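(* Let $G$ be a non-abelian group which is one of $D_{2n}$ ($n\ge 3$), $T_{4n}$ ($n \ge 2$), $U_{6n}$ ($n\ge 2$), $SD_{8n}$ ($n\ge 2$) or $U_{(n,m)}$ ($n\ge 2$, $m\ge 2$), and let $\Gamma_G$ be its commuting conjugacy class graph. Then: (1) $\Gamma_G$ is CNL-borderenergetic if and only if $G$ is $D_6$, $D_{22}$ or $U_{(n,2)}$ for some $n \ge 2$. (2) $\Gamma_G$ is CNL-hyperenergetic if and only if $G$ is one of: $D_{2n}$ with $n\ge 13$; $T_{4n}$ with $n \ge 7$; $SD_{8n}$ with $n\ge 4$; $U_{(n,m)}$ except for [$m=3$ and $n\ge 2$], [$m=5$ and $n\in\{2,3\}$], [$m=4$ and $n\ge 2$], [$m=8$ and $n=2$], and [$m=6$ and $n\ge 2$]. (3) $\Gamma_G$ is CNSL-borderenergetic if and only if $G$ is $D_6$ or $U_{(n,2)}$ for some $n\ge 2$. (4) $\Gamma_G$ is CNSL-hyperenergetic if and only if $G$ is one of: $D_{2n}$ with $n$ even and $n\ge 20$; $T_{4n}$ with $n\ge 10$; $SD_{8n}$ with $n\ge 6$; $U_{(n,m)}$ except for [$m=3$ and $n\ge 2$], [$m\in\{5,7,9\}$ and $n=2$], [$m=5$ and $n\in\{3,4\}$], [$m=4$ and $n\ge 2$], [$m=8$ and $n=2$], [$m=6$ and $n\ge 2$], and [$m=10$ and $n=2$].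
   Context: For a finite non-abelian group $G$ with center $Z(G)$, the commuting conjugacy class graph (CCC-graph) $\Gamma_G$ is the simple undirected graph whose vertices are the conjugacy classes $x^G$ of non-central elements $x \in G \setminus Z(G)$; two distinct vertices $x^G, y^G$ are adjacent if there exist $x' \in x^G$ and $y' \in y^G$ with $x'y' = y'x'$. For a finite simple graph $\mathcal{G}$ with vertices $v_1,\dots,v_N$, let $CN(\mathcal{G})$ be the $N\times N$ matrix whose $(i,j)$ entry is, for $i\ne j$, the number of vertices other than $v_i,v_j$ adjacent to both $v_i$ and $v_j$, and whose diagonal entries are $0$. Let $CNRS(\mathcal{G})$ be the diagonal matrix whose $i$-th diagonal entry is the $i$-th row sum of $CN(\mathcal{G})$. Put $CNL(\mathcal{G}) = CNRS(\mathcal{G}) - CN(\mathcal{G})$, $CNSL(\mathcal{G}) = CNRS(\mathcal{G}) + CN(\mathcal{G})$ and $\Delta(\mathcal{G}) = \operatorname{tr}(CNRS(\mathcal{G}))/N$. Then $LE_{CN}(\mathcal{G}) = \sum_{\alpha} |\alpha - \Delta(\mathcal{G})|$ over all eigenvalues $\alpha$ of $CNL(\mathcal{G})$ with multiplicity, and $LE^+_{CN}(\mathcal{G}) = \sum_{\beta} |\beta - \Delta(\mathcal{G})|$ over all eigenvalues $\beta$ of $CNSL(\mathcal{G})$ with multiplicity. A graph $\mathcal{G}$ of order $N$ is CNL-hyperenergetic (respectively CNL-borderenergetic) if $LE_{CN}(\mathcal{G}) > 2(N-1)(N-2)$ (respectively $LE_{CN}(\mathcal{G}) = 2(N-1)(N-2)$),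 and CNSL-hyperenergetic (respectively CNSL-borderenergetic) if $LE^+_{CN}(\mathcal{G}) > 2(N-1)(N-2)$ (respectively $LE^+_{CN}(\mathcal{G}) = 2(N-1)(N-2)$). Groups: $D_{2n}=\langle x,y : x^n=y^2=1,\ yxy^{-1}=x^{-1}\rangle$; $T_{4n}=\langle x,y : x^{2n}=1,\ x^n=y^2,\ y^{-1}xy=x^{-1}\rangle$; $U_{6n}=\langle x,y : x^{2n}=y^3=1,\ x^{-1}yx=y^{-1}\rangle$; $U_{(n,m)}=\langle x,y : x^{2n}=y^m=1,\ x^{-1}yx=y^{-1}\rangle$; $SD_{8n}=\langle x,y : x^{4n}=y^2=1,\ yxy=x^{2n-1}\rangle$. *)

theory Defs
  imports
    "HOL-Algebra.Coset"
    "Jordan_Normal_Form.Spectral_Radius"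
    "Graph_Theory.Pair_Digraph"
begin

section \<open>Groups given by generators and relations\<close>

text \<open>A letter \<open>(g, True)\<close> stands for the generator \<open>g\<close>, and \<open>(g, False)\<close> for its formal inverse.\<close>

type_synonym 'g word = "('g \<times> bool) list"

definition word_inv :: "'g word \<Rightarrow> 'g word" where
  "word_inv w = map (\<lambda>(g, b). (g, \<not> b)) (rev w)"

definition word_pow :: "'g word \<Rightarrow> nat \<Rightarrow> 'g word" where
  "word_pow w k = concat (replicate k w)"

text \<open>The least congruence on words that contains the relations \<open>u = v\<close> for \<open>(u, v) \<in> R\<close> and makes
  mutually inverse letters cancel.\<close>

inductive pres_eq :: "('g word \<times> 'g word) set \<Rightarrow> 'g word \<Rightarrow> 'g word \<Rightarrow> bool"
  for R :: "('g word \<times> 'g word) set" where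
  relation: "(u, v) \<in> R \<Longrightarrow> pres_eq R u v"
| cancel: "pres_eq R [(g, b), (g, \<not> b)] []"
| refl: "pres_eq R u u"
| sym: "pres_eq R u v \<Longrightarrow> pres_eq R v u"
| trans: "pres_eq R u v \<Longrightarrow> pres_eq R v w \<Longrightarrow> pres_eq R u w"
| append: "pres_eq R u u' \<Longrightarrow> pres_eq R v v' \<Longrightarrow> pres_eq R (u @ v) (u' @ v')"

definition pres_rel :: "('g word \<times> 'g word) set \<Rightarrow> ('g word \<times> 'g word) set" where
  "pres_rel R = {(u, v). pres_eq R u v}"

text \<open>The generators are all elements of the type \<open>'g\<close>.\<close>

definition presented_group :: "('g word \<times> 'g word) set \<Rightarrow> 'g word set monoid" where
  "presented_group R =
     \<lparr>carrier = UNIV // pres_rel R,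
      mult = (\<lambda>A B. \<Union>u\<in>A. \<Union>v\<in>B. pres_rel R `` {u @ v}),
      one = pres_rel R `` {[]}\<rparr>"

lemma equiv_pres_rel: "equiv UNIV (pres_rel R)"
  by (rule equivI)
    (auto simp: pres_rel_def refl_on_def sym_def trans_def
      intro: pres_eq.refl pres_eq.sym pres_eq.trans)

lemma presented_group_mult:
  "(pres_rel R `` {u}) \<otimes>\<^bsub>presented_group R\<^esub> (pres_rel R `` {v}) = pres_rel R `` {u @ v}"
proof -
  have "congruent2 (pres_rel R) (pres_rel R) (\<lambda>u v. pres_rel R `` {u @ v})"
    by (rule congruent2I', rule equiv_class_eq[OF equiv_pres_rel])
      (simp add: pres_rel_def pres_eq.append)
  from UN_equiv_class2[OF equiv_pres_rel equiv_pres_rel this, of u v] show ?thesis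
    by (simp add: presented_group_def)
qed

lemma pres_eq_word_inv: "pres_eq R (word_inv w @ w) []"
proof (induction w)
  case Nil
  then show ?case by (simp add: word_inv_def pres_eq.refl)
next
  case (Cons a w)
  obtain g b where a: "a = (g, b)" by force
  have "pres_eq R [(g, \<not> b), (g, b)] []"
    using pres_eq.cancel[of R g "\<not> b"] by simp
  then have "pres_eq R (word_inv w @ [(g, \<not> b), (g, b)] @ w) (word_inv w @ [] @ w)"
    by (intro pres_eq.append pres_eq.refl)
  with Cons.IH show ?case
    by (auto simp: word_inv_def a intro: pres_eq.trans)
qed

lemma group_presented_group: "group (presented_group R)"
proof (rule groupI)
  fix A assume "A \<in> carrier (presented_group R)"
  then obtain w where A: "A = pres_rel R `` {w}"
    by (auto simp: presented_group_def elim: quotientE)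
  have "pres_rel R `` {word_inv w @ w} = pres_rel R `` {[]}"
    using pres_eq_word_inv[of R w] by (intro equiv_class_eq[OF equiv_pres_rel]) (simp add: pres_rel_def)
  then have "(pres_rel R `` {word_inv w}) \<otimes>\<^bsub>presented_group R\<^esub> A = \<one>\<^bsub>presented_group R\<^esub>"
    unfolding A presented_group_mult by (simp add: presented_group_def)
  then show "\<exists>B\<in>carrier (presented_group R). B \<otimes>\<^bsub>presented_group R\<^esub> A = \<one>\<^bsub>presented_group R\<^esub>"
    by (rule bexI) (simp add: presented_group_def quotientI)
next
  have one: "\<one>\<^bsub>presented_group R\<^esub> = pres_rel R `` {[]}"
    and car: "carrier (presented_group R) = UNIV // pres_rel R"
    by (simp_all add: presented_group_def)
  show "\<one>\<^bsub>presented_group R\<^esub> \<in> carrier (presented_group R)"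
    by (simp add: one car quotientI)
  fix A assume "A \<in> carrier (presented_group R)"
  then obtain u where A: "A = pres_rel R `` {u}" by (auto simp: car elim: quotientE)
  show "\<one>\<^bsub>presented_group R\<^esub> \<otimes>\<^bsub>presented_group R\<^esub> A = A"
    by (simp add: one A presented_group_mult)
  fix B assume "B \<in> carrier (presented_group R)"
  then obtain v where B: "B = pres_rel R `` {v}" by (auto simp: car elim: quotientE)
  show "A \<otimes>\<^bsub>presented_group R\<^esub> B \<in> carrier (presented_group R)"
    by (simp add: A B presented_group_mult car quotientI)
  fix C assume "C \<in> carrier (presented_group R)"
  then obtain w where C: "C = pres_rel R `` {w}" by (auto simp: car elim: quotientE)
  show "A \<otimes>\<^bsub>presented_group R\<^esub> B \<otimes>\<^bsub>presented_group R\<^esub> C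
      = A \<otimes>\<^bsub>presented_group R\<^esub> (B \<otimes>\<^bsub>presented_group R\<^esub> C)"
    by (simp add: A B C presented_group_mult)
qed


section \<open>The five families of groups\<close>

datatype gen = Gen_x | Gen_y

abbreviation wx :: "gen word" where "wx \<equiv> [(Gen_x, True)]"
abbreviation wy :: "gen word" where "wy \<equiv> [(Gen_y, True)]"

text \<open>The argument of the first four functions is the parameter \<open>n\<close>, not the index of the usual
  notation: \<open>grp_D n\<close> is \<open>D\<^sub>2\<^sub>n\<close>, \<open>grp_T n\<close> is \<open>T\<^sub>4\<^sub>n\<close>, \<open>grp_U6 n\<close> is \<open>U\<^sub>6\<^sub>n\<close>, \<open>grp_SD n\<close> is \<open>SD\<^sub>8\<^sub>n\<close>;
  \<open>grp_U n m\<close> is \<open>U\<close> with index \<open>(n, m)\<close>.\<close>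

definition grp_D :: "nat \<Rightarrow> gen word set monoid" where
  "grp_D n = presented_group
     {(word_pow wx n, []), (word_pow wy 2, []), (wy @ wx @ word_inv wy, word_inv wx)}"

definition grp_T :: "nat \<Rightarrow> gen word set monoid" where
  "grp_T n = presented_group
     {(word_pow wx (2 * n), []), (word_pow wx n, word_pow wy 2),
      (word_inv wy @ wx @ wy, word_inv wx)}"

definition grp_U6 :: "nat \<Rightarrow> gen word set monoid" where
  "grp_U6 n = presented_group
     {(word_pow wx (2 * n), []), (word_pow wy 3, []), (word_inv wx @ wy @ wx, word_inv wy)}"

definition grp_U :: "nat \<Rightarrow> nat \<Rightarrow> gen word set monoid" where
  "grp_U n m = presented_group
     {(word_pow wx (2 * n), []), (word_pow wy m, []), (word_inv wx @ wy @ wx, word_inv wy)}"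

definition grp_SD :: "nat \<Rightarrow> gen word set monoid" where
  "grp_SD n = presented_group
     {(word_pow wx (4 * n), []), (word_pow wy 2, []), (wy @ wx @ wy, word_pow wx (2 * n - 1))}"


section \<open>The commuting conjugacy class graph\<close>

definition grp_center :: "('a, 'b) monoid_scheme \<Rightarrow> 'a set" where
  "grp_center G = {z \<in> carrier G. \<forall>g\<in>carrier G. z \<otimes>\<^bsub>G\<^esub> g = g \<otimes>\<^bsub>G\<^esub> z}"

definition conj_class :: "('a, 'b) monoid_scheme \<Rightarrow> 'a \<Rightarrow> 'a set" where
  "conj_class G x = {g \<otimes>\<^bsub>G\<^esub> x \<otimes>\<^bsub>G\<^esub> inv\<^bsub>G\<^esub> g | g. g \<in> carrier G}"

text \<open>An undirected simple graph is represented, as in \<^theory>\<open>Graph_Theory.Pair_Digraph\<close>, by a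
  symmetric irreflexive set of ordered pairs (locale \<^locale>\<open>pair_graph\<close>).\<close>

definition ccc_graph :: "('a, 'b) monoid_scheme \<Rightarrow> 'a set pair_pre_digraph" where
  "ccc_graph G =
     (let V = conj_class G ` (carrier G - grp_center G) in
      \<lparr>pverts = V,
       parcs = {(A, B). A \<in> V \<and> B \<in> V \<and> A \<noteq> B \<and>
                  (\<exists>x'\<in>A. \<exists>y'\<in>B. x' \<otimes>\<^bsub>G\<^esub> y' = y' \<otimes>\<^bsub>G\<^esub> x')}\<rparr>)"

lemma pair_graph_ccc_graph:
  assumes "finite (carrier G)"
  shows "pair_graph (ccc_graph G)"
proof
  let ?V = "conj_class G ` (carrier G - grp_center G)"
  have V: "finite ?V" using assms by simp
  have "parcs (ccc_graph G) \<subseteq> ?V \<times> ?V"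
    by (auto simp: ccc_graph_def Let_def)
  with V show "finite (parcs (ccc_graph G))" by (meson finite_SigmaI finite_subset)
  from V show "finite (pverts (ccc_graph G))" by (simp add: ccc_graph_def)
  show "symmetric (with_proj (ccc_graph G))"
    unfolding symmetric_def
    by (rule symI) (auto simp: ccc_graph_def Let_def, (metis)+)
qed (auto simp: ccc_graph_def Let_def)


section \<open>Common neighbourhood Laplacian and signless Laplacian energies\<close>

text \<open>The vertices are numbered in an arbitrary order; the characteristic polynomials below do not
  depend on the choice.\<close>

definition vertex_list :: "'v pair_pre_digraph \<Rightarrow> 'v list" where
  "vertex_list \<Gamma> = (SOME vs. distinct vs \<and> set vs = pverts \<Gamma>)"

definition graph_order :: "'v pair_pre_digraph \<Rightarrow> nat" where
  "graph_order \<Gamma> = card (pverts \<Gamma>)"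

definition common_nbrs :: "'v pair_pre_digraph \<Rightarrow> 'v \<Rightarrow> 'v \<Rightarrow> 'v set" where
  "common_nbrs \<Gamma> u v =
     {w \<in> pverts \<Gamma>. w \<noteq> u \<and> w \<noteq> v \<and> (u, w) \<in> parcs \<Gamma> \<and> (v, w) \<in> parcs \<Gamma>}"

definition CN :: "'v pair_pre_digraph \<Rightarrow> real mat" where
  "CN \<Gamma> = mat (graph_order \<Gamma>) (graph_order \<Gamma>)
     (\<lambda>(i, j). if i = j then 0
               else real (card (common_nbrs \<Gamma> (vertex_list \<Gamma> ! i) (vertex_list \<Gamma> ! j))))"

definition CNRS :: "'v pair_pre_digraph \<Rightarrow> real mat" where
  "CNRS \<Gamma> = mat_diag (graph_order \<Gamma>) (\<lambda>i. \<Sum>j<graph_order \<Gamma>. CN \<Gamma> $$ (i, j))"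

definition CNL :: "'v pair_pre_digraph \<Rightarrow> real mat" where
  "CNL \<Gamma> = CNRS \<Gamma> - CN \<Gamma>"

definition CNSL :: "'v pair_pre_digraph \<Rightarrow> real mat" where
  "CNSL \<Gamma> = CNRS \<Gamma> + CN \<Gamma>"

definition mat_trace :: "real mat \<Rightarrow> real" where
  "mat_trace A = (\<Sum>i<dim_row A. A $$ (i, i))"

definition CN_Delta :: "'v pair_pre_digraph \<Rightarrow> real" where
  "CN_Delta \<Gamma> = mat_trace (CNRS \<Gamma>) / real (graph_order \<Gamma>)"

text \<open>\<open>\<Sum>\<^sub>\<alpha> \<bar>\<alpha> - d\<bar>\<close> over the real eigenvalues \<open>\<alpha>\<close> of \<open>A\<close>, each counted with its (algebraic)
  multiplicity.  It is only applied to the symmetric matrices \<open>CNL \<Gamma>\<close> and \<open>CNSL \<Gamma>\<close>, all of whose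
  complex eigenvalues are real.  Note that \<^const>\<open>Polynomial.order\<close> is the multiplicity of a root,
  not the order of a group.\<close>

definition eigenvalue_deviation :: "real mat \<Rightarrow> real \<Rightarrow> real" where
  "eigenvalue_deviation A d =
     (\<Sum>\<alpha>\<in>spectrum A. real (Polynomial.order \<alpha> (char_poly A)) * \<bar>\<alpha> - d\<bar>)"

definition LE_CN :: "'v pair_pre_digraph \<Rightarrow> real" where
  "LE_CN \<Gamma> = eigenvalue_deviation (CNL \<Gamma>) (CN_Delta \<Gamma>)"

definition LE_CN_plus :: "'v pair_pre_digraph \<Rightarrow> real" where
  "LE_CN_plus \<Gamma> = eigenvalue_deviation (CNSL \<Gamma>) (CN_Delta \<Gamma>)"

definition energy_bound :: "'v pair_pre_digraph \<Rightarrow> real" where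
  "energy_bound \<Gamma> = 2 * (real (graph_order \<Gamma>) - 1) * (real (graph_order \<Gamma>) - 2)"

definition CNL_hyperenergetic :: "'v pair_pre_digraph \<Rightarrow> bool" where
  "CNL_hyperenergetic \<Gamma> \<longleftrightarrow> LE_CN \<Gamma> > energy_bound \<Gamma>"

definition CNL_borderenergetic :: "'v pair_pre_digraph \<Rightarrow> bool" where
  "CNL_borderenergetic \<Gamma> \<longleftrightarrow> LE_CN \<Gamma> = energy_bound \<Gamma>"

definition CNSL_hyperenergetic :: "'v pair_pre_digraph \<Rightarrow> bool" where
  "CNSL_hyperenergetic \<Gamma> \<longleftrightarrow> LE_CN_plus \<Gamma> > energy_bound \<Gamma>"

definition CNSL_borderenergetic :: "'v pair_pre_digraph \<Rightarrow> bool" where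
  "CNSL_borderenergetic \<Gamma> \<longleftrightarrow> LE_CN_plus \<Gamma> = energy_bound \<Gamma>"

end

theory Submission
  imports Defs
begin

text \<open>Every group \<open>G\<close> in the five families has a cyclic normal subgroup generated by some \<open>c\<close> of order
\<open>N\<close> and a further generator \<open>d\<close> with \<open>d\<^sup>K = c\<^sup>t\<close> and \<open>d c = c\<^sup>s d\<close>, where \<open>K\<close> is even and
\<open>s\<^sup>2 \<equiv> 1 (mod N)\<close>. For \<open>D\<close>, \<open>T\<close> and \<open>U\<close> the exponent is \<open>s = -1\<close>, for \<open>SD\<close> it is \<open>s = 2n - 1\<close>.
The relations alone give that each element is some \<open>c\<^sup>i d\<^sup>k\<close> with \<open>0 \<le> i < N\<close> and \<open>0 \<le> k < K\<close>; that
these \<open>N K\<close> elements are distinct needs a model, the group \<open>M\<close> of pairs \<open>(i, k)\<close>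
(\<open>presented_group_iso_M\<close>).

In \<open>M\<close> the square of \<open>d\<close> is central, so conjugation only sees the parity of \<open>k\<close>. Put
\<open>g = gcd (1 - s, N)\<close> and \<open>q = N / g\<close>. Non-central elements with \<open>k\<close> even commute with each other, never
with elements with \<open>k\<close> odd, and form classes of size \<open>2\<close>; elements with \<open>k\<close> odd form classes of size \<open>q\<close>,
and two such classes contain commuting elements exactly if the exponents \<open>i\<close> agree modulo
\<open>e = gcd (g, q)\<close> (\<open>commuting_representatives_iff\<close>). Hence the commuting conjugacy class graph is a disjoint
union of one clique with \<open>a = (N - g) K / 4\<close> vertices and \<open>e\<close> cliques with \<open>b = g K / (2 e)\<close> vertices each
(\<open>clique_type_M\<close>). In all cases at hand \<open>e\<close> is \<open>1\<close> or \<open>2\<close>.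

For a disjoint union of cliques the common neighbourhood matrices are block matrices with blocks of the form
\<open>\<alpha> I + \<beta> J\<close>. A clique with \<open>k\<close> vertices contributes to \<open>CNL\<close> the eigenvalue \<open>0\<close> once and \<open>k (k - 2)\<close> with
multiplicity \<open>k - 1\<close>, and to \<open>CNSL\<close> the eigenvalue \<open>2 (k - 1) (k - 2)\<close> once and \<open>(k - 2)\<^sup>2\<close> with
multiplicity \<open>k - 1\<close> (\<open>clique_union_LE_CN\<close>, \<open>clique_union_LE_CN_plus\<close>). Both energies are therefore
explicit functions of \<open>(a, e, b)\<close>.

It remains to compare them with \<open>2 (v - 1) (v - 2)\<close>, where \<open>v = a + e b\<close>. The deviations of the eigenvalues
from their mean add up to \<open>0\<close>, so the sum of their absolute values is at least twice the sum of the deviations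
over any part of the spectrum. Taking positive signs on the nonzero eigenvalues of the large clique and negative
signs elsewhere gives a lower bound that is a rational function without absolute values, and this bound already exceeds
\<open>2 (v - 1) (v - 2)\<close> whenever the graph is hyperenergetic. The parameters that are left over are finitely many
numerical cases, the unions of equal cliques, and one clique plus an isolated vertex (\<open>D\<^sub>2\<^sub>n\<close> with \<open>n\<close> odd);
only the last kind attains equality.

Some groups belong to several families, for example \<open>T\<^sub>4\<^sub>n\<close> with \<open>n\<close> odd is isomorphic to \<open>U\<close> with index
\<open>(2, n)\<close>. Since the energies depend on \<open>G\<close> only up to isomorphism, it suffices to decide, for each family
and each parameter, whether the graph is hyper- or borderenergetic.\<close>

section \<open>Spectra of block matrices\<close>

lemma order_prod_linear_factors:
  fixes h :: "'i \<Rightarrow> real"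
  assumes "finite I"
  shows "Polynomial.order \<alpha> (\<Prod>i\<in>I. [:- h i, 1:]) = card {i \<in> I. h i = \<alpha>}"
  using assms
proof (induction I)
  case empty
  then show ?case by simp
next
  case (insert j I)
  have nz: "[:- h j, 1:] * (\<Prod>i\<in>I. [:- h i, 1:]) \<noteq> 0"
    by (rule no_zero_divisors) (use insert.hyps in \<open>auto simp: prod_zero_iff\<close>)
  have lin: "Polynomial.order \<alpha> [:- h j, 1:] = (if h j = \<alpha> then 1 else 0)"
    using order_linear_power[of \<alpha> "- h j" "Suc 0"] by auto
  have set: "{i \<in> insert j I. h i = \<alpha>} =
      (if h j = \<alpha> then insert j {i \<in> I. h i = \<alpha>} else {i \<in> I. h i = \<alpha>})"
    by (cases "h j = \<alpha>") auto
  have "Polynomial.order \<alpha> (\<Prod>i\<in>insert j I. [:- h i, 1:]) =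
      Polynomial.order \<alpha> [:- h j, 1:] + Polynomial.order \<alpha> (\<Prod>i\<in>I. [:- h i, 1:])"
    by (simp only: prod.insert[OF insert.hyps] order_mult[OF nz])
  then show ?case
    unfolding insert.IH lin set using insert.hyps by auto
qed

text \<open>Once the characteristic polynomial is split into linear factors, the sum over the spectrum with
algebraic multiplicities becomes a sum over the factors.\<close>

lemma eigenvalue_deviation_char_poly:
  assumes A: "A \<in> carrier_mat n n"
    and cp: "char_poly A = (\<Prod>i<n. [:- h i, 1:])"
  shows "eigenvalue_deviation A d = (\<Sum>i<n. \<bar>h i - d\<bar>)"
proof -
  have "spectrum A = h ` {..<n}"
    by (auto simp: spectrum_def eigenvalue_root_char_poly[OF A] cp poly_prod prod_zero_iff)
  then show ?thesis
    unfolding eigenvalue_deviation_def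
    by (simp add: cp order_prod_linear_factors
        sum.image_gen[of "{..<n}" "\<lambda>i. \<bar>h i - d\<bar>" h])
qed

text \<open>Up to a reordering of the indices, the matrix is block diagonal with blocks \<open>\<alpha> I + \<beta> J\<close>, where \<open>J\<close> is the
all-ones matrix. Instead of reordering, replace the basis vector of the least index of every class by the
indicator vector of that class, which is an eigenvector with eigenvalue \<open>\<alpha> + k \<beta>\<close> for a class of size \<open>k\<close>.
Every other basis vector is mapped to \<open>\<alpha>\<close> times itself plus \<open>\<beta>\<close> times the indicator vector of its class,
and the latter comes earlier. So the matrix becomes upper triangular in the new basis.\<close>

lemma char_poly_class_constant:
  fixes cls :: "nat \<Rightarrow> 'c" and \<alpha> \<beta> :: "'c \<Rightarrow> real"
  defines "blk \<equiv> \<lambda>n i. {j \<in> {..<n}. cls j = cls i}"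
  defines "A \<equiv> \<lambda>n. mat n n (\<lambda>(i, j). if i = j then \<alpha> (cls i) + \<beta> (cls i)
                                else if cls i = cls j then \<beta> (cls i) else 0)"
  shows "char_poly (A n) =
    (\<Prod>i<n. [:- (if i = Min (blk n i) then \<alpha> (cls i) + real (card (blk n i)) * \<beta> (cls i)
                 else \<alpha> (cls i)), 1:])"
proof -
  define rep where "rep = (\<lambda>i. Min (blk n i))"
  have fin: "finite (blk n i)" for i by (simp add: blk_def)
  have blk_eq: "blk n i = blk n j" if "cls i = cls j" for i j
    using that by (simp add: blk_def)
  have rep: "rep i \<le> i" "rep i < n" "cls (rep i) = cls i" "rep (rep i) = rep i" if "i < n" for i
  proof -
    have ne: "i \<in> blk n i" using that by (simp add: blk_def)
    show "rep i \<le> i" using Min_le[OF fin ne] by (simp add: rep_def)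
    have "rep i \<in> blk n i" unfolding rep_def by (rule Min_in[OF fin]) (use ne in auto)
    then show "rep i < n" and c: "cls (rep i) = cls i" by (auto simp: blk_def)
    show "rep (rep i) = rep i" using blk_eq[OF c] by (simp add: rep_def)
  qed
  have rep_cls: "rep i = rep j \<longleftrightarrow> cls i = cls j" if "i < n" "j < n" for i j
    using rep(3)[OF that(1)] rep(3)[OF that(2)] blk_eq[of i j] by (auto simp: rep_def)
  \<comment> \<open>The columns of \<open>P\<close> are the new basis, and \<open>T\<close> is the matrix in that basis.\<close>
  define P where "P = mat n n (\<lambda>(i, j). if i = j \<or> j = rep i then 1 else (0 :: real))"
  define T where "T = mat n n (\<lambda>(i, j).
    if i = j then (if i = rep i then \<alpha> (cls i) + real (card (blk n i)) * \<beta> (cls i) else \<alpha> (cls i))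
    else if i = rep j then \<beta> (cls i) else 0)"
  have carr: "P \<in> carrier_mat n n" "T \<in> carrier_mat n n" "A n \<in> carrier_mat n n"
    by (auto simp: P_def T_def A_def)
  have "det P = prod_list (diag_mat P)"
  proof (rule det_lower_triangular[OF _ carr(1)])
    fix i j assume "i < j" "j < n"
    moreover from this have "j \<noteq> rep i" using rep(1)[of i] by linarith
    ultimately show "P $$ (i, j) = 0" by (simp add: P_def)
  qed
  also have "\<dots> = 1"
    by (auto simp: diag_mat_def P_def prod_list_diag_prod intro!: prod_list_neutral)
  finally have "det P \<noteq> 0" by simp
  then obtain Q where Q: "Q \<in> carrier_mat n n" "P * Q = 1\<^sub>m n" "Q * P = 1\<^sub>m n"
    using det_non_zero_imp_unit[OF carr(1), of undefined]
    by (auto simp: Units_def ring_mat_def)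
  have comm: "A n * P = P * T"
  proof (rule eq_matI)
    fix i j assume "i < dim_row (P * T)" "j < dim_col (P * T)"
    then have i: "i < n" and j: "j < n" using carr by auto
    have PT: "(P * T) $$ (i, j) = (\<Sum>l<n. P $$ (i, l) * T $$ (l, j))"
      using i j carr by (simp add: scalar_prod_def atLeast0LessThan)
    have AP: "(A n * P) $$ (i, j) = (\<Sum>l<n. A n $$ (i, l) * P $$ (l, j))"
      using i j carr by (simp add: scalar_prod_def atLeast0LessThan)
    have "(\<Sum>l<n. P $$ (i, l) * T $$ (l, j)) = (\<Sum>l\<in>{i, rep i}. P $$ (i, l) * T $$ (l, j))"
      using i rep(2)[OF i] by (intro sum.mono_neutral_right) (auto simp: P_def)
    also have "\<dots> = (\<Sum>l\<in>{i, rep i}. T $$ (l, j))"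
      using i rep(2)[OF i] by (intro sum.cong) (auto simp: P_def)
    finally have PT': "(P * T) $$ (i, j) = (\<Sum>l\<in>{i, rep i}. T $$ (l, j))" using PT by simp
    show "(A n * P) $$ (i, j) = (P * T) $$ (i, j)"
    proof (cases "j = rep j")
      case True
      have "(\<Sum>l<n. A n $$ (i, l) * P $$ (l, j)) = (\<Sum>l\<in>blk n j. A n $$ (i, l) * P $$ (l, j))"
        using rep_cls[OF _ j] True j
        by (intro sum.mono_neutral_right) (auto simp: P_def blk_def)
      also have "\<dots> = (\<Sum>l\<in>blk n j. A n $$ (i, l))"
        using rep_cls[OF _ j] True j
        by (intro sum.cong) (auto simp: P_def blk_def)
      also have "\<dots> = (if cls i = cls j then \<alpha> (cls i) + real (card (blk n i)) * \<beta> (cls i) else 0)"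
      proof (cases "cls i = cls j")
        case c: True
        have ib: "i \<in> blk n i" using i by (simp add: blk_def)
        have "(\<Sum>l\<in>blk n j. A n $$ (i, l)) =
            (\<Sum>l\<in>blk n i. \<beta> (cls i) + (if l = i then \<alpha> (cls i) else 0))"
          unfolding blk_eq[OF c] using i c by (intro sum.cong) (auto simp: A_def blk_def)
        then show ?thesis using ib c by (simp add: sum.distrib sum.delta fin)
      next
        case False
        then show ?thesis using i by (auto simp: A_def blk_def intro!: sum.neutral)
      qed
      also have "\<dots> = (\<Sum>l\<in>{i, rep i}. T $$ (l, j))"
      proof (cases "i = rep i")
        case ri: True
        then show ?thesis
          using i j True rep_cls[OF i j] by (auto simp: T_def)
      next
        case False
        then show ?thesis
          using i j True rep_cls[OF i j] rep[OF i] blk_eq[of i j] by (auto simp: T_def)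
      qed
      finally show ?thesis using AP PT' by simp
    next
      case False
      have "(\<Sum>l<n. A n $$ (i, l) * P $$ (l, j)) = (\<Sum>l\<in>{j}. A n $$ (i, l) * P $$ (l, j))"
        using False j rep(4) by (intro sum.mono_neutral_right) (auto simp: P_def)
      also have "\<dots> = A n $$ (i, j)" using j by (simp add: P_def)
      also have "\<dots> = (\<Sum>l\<in>{i, rep i}. T $$ (l, j))"
      proof (cases "i = rep i")
        case ri: True
        then show ?thesis
          using i j False rep_cls[OF i j] rep[OF j] by (auto simp: T_def A_def)
      next
        case ri: False
        then show ?thesis
          using i j False rep_cls[OF i j] rep[OF i] rep[OF j] by (auto simp: T_def A_def)
      qed
      finally show ?thesis using AP PT' by simp
    qed
  qed (use carr in auto)
  have "A n = A n * (P * Q)" using Q carr by simp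
  also have "\<dots> = A n * P * Q" using Q carr by simp
  also have "\<dots> = P * T * Q" by (simp add: comm)
  finally have "similar_mat (A n) T"
    unfolding similar_mat_def using similar_mat_witI[OF Q(2,3)] carr Q(1) by blast
  then have "char_poly (A n) = char_poly T" by (rule char_poly_similar)
  also have "\<dots> = (\<Prod>a\<leftarrow>diag_mat T. [:- a, 1:])"
  proof (rule char_poly_upper_triangular[OF carr(2)])
    have "T $$ (i, j) = 0" if "j < i" "i < n" for i j
    proof -
      have "i \<noteq> rep j" using rep(1)[of j] that by linarith
      with that show ?thesis by (simp add: T_def)
    qed
    then show "upper_triangular T" using carr(2) by (auto simp: upper_triangular_def)
  qed
  also have "\<dots> = (\<Prod>i<n. [:- T $$ (i, i), 1:])"
    using carr(2) by (simp add: diag_mat_def o_def interv_sum_list_conv_sum_set_nat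
        prod.list_conv_set_nth atLeast0LessThan)
  also have "\<dots> = (\<Prod>i<n. [:- (if i = Min (blk n i) then \<alpha> (cls i) + real (card (blk n i)) * \<beta> (cls i)
                 else \<alpha> (cls i)), 1:])"
    by (rule prod.cong) (auto simp: T_def rep_def)
  finally show ?thesis .
qed


lemma eigenvalue_deviation_class_constant:
  fixes cls :: "nat \<Rightarrow> 'c" and \<alpha> \<beta> :: "'c \<Rightarrow> real" and n :: nat
  defines "k \<equiv> \<lambda>c. real (card {j \<in> {..<n}. cls j = c})"
  assumes A: "A = mat n n (\<lambda>(i, j). if i = j then \<alpha> (cls i) + \<beta> (cls i)
                                else if cls i = cls j then \<beta> (cls i) else 0)"
  shows "eigenvalue_deviation A d =
    (\<Sum>c\<in>cls ` {..<n}. \<bar>\<alpha> c + k c * \<beta> c - d\<bar> + (k c - 1) * \<bar>\<alpha> c - d\<bar>)"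
proof -
  define blk where "blk = (\<lambda>c. {j \<in> {..<n}. cls j = c})"
  define h where "h = (\<lambda>i. if i = Min (blk (cls i)) then \<alpha> (cls i) + k (cls i) * \<beta> (cls i)
                           else \<alpha> (cls i))"
  have "A \<in> carrier_mat n n" by (simp add: A)
  moreover have "char_poly A = (\<Prod>i<n. [:- h i, 1:])"
    unfolding A char_poly_class_constant h_def blk_def k_def ..
  ultimately have "eigenvalue_deviation A d = (\<Sum>i<n. \<bar>h i - d\<bar>)"
    by (rule eigenvalue_deviation_char_poly)
  also have "\<dots> = (\<Sum>c\<in>cls ` {..<n}. \<Sum>i\<in>blk c. \<bar>h i - d\<bar>)"
    unfolding blk_def by (rule sum.image_gen) simp
  also have "\<dots> = (\<Sum>c\<in>cls ` {..<n}. \<bar>\<alpha> c + k c * \<beta> c - d\<bar> + (k c - 1) * \<bar>\<alpha> c - d\<bar>)"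
  proof (rule sum.cong[OF HOL.refl])
    fix c assume "c \<in> cls ` {..<n}"
    then have ne: "blk c \<noteq> {}" and fin: "finite (blk c)" by (auto simp: blk_def)
    have m: "Min (blk c) \<in> blk c" by (rule Min_in[OF fin ne])
    have k_blk: "k c = real (card (blk c))" by (simp add: k_def blk_def)
    have cls: "cls i = c" if "i \<in> blk c" for i using that by (simp add: blk_def)
    have "(\<Sum>i\<in>blk c. \<bar>h i - d\<bar>) =
        \<bar>h (Min (blk c)) - d\<bar> + (\<Sum>i\<in>blk c - {Min (blk c)}. \<bar>h i - d\<bar>)"
      by (rule sum.remove[OF fin m])
    also have "(\<Sum>i\<in>blk c - {Min (blk c)}. \<bar>h i - d\<bar>) =
        (\<Sum>i\<in>blk c - {Min (blk c)}. \<bar>\<alpha> c - d\<bar>)"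
      by (rule sum.cong) (auto simp: h_def cls)
    also have "\<dots> = (k c - 1) * \<bar>\<alpha> c - d\<bar>"
      using m fin ne by (simp add: card_Diff_singleton k_blk of_nat_diff Suc_le_eq card_gt_0_iff)
    also have "h (Min (blk c)) = \<alpha> c + k c * \<beta> c"
      by (simp add: h_def cls[OF m])
    finally show "(\<Sum>i\<in>blk c. \<bar>h i - d\<bar>) =
        \<bar>\<alpha> c + k c * \<beta> c - d\<bar> + (k c - 1) * \<bar>\<alpha> c - d\<bar>" .
  qed
  finally show ?thesis .
qed

section \<open>Common neighbourhood energies of disjoint unions of cliques\<close>

text \<open>\<open>f\<close> names the clique of a vertex: two distinct vertices are adjacent exactly if \<open>f\<close> agrees on them.\<close>

definition clique_union :: "'v pair_pre_digraph \<Rightarrow> ('v \<Rightarrow> 'c) \<Rightarrow> bool" where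
  "clique_union \<Gamma> f \<longleftrightarrow> finite (pverts \<Gamma>) \<and>
     parcs \<Gamma> = {(u, v). u \<in> pverts \<Gamma> \<and> v \<in> pverts \<Gamma> \<and> u \<noteq> v \<and> f u = f v}"

definition clique_size :: "'v pair_pre_digraph \<Rightarrow> ('v \<Rightarrow> 'c) \<Rightarrow> 'c \<Rightarrow> nat" where
  "clique_size \<Gamma> f c = card {v \<in> pverts \<Gamma>. f v = c}"

lemma vertex_list:
  assumes "finite (pverts \<Gamma>)"
  shows "distinct (vertex_list \<Gamma>)" "set (vertex_list \<Gamma>) = pverts \<Gamma>"
    "length (vertex_list \<Gamma>) = graph_order \<Gamma>"
proof -
  have "distinct (vertex_list \<Gamma>) \<and> set (vertex_list \<Gamma>) = pverts \<Gamma>"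
    unfolding vertex_list_def by (rule someI_ex) (use finite_distinct_list[OF assms] in blast)
  then show "distinct (vertex_list \<Gamma>)" "set (vertex_list \<Gamma>) = pverts \<Gamma>" by auto
  then show "length (vertex_list \<Gamma>) = graph_order \<Gamma>"
    using distinct_card by (fastforce simp: graph_order_def)
qed

context
  fixes \<Gamma> :: "'v pair_pre_digraph" and f :: "'v \<Rightarrow> 'c"
  assumes clique_union: "clique_union \<Gamma> f"
begin

private abbreviation "k c \<equiv> real (clique_size \<Gamma> f c)"
private abbreviation "cls i \<equiv> f (vertex_list \<Gamma> ! i)"

private lemma finite_verts: "finite (pverts \<Gamma>)"
  using clique_union by (simp add: clique_union_def)

private lemma bij_vertex: "bij_betw (\<lambda>i. vertex_list \<Gamma> ! i) {..<graph_order \<Gamma>} (pverts \<Gamma>)"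
  using bij_betw_nth[OF vertex_list(1)[OF finite_verts]] vertex_list[OF finite_verts] by metis

private lemma cls_image: "cls ` {..<graph_order \<Gamma>} = f ` pverts \<Gamma>"
  using bij_betw_imp_surj_on[OF bij_vertex] by (metis image_image)

private lemma card_cls: "card {j \<in> {..<graph_order \<Gamma>}. cls j = c} = clique_size \<Gamma> f c"
proof -
  have "(\<lambda>i. vertex_list \<Gamma> ! i) ` {j \<in> {..<graph_order \<Gamma>}. cls j = c} = {v \<in> pverts \<Gamma>. f v = c}"
    using bij_betw_imp_surj_on[OF bij_vertex] by auto
  moreover have "inj_on (\<lambda>i. vertex_list \<Gamma> ! i) {j \<in> {..<graph_order \<Gamma>}. cls j = c}"
    using bij_betw_imp_inj_on[OF bij_vertex] by (rule inj_on_subset) auto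
  ultimately show ?thesis
    using card_image[of "\<lambda>i. vertex_list \<Gamma> ! i" "{j \<in> {..<graph_order \<Gamma>}. cls j = c}"]
    by (simp add: clique_size_def)
qed

text \<open>Two vertices of a clique of size \<open>k\<close> share the other \<open>k - 2\<close> vertices of that clique as neighbours, and
vertices of different cliques share none.\<close>

private lemma card_common_nbrs:
  assumes u: "u \<in> pverts \<Gamma>" and v: "v \<in> pverts \<Gamma>" and "u \<noteq> v"
  shows "real (card (common_nbrs \<Gamma> u v)) = (if f u = f v then k (f u) - 2 else 0)"
proof (cases "f u = f v")
  case True
  have "common_nbrs \<Gamma> u v = {w \<in> pverts \<Gamma>. f w = f u} - {u, v}"
  proof (rule Set.set_eqI)
    fix w
    have "w \<in> common_nbrs \<Gamma> u v \<longleftrightarrow> w \<in> pverts \<Gamma> \<and> w \<noteq> u \<and> w \<noteq> v \<and> f u = f w \<and> f v = f w"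
      using u v clique_union unfolding clique_union_def common_nbrs_def by blast
    then show "w \<in> common_nbrs \<Gamma> u v \<longleftrightarrow> w \<in> {w \<in> pverts \<Gamma>. f w = f u} - {u, v}"
      using True by auto
  qed
  moreover have sub: "{u, v} \<subseteq> {w \<in> pverts \<Gamma>. f w = f u}" using u v True by auto
  moreover have two: "card {u, v} = 2" using \<open>u \<noteq> v\<close> by simp
  ultimately have "card (common_nbrs \<Gamma> u v) = clique_size \<Gamma> f (f u) - 2"
    by (simp add: clique_size_def card_Diff_subset)
  moreover have "2 \<le> clique_size \<Gamma> f (f u)"
    using card_mono[OF _ sub] finite_verts two by (simp add: clique_size_def)
  ultimately show ?thesis using True by (simp add: of_nat_diff)
next
  case False
  then have "common_nbrs \<Gamma> u v = {}"
    using clique_union unfolding clique_union_def common_nbrs_def by fastforce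
  then show ?thesis using False by simp
qed

private lemma CN_entry:
  assumes "i < graph_order \<Gamma>" "j < graph_order \<Gamma>"
  shows "CN \<Gamma> $$ (i, j) = (if i \<noteq> j \<and> cls i = cls j then k (cls i) - 2 else 0)"
proof -
  have "vertex_list \<Gamma> ! i \<in> pverts \<Gamma>" "vertex_list \<Gamma> ! j \<in> pverts \<Gamma>"
    "i \<noteq> j \<Longrightarrow> vertex_list \<Gamma> ! i \<noteq> vertex_list \<Gamma> ! j"
    using assms vertex_list[OF finite_verts] nth_mem by (metis, metis, metis nth_eq_iff_index_eq)
  then show ?thesis using assms by (simp add: CN_def card_common_nbrs)
qed

private lemma CN_row_sum:
  assumes i: "i < graph_order \<Gamma>"
  shows "(\<Sum>j<graph_order \<Gamma>. CN \<Gamma> $$ (i, j)) = (k (cls i) - 1) * (k (cls i) - 2)"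
proof -
  define B where "B = {j \<in> {..<graph_order \<Gamma>}. cls j = cls i}"
  have B: "finite B" "i \<in> B" "card B = clique_size \<Gamma> f (cls i)"
    using i card_cls by (auto simp: B_def)
  have "(\<Sum>j<graph_order \<Gamma>. CN \<Gamma> $$ (i, j)) = (\<Sum>j\<in>B - {i}. k (cls i) - 2)"
    using i by (intro sum.mono_neutral_cong_right) (auto simp: B_def CN_entry)
  also have "\<dots> = (real (card B) - 1) * (k (cls i) - 2)"
  proof -
    have "real (card (B - {i})) = real (card B) - 1"
      using B(1,2) card_Diff_singleton[of i B] card_gt_0_iff[of B] by (auto simp: of_nat_diff)
    then show ?thesis by simp
  qed
  finally show ?thesis using B(3) by simp
qed

private lemma CNRS_entry:
  assumes "i < graph_order \<Gamma>" "j < graph_order \<Gamma>"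
  shows "CNRS \<Gamma> $$ (i, j) = (if i = j then (k (cls i) - 1) * (k (cls i) - 2) else 0)"
  unfolding CNRS_def mat_diag_def using assms by (cases "i = j") (simp_all add: CN_row_sum)

private lemma dims: "CN \<Gamma> \<in> carrier_mat (graph_order \<Gamma>) (graph_order \<Gamma>)"
  "CNRS \<Gamma> \<in> carrier_mat (graph_order \<Gamma>) (graph_order \<Gamma>)"
  unfolding CN_def CNRS_def by (rule mat_carrier, rule mat_diag_dim)

lemma clique_union_CN_Delta:
  "CN_Delta \<Gamma> = (\<Sum>c\<in>f ` pverts \<Gamma>. k c * (k c - 1) * (k c - 2)) / real (graph_order \<Gamma>)"
proof -
  let ?n = "graph_order \<Gamma>"
  have "mat_trace (CNRS \<Gamma>) = (\<Sum>i<?n. (k (cls i) - 1) * (k (cls i) - 2))"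
    unfolding mat_trace_def using dims(2) by (intro sum.cong) (auto simp: CNRS_entry)
  also have "\<dots> = (\<Sum>c\<in>cls ` {..<?n}. \<Sum>i\<in>{i \<in> {..<?n}. cls i = c}. (k (cls i) - 1) * (k (cls i) - 2))"
    by (rule sum.image_gen) simp
  also have "\<dots> = (\<Sum>c\<in>cls ` {..<?n}. k c * (k c - 1) * (k c - 2))"
  proof (rule sum.cong[OF HOL.refl])
    fix c
    have "(\<Sum>i\<in>{i \<in> {..<?n}. cls i = c}. (k (cls i) - 1) * (k (cls i) - 2)) =
        (\<Sum>i\<in>{i \<in> {..<?n}. cls i = c}. (k c - 1) * (k c - 2))"
      by (rule sum.cong) auto
    also have "\<dots> = k c * (k c - 1) * (k c - 2)"
      using card_cls[of c] by simp
    finally show "(\<Sum>i\<in>{i \<in> {..<?n}. cls i = c}. (k (cls i) - 1) * (k (cls i) - 2)) =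
        k c * (k c - 1) * (k c - 2)" .
  qed
  finally show ?thesis by (simp add: CN_Delta_def cls_image)
qed

text \<open>On a clique of size \<open>k\<close> the matrix \<open>CNL\<close> has the block \<open>k (k - 2) I - (k - 2) J\<close>, with eigenvalue
\<open>k (k - 2) - k (k - 2) = 0\<close> on the indicator vector.\<close>

lemma clique_union_LE_CN:
  "LE_CN \<Gamma> = (\<Sum>c\<in>f ` pverts \<Gamma>.
     \<bar>CN_Delta \<Gamma>\<bar> + (k c - 1) * \<bar>k c * (k c - 2) - CN_Delta \<Gamma>\<bar>)"
proof -
  let ?n = "graph_order \<Gamma>"
  define \<alpha> \<beta> where "\<alpha> = (\<lambda>c. k c * (k c - 2))" and "\<beta> = (\<lambda>c. 2 - k c)"
  have "CNL \<Gamma> = mat ?n ?n (\<lambda>(i, j). if i = j then \<alpha> (cls i) + \<beta> (cls i)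
      else if cls i = cls j then \<beta> (cls i) else 0)"
    (is "_ = ?M")
  proof (rule eq_matI)
    fix i j assume "i < dim_row ?M" "j < dim_col ?M"
    then have ij: "i < ?n" "j < ?n" by auto
    have "CNL \<Gamma> $$ (i, j) = CNRS \<Gamma> $$ (i, j) - CN \<Gamma> $$ (i, j)"
      using ij dims by (simp add: CNL_def)
    also have "\<dots> = ?M $$ (i, j)"
      using ij by (cases "i = j")
        (simp_all add: CNRS_entry CN_entry \<alpha>_def \<beta>_def algebra_simps power2_eq_square)
    finally show "CNL \<Gamma> $$ (i, j) = ?M $$ (i, j)" .
  qed (use dims in \<open>simp_all add: CNL_def\<close>)
  from eigenvalue_deviation_class_constant[OF this, of "CN_Delta \<Gamma>"]
  show ?thesis
    unfolding LE_CN_def card_cls cls_image by (simp add: \<alpha>_def \<beta>_def algebra_simps)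
qed

text \<open>On a clique of size \<open>k\<close> the matrix \<open>CNSL\<close> has the block \<open>(k - 2)\<^sup>2 I + (k - 2) J\<close>, with eigenvalue
\<open>(k - 2)\<^sup>2 + k (k - 2) = 2 (k - 1) (k - 2)\<close> on the indicator vector.\<close>

lemma clique_union_LE_CN_plus:
  "LE_CN_plus \<Gamma> = (\<Sum>c\<in>f ` pverts \<Gamma>.
     \<bar>2 * (k c - 1) * (k c - 2) - CN_Delta \<Gamma>\<bar> + (k c - 1) * \<bar>(k c - 2) ^ 2 - CN_Delta \<Gamma>\<bar>)"
proof -
  let ?n = "graph_order \<Gamma>"
  define \<alpha> \<beta> where "\<alpha> = (\<lambda>c. (k c - 2) ^ 2)" and "\<beta> = (\<lambda>c. k c - 2)"
  have "CNSL \<Gamma> = mat ?n ?n (\<lambda>(i, j). if i = j then \<alpha> (cls i) + \<beta> (cls i)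
      else if cls i = cls j then \<beta> (cls i) else 0)"
    (is "_ = ?M")
  proof (rule eq_matI)
    fix i j assume "i < dim_row ?M" "j < dim_col ?M"
    then have ij: "i < ?n" "j < ?n" by auto
    have "CNSL \<Gamma> $$ (i, j) = CNRS \<Gamma> $$ (i, j) + CN \<Gamma> $$ (i, j)"
      using ij dims by (simp add: CNSL_def)
    also have "\<dots> = ?M $$ (i, j)"
      using ij by (cases "i = j")
        (simp_all add: CNRS_entry CN_entry \<alpha>_def \<beta>_def algebra_simps power2_eq_square)
    finally show "CNSL \<Gamma> $$ (i, j) = ?M $$ (i, j)" .
  qed (use dims in \<open>simp_all add: CNSL_def\<close>)
  from eigenvalue_deviation_class_constant[OF this, of "CN_Delta \<Gamma>"]
  show ?thesis
    unfolding LE_CN_plus_def card_cls cls_image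
    by (simp add: \<alpha>_def \<beta>_def algebra_simps power2_eq_square)
qed

end

section \<open>Comparing the energies of a union of cliques with the bound\<close>

text \<open>The following four functions are the mean of the eigenvalues, the two energies and the bound
\<open>2 (v - 1) (v - 2)\<close> on \<open>v\<close> vertices, for the disjoint union of one clique with \<open>a\<close> vertices and \<open>e\<close> cliques with \<open>b\<close>
vertices each. They take real arguments, so that polynomial identities can be used freely.\<close>

definition cliques_Delta :: "real \<Rightarrow> real \<Rightarrow> real \<Rightarrow> real" where
  "cliques_Delta a e b = (a * (a - 1) * (a - 2) + e * (b * (b - 1) * (b - 2))) / (a + e * b)"

definition cliques_LE :: "real \<Rightarrow> real \<Rightarrow> real \<Rightarrow> real" where
  "cliques_LE a e b = (let D = cliques_Delta a e b in
     \<bar>D\<bar> + (a - 1) * \<bar>a * (a - 2) - D\<bar> + e * (\<bar>D\<bar> + (b - 1) * \<bar>b * (b - 2) - D\<bar>))"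

definition cliques_LE_plus :: "real \<Rightarrow> real \<Rightarrow> real \<Rightarrow> real" where
  "cliques_LE_plus a e b = (let D = cliques_Delta a e b in
     \<bar>2 * (a - 1) * (a - 2) - D\<bar> + (a - 1) * \<bar>(a - 2) ^ 2 - D\<bar> +
     e * (\<bar>2 * (b - 1) * (b - 2) - D\<bar> + (b - 1) * \<bar>(b - 2) ^ 2 - D\<bar>))"

definition cliques_bound :: "real \<Rightarrow> real \<Rightarrow> real \<Rightarrow> real" where
  "cliques_bound a e b = 2 * (a + e * b - 1) * (a + e * b - 2)"

lemma cliques_Delta_mult:
  assumes "1 \<le> a" "1 \<le> b" "0 \<le> e"
  shows "(a + e * b) * cliques_Delta a e b = a * (a - 1) * (a - 2) + e * (b * (b - 1) * (b - 2))"
proof -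
  have "0 \<le> e * b" using assms by simp
  then have "a + e * b \<noteq> 0" using assms by linarith
  then show ?thesis by (simp add: cliques_Delta_def)
qed

text \<open>Replace \<open>\<bar>a (a - 2) - D\<bar>\<close> by \<open>a (a - 2) - D\<close> and every other deviation by its negative. Since all
deviations add up to \<open>0\<close>, the result is twice the sum \<open>(a - 1) (a (a - 2) - D)\<close> of the deviations that got a
positive sign. Multiplication by the number of vertices clears the denominator of the mean \<open>D\<close>.\<close>

lemma cliques_LE_lower:
  assumes "1 \<le> a" "1 \<le> b" "0 \<le> e"
  shows "2 * ((a - 1) * (a * (a - 2) * (e * b + 1) - e * b * (b - 1) * (b - 2)))
    \<le> (a + e * b) * cliques_LE a e b"
proof -
  define D where "D = cliques_Delta a e b"
  have D: "(a + e * b) * D = a * (a - 1) * (a - 2) + e * (b * (b - 1) * (b - 2))"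
    unfolding D_def by (rule cliques_Delta_mult[OF assms])
  have N: "0 \<le> a + e * b" using assms by simp
  have "(a - 1) * (a * (a - 2) - D) \<le> (a - 1) * \<bar>a * (a - 2) - D\<bar>"
    using assms by (intro mult_left_mono) auto
  moreover have "e * (D + (b - 1) * (D - b * (b - 2))) \<le> e * (\<bar>D\<bar> + (b - 1) * \<bar>b * (b - 2) - D\<bar>)"
    using assms by (intro mult_left_mono add_mono) auto
  ultimately have "D + (a - 1) * (a * (a - 2) - D) + e * (D + (b - 1) * (D - b * (b - 2))) \<le> cliques_LE a e b"
    unfolding cliques_LE_def Let_def D_def[symmetric] by linarith
  moreover have "D + (a - 1) * (a * (a - 2) - D) + e * (D + (b - 1) * (D - b * (b - 2)))
      = 2 * ((a - 1) * (a * (a - 2) - D)) + ((a + e * b) * D -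
        (a * (a - 1) * (a - 2) + e * (b * (b - 1) * (b - 2))))"
    by (simp add: algebra_simps power2_eq_square)
  ultimately have "(a + e * b) * (2 * ((a - 1) * (a * (a - 2) - D))) \<le> (a + e * b) * cliques_LE a e b"
    using N D by (intro mult_left_mono) auto
  moreover have "(a + e * b) * (2 * ((a - 1) * (a * (a - 2) - D))) =
      2 * ((a - 1) * ((a + e * b) * (a * (a - 2)) - (a + e * b) * D))"
    by (simp add: algebra_simps power2_eq_square)
  moreover have "(a + e * b) * (a * (a - 2)) - (a + e * b) * D =
      a * (a - 2) * (e * b + 1) - e * b * (b - 1) * (b - 2)"
    unfolding D by (simp add: algebra_simps power2_eq_square)
  ultimately show ?thesis by (simp add: mult.assoc)
qed

text \<open>As before, with positive signs on both eigenvalues of the large clique. They add up to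
\<open>a (a - 1) (a - 2)\<close>, and \<open>(a + e b) ((a - 1) (a - 2) - D)\<close> factors as \<open>e b (a - b) (a + b - 3)\<close>.\<close>

lemma cliques_LE_plus_lower:
  assumes "1 \<le> a" "1 \<le> b" "0 \<le> e"
  shows "2 * (a * (e * b) * (a - b) * (a + b - 3)) \<le> (a + e * b) * cliques_LE_plus a e b"
proof -
  define D where "D = cliques_Delta a e b"
  have D: "(a + e * b) * D = a * (a - 1) * (a - 2) + e * (b * (b - 1) * (b - 2))"
    unfolding D_def by (rule cliques_Delta_mult[OF assms])
  have N: "0 \<le> a + e * b" using assms by simp
  have "(a - 1) * ((a - 2) ^ 2 - D) \<le> (a - 1) * \<bar>(a - 2) ^ 2 - D\<bar>"
    using assms by (intro mult_left_mono) auto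
  moreover have "e * (D - 2 * (b - 1) * (b - 2) + (b - 1) * (D - (b - 2) ^ 2))
      \<le> e * (\<bar>2 * (b - 1) * (b - 2) - D\<bar> + (b - 1) * \<bar>(b - 2) ^ 2 - D\<bar>)"
    using assms by (intro mult_left_mono add_mono) auto
  ultimately have "2 * (a - 1) * (a - 2) - D + (a - 1) * ((a - 2) ^ 2 - D) +
      e * (D - 2 * (b - 1) * (b - 2) + (b - 1) * (D - (b - 2) ^ 2)) \<le> cliques_LE_plus a e b"
    unfolding cliques_LE_plus_def Let_def D_def[symmetric] by linarith
  moreover have "2 * (a - 1) * (a - 2) - D + (a - 1) * ((a - 2) ^ 2 - D) +
      e * (D - 2 * (b - 1) * (b - 2) + (b - 1) * (D - (b - 2) ^ 2))
      = 2 * (a * ((a - 1) * (a - 2) - D)) + ((a + e * b) * D -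
        (a * (a - 1) * (a - 2) + e * (b * (b - 1) * (b - 2))))"
    by (simp add: algebra_simps power2_eq_square)
  ultimately have "(a + e * b) * (2 * (a * ((a - 1) * (a - 2) - D))) \<le> (a + e * b) * cliques_LE_plus a e b"
    using N D by (intro mult_left_mono) auto
  moreover have "(a + e * b) * (2 * (a * ((a - 1) * (a - 2) - D))) =
      2 * (a * ((a + e * b) * ((a - 1) * (a - 2)) - (a + e * b) * D))"
    by (simp add: algebra_simps power2_eq_square)
  moreover have "(a + e * b) * ((a - 1) * (a - 2)) - (a + e * b) * D = (e * b) * (a - b) * (a + b - 3)"
    unfolding D by (simp add: algebra_simps power2_eq_square)
  ultimately show ?thesis by (simp add: mult.assoc)
qed

text \<open>The next four lemmas compare the lower bounds with the energy bound, both multiplied by half the number of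
vertices, when the size of the large clique is \<open>r\<close> times the size \<open>b\<close> of the others. The difference is \<open>b\<close>
times a polynomial in \<open>r\<close> and \<open>b\<close>. Its Taylor expansion at each of the given corners has nonnegative
coefficients and a positive constant term, so it is positive on the whole quadrant above that corner. The
corners are the minimal integral points with \<open>b \<ge> 2\<close> at which the difference is positive, where for three
cliques only odd \<open>r\<close> are considered.\<close>

lemma LE_excess_two_cliques:
  fixes a r b :: real
  assumes ab: "a = r * b" and corner: "3 \<le> r \<and> 2 \<le> b \<or> 2 \<le> r \<and> 4 \<le> b"
  shows "(a + b) * (a + b - 1) * (a + b - 2)
    < (a - 1) * (a * (a - 2) * (b + 1) - b * (b - 1) * (b - 2))" (is "?L < ?R")
proof -
  consider "3 \<le> r" "2 \<le> b" | "2 \<le> r" "4 \<le> b" using corner by blast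
  then show ?thesis
  proof cases
    case 1
    define x y where "x = r - 3" and "y = b - 2"
    have "?R - ?L = b * (x ^ 3 * y ^ 3 + 6 * x ^ 3 * y ^ 2 + 12 * x ^ 3 * y + 8 * x ^ 3 + 9 * x ^ 2 * y ^ 3 +
        48 * x ^ 2 * y ^ 2 + 84 * x ^ 2 * y + 48 * x ^ 2 + 26 * x * y ^ 3 + 120 * x * y ^ 2 +
        174 * x * y + 76 * x + 24 * y ^ 3 + 90 * y ^ 2 + 90 * y + 12)"
      unfolding ab x_def y_def by (simp add: algebra_simps power2_eq_square power3_eq_cube)
    moreover have "0 \<le> x" "0 \<le> y" "0 < b" using 1 by (auto simp: x_def y_def)
    ultimately have "0 < ?R - ?L"
      by (simp only:, intro mult_pos_pos add_nonneg_pos add_nonneg_nonneg) auto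
    then show ?thesis by linarith
  next
    case 2
    define x y where "x = r - 2" and "y = b - 4"
    have "?R - ?L = b * (x ^ 3 * y ^ 3 + 12 * x ^ 3 * y ^ 2 + 48 * x ^ 3 * y + 64 * x ^ 3 +
        6 * x ^ 2 * y ^ 3 + 66 * x ^ 2 * y ^ 2 + 240 * x ^ 2 * y + 288 * x ^ 2 +
        11 * x * y ^ 3 + 108 * x * y ^ 2 + 342 * x * y + 344 * x + 6 * y ^ 3 + 48 * y ^ 2 +
        108 * y + 48)"
      unfolding ab x_def y_def by (simp add: algebra_simps power2_eq_square power3_eq_cube)
    moreover have "0 \<le> x" "0 \<le> y" "0 < b" using 2 by (auto simp: x_def y_def)
    ultimately have "0 < ?R - ?L"
      by (simp only:, intro mult_pos_pos add_nonneg_pos add_nonneg_nonneg) auto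
    then show ?thesis by linarith
  qed
qed

lemma LE_excess_three_cliques:
  fixes a r b :: real
  assumes ab: "a = r * b" and corner: "3 \<le> r \<and> 3 \<le> b \<or> 5 \<le> r \<and> 2 \<le> b"
  shows "(a + 2 * b) * (a + 2 * b - 1) * (a + 2 * b - 2)
    < (a - 1) * (a * (a - 2) * (2 * b + 1) - 2 * b * (b - 1) * (b - 2))" (is "?L < ?R")
proof -
  consider "3 \<le> r" "3 \<le> b" | "5 \<le> r" "2 \<le> b" using corner by blast
  then show ?thesis
  proof cases
    case 1
    define x y where "x = r - 3" and "y = b - 3"
    have "?R - ?L = b * (2 * x ^ 3 * y ^ 3 + 18 * x ^ 3 * y ^ 2 + 54 * x ^ 3 * y + 54 * x ^ 3 +
        18 * x ^ 2 * y ^ 3 + 150 * x ^ 2 * y ^ 2 + 414 * x ^ 2 * y + 378 * x ^ 2 +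
        52 * x * y ^ 3 + 390 * x * y ^ 2 + 948 * x * y + 738 * x + 48 * y ^ 3 + 300 * y ^ 2 +
        546 * y + 234)"
      unfolding ab x_def y_def by (simp add: algebra_simps power2_eq_square power3_eq_cube)
    moreover have "0 \<le> x" "0 \<le> y" "0 < b" using 1 by (auto simp: x_def y_def)
    ultimately have "0 < ?R - ?L"
      by (simp only:, intro mult_pos_pos add_nonneg_pos add_nonneg_nonneg) auto
    then show ?thesis by linarith
  next
    case 2
    define x y where "x = r - 5" and "y = b - 2"
    have "?R - ?L = b * (2 * x ^ 3 * y ^ 3 + 12 * x ^ 3 * y ^ 2 + 24 * x ^ 3 * y + 16 * x ^ 3 +
        30 * x ^ 2 * y ^ 3 + 168 * x ^ 2 * y ^ 2 + 312 * x ^ 2 * y + 192 * x ^ 2 +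
        148 * x * y ^ 3 + 762 * x * y ^ 2 + 1284 * x * y + 704 * x + 240 * y ^ 3 +
        1104 * y ^ 2 + 1602 * y + 708)"
      unfolding ab x_def y_def by (simp add: algebra_simps power2_eq_square power3_eq_cube)
    moreover have "0 \<le> x" "0 \<le> y" "0 < b" using 2 by (auto simp: x_def y_def)
    ultimately have "0 < ?R - ?L"
      by (simp only:, intro mult_pos_pos add_nonneg_pos add_nonneg_nonneg) auto
    then show ?thesis by linarith
  qed
qed

lemma LE_plus_excess_two_cliques:
  fixes a r b :: real
  assumes ab: "a = r * b" and corner: "2 \<le> r \<and> 5 \<le> b \<or> 3 \<le> r \<and> 3 \<le> b \<or> 5 \<le> r \<and> 2 \<le> b"
  shows "(a + b) * (a + b - 1) * (a + b - 2)
    < a * (b) * (a - b) * (a + b - 3)" (is "?L < ?R")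
proof -
  consider "2 \<le> r" "5 \<le> b" | "3 \<le> r" "3 \<le> b" | "5 \<le> r" "2 \<le> b" using corner by blast
  then show ?thesis
  proof cases
    case 1
    define x y where "x = r - 2" and "y = b - 5"
    have "?R - ?L = b * (x ^ 3 * y ^ 3 + 14 * x ^ 3 * y ^ 2 + 65 * x ^ 3 * y + 100 * x ^ 3 +
        6 * x ^ 2 * y ^ 3 + 78 * x ^ 2 * y ^ 2 + 333 * x ^ 2 * y + 465 * x ^ 2 +
        11 * x * y ^ 3 + 129 * x * y ^ 2 + 483 * x * y + 563 * x + 6 * y ^ 3 + 57 * y ^ 2 +
        147 * y + 54)"
      unfolding ab x_def y_def by (simp add: algebra_simps power2_eq_square power3_eq_cube)
    moreover have "0 \<le> x" "0 \<le> y" "0 < b" using 1 by (auto simp: x_def y_def)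
    ultimately have "0 < ?R - ?L"
      by (simp only:, intro mult_pos_pos add_nonneg_pos add_nonneg_nonneg) auto
    then show ?thesis by linarith
  next
    case 2
    define x y where "x = r - 3" and "y = b - 3"
    have "?R - ?L = b * (x ^ 3 * y ^ 3 + 8 * x ^ 3 * y ^ 2 + 21 * x ^ 3 * y + 18 * x ^ 3 + 9 * x ^ 2 * y ^ 3 +
        66 * x ^ 2 * y ^ 2 + 156 * x ^ 2 * y + 117 * x ^ 2 + 26 * x * y ^ 3 +
        171 * x * y ^ 2 + 348 * x * y + 205 * x + 24 * y ^ 3 + 134 * y ^ 2 + 204 * y + 46)"
      unfolding ab x_def y_def by (simp add: algebra_simps power2_eq_square power3_eq_cube)
    moreover have "0 \<le> x" "0 \<le> y" "0 < b" using 2 by (auto simp: x_def y_def)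
    ultimately have "0 < ?R - ?L"
      by (simp only:, intro mult_pos_pos add_nonneg_pos add_nonneg_nonneg) auto
    then show ?thesis by linarith
  next
    case 3
    define x y where "x = r - 5" and "y = b - 2"
    have "?R - ?L = b * (x ^ 3 * y ^ 3 + 5 * x ^ 3 * y ^ 2 + 8 * x ^ 3 * y + 4 * x ^ 3 + 15 * x ^ 2 * y ^ 3 +
        69 * x ^ 2 * y ^ 2 + 99 * x ^ 2 * y + 42 * x ^ 2 + 74 * x * y ^ 3 + 309 * x * y ^ 2 +
        384 * x * y + 122 * x + 120 * y ^ 3 + 444 * y ^ 2 + 444 * y + 60)"
      unfolding ab x_def y_def by (simp add: algebra_simps power2_eq_square power3_eq_cube)
    moreover have "0 \<le> x" "0 \<le> y" "0 < b" using 3 by (auto simp: x_def y_def)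
    ultimately have "0 < ?R - ?L"
      by (simp only:, intro mult_pos_pos add_nonneg_pos add_nonneg_nonneg) auto
    then show ?thesis by linarith
  qed
qed

lemma LE_plus_excess_three_cliques:
  fixes a r b :: real
  assumes ab: "a = r * b" and corner: "3 \<le> r \<and> 3 \<le> b \<or> 5 \<le> r \<and> 2 \<le> b"
  shows "(a + 2 * b) * (a + 2 * b - 1) * (a + 2 * b - 2)
    < a * (2 * b) * (a - b) * (a + b - 3)" (is "?L < ?R")
proof -
  consider "3 \<le> r" "3 \<le> b" | "5 \<le> r" "2 \<le> b" using corner by blast
  then show ?thesis
  proof cases
    case 1
    define x y where "x = r - 3" and "y = b - 3"
    have "?R - ?L = b * (2 * x ^ 3 * y ^ 3 + 17 * x ^ 3 * y ^ 2 + 48 * x ^ 3 * y + 45 * x ^ 3 +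
        18 * x ^ 2 * y ^ 3 + 141 * x ^ 2 * y ^ 2 + 363 * x ^ 2 * y + 306 * x ^ 2 +
        52 * x * y ^ 3 + 363 * x * y ^ 2 + 804 * x * y + 547 * x + 48 * y ^ 3 + 271 * y ^ 2 +
        405 * y + 62)"
      unfolding ab x_def y_def by (simp add: algebra_simps power2_eq_square power3_eq_cube)
    moreover have "0 \<le> x" "0 \<le> y" "0 < b" using 1 by (auto simp: x_def y_def)
    ultimately have "0 < ?R - ?L"
      by (simp only:, intro mult_pos_pos add_nonneg_pos add_nonneg_nonneg) auto
    then show ?thesis by linarith
  next
    case 2
    define x y where "x = r - 5" and "y = b - 2"
    have "?R - ?L = b * (2 * x ^ 3 * y ^ 3 + 11 * x ^ 3 * y ^ 2 + 20 * x ^ 3 * y + 12 * x ^ 3 +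
        30 * x ^ 2 * y ^ 3 + 153 * x ^ 2 * y ^ 2 + 255 * x ^ 2 * y + 138 * x ^ 2 +
        148 * x * y ^ 3 + 687 * x * y ^ 2 + 1014 * x * y + 462 * x + 240 * y ^ 3 +
        977 * y ^ 2 + 1175 * y + 348)"
      unfolding ab x_def y_def by (simp add: algebra_simps power2_eq_square power3_eq_cube)
    moreover have "0 \<le> x" "0 \<le> y" "0 < b" using 2 by (auto simp: x_def y_def)
    ultimately have "0 < ?R - ?L"
      by (simp only:, intro mult_pos_pos add_nonneg_pos add_nonneg_nonneg) auto
    then show ?thesis by linarith
  qed
qed

lemma hyper_from_excess:
  assumes "1 \<le> a" "1 \<le> b" "0 \<le> e"
  shows "(a + e * b) * (a + e * b - 1) * (a + e * b - 2)
      < (a - 1) * (a * (a - 2) * (e * b + 1) - e * b * (b - 1) * (b - 2)) \<Longrightarrow>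
      cliques_bound a e b < cliques_LE a e b"
    and "(a + e * b) * (a + e * b - 1) * (a + e * b - 2) < a * (e * b) * (a - b) * (a + b - 3) \<Longrightarrow>
      cliques_bound a e b < cliques_LE_plus a e b"
proof -
  have "0 \<le> e * b" using assms by simp
  then have N: "0 < a + e * b" using assms by linarith
  have bound: "(a + e * b) * cliques_bound a e b = 2 * ((a + e * b) * (a + e * b - 1) * (a + e * b - 2))"
    by (simp add: cliques_bound_def)
  {
    assume "(a + e * b) * (a + e * b - 1) * (a + e * b - 2)
      < (a - 1) * (a * (a - 2) * (e * b + 1) - e * b * (b - 1) * (b - 2))"
    with cliques_LE_lower[OF assms] bound have "(a + e * b) * cliques_bound a e b < (a + e * b) * cliques_LE a e b"
      by linarith
    with N show "cliques_bound a e b < cliques_LE a e b" by simp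
  }
  {
    assume "(a + e * b) * (a + e * b - 1) * (a + e * b - 2) < a * (e * b) * (a - b) * (a + b - 3)"
    with cliques_LE_plus_lower[OF assms] bound
    have "(a + e * b) * cliques_bound a e b < (a + e * b) * cliques_LE_plus a e b"
      by linarith
    with N show "cliques_bound a e b < cliques_LE_plus a e b" by simp
  }
qed

text \<open>All vertices have the same row sum here, so the mean is \<open>(b - 1) (b - 2)\<close> and both energies equal
\<open>2 (1 + e) (b - 1) (b - 2)\<close>.\<close>

lemma equal_cliques:
  fixes b e :: real
  assumes "2 \<le> b" "1 \<le> e"
  shows "cliques_LE b e b < cliques_bound b e b" "cliques_LE_plus b e b < cliques_bound b e b"
proof -
  have pos: "0 < b + e * b" using assms by (intro add_pos_nonneg) auto
  have "(b + e * b) * cliques_Delta b e b = (b + e * b) * ((b - 1) * (b - 2))"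
    by (subst cliques_Delta_mult) (use assms in \<open>auto simp: algebra_simps\<close>)
  then have D: "cliques_Delta b e b = (b - 1) * (b - 2)" using pos by simp
  have nonneg: "0 \<le> (b - 1) * (b - 2)" using assms by simp
  have diff: "b * (b - 2) - (b - 1) * (b - 2) = b - 2"
    "2 * (b - 1) * (b - 2) - (b - 1) * (b - 2) = (b - 1) * (b - 2)"
    "(b - 2)\<^sup>2 - (b - 1) * (b - 2) = - (b - 2)"
    by (simp_all add: algebra_simps power2_eq_square)
  have sq: "2 * 2 * 2 \<le> (1 + e) * b * b" using assms by (intro mult_mono) auto
  have "cliques_bound b e b - 2 * (1 + e) * ((b - 1) * (b - 2)) = 2 * e * ((1 + e) * b * b - 2)"
    by (simp add: cliques_bound_def algebra_simps)
  moreover have "0 < 2 * e * ((1 + e) * b * b - 2)" using sq assms by (intro mult_pos_pos) auto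
  ultimately have bound: "2 * (1 + e) * ((b - 1) * (b - 2)) < cliques_bound b e b" by linarith
  have "cliques_LE b e b = 2 * (1 + e) * ((b - 1) * (b - 2))"
    unfolding cliques_LE_def Let_def D diff using nonneg assms by (simp add: algebra_simps)
  with bound show "cliques_LE b e b < cliques_bound b e b" by simp
  have "cliques_LE_plus b e b = 2 * (1 + e) * ((b - 1) * (b - 2))"
    unfolding cliques_LE_plus_def Let_def D diff using nonneg assms by (simp add: algebra_simps)
  with bound show "cliques_LE_plus b e b < cliques_bound b e b" by simp
qed

text \<open>This is the case of \<open>D\<^sub>2\<^sub>n\<close> with \<open>n = 2 a + 1\<close>. For \<open>a \<ge> 2\<close> the difference between the first
energy and the bound is \<open>2 a (a - 1) (a - 5) / (a + 1)\<close>, whence the equality for \<open>a = 5\<close>. The eigenvalue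
\<open>(a - 2)\<^sup>2\<close> lies slightly below the mean, by less than \<open>2\<close>, which keeps the second energy small. For \<open>a = 1\<close> there are no edges and everything is \<open>0\<close>.\<close>

lemma one_clique_and_point:
  fixes a :: nat
  assumes "1 \<le> a"
  shows "cliques_LE a 1 1 > cliques_bound a 1 1 \<longleftrightarrow> 6 \<le> a"
    and "cliques_LE a 1 1 = cliques_bound a 1 1 \<longleftrightarrow> a = 1 \<or> a = 5"
    and "\<not> cliques_LE_plus a 1 1 > cliques_bound a 1 1"
    and "cliques_LE_plus a 1 1 = cliques_bound a 1 1 \<longleftrightarrow> a = 1"
proof -
  define x where "x = real a"
  define D where "D = cliques_Delta x 1 1"
  have x1: "1 \<le> x" using assms by (simp add: x_def)
  have ND: "(x + 1) * D = x * (x - 1) * (x - 2)"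
    unfolding D_def using cliques_Delta_mult[of x 1 1] x1 by simp
  have a1: "cliques_LE 1 1 1 = cliques_bound 1 1 1" "cliques_LE_plus 1 1 1 = cliques_bound 1 1 1"
    by (simp_all add: cliques_LE_def cliques_LE_plus_def cliques_bound_def cliques_Delta_def)
  have ge2: "(x + 1) * (cliques_LE x 1 1 - cliques_bound x 1 1) = 2 * x * (x - 1) * (x - 5) \<and>
      cliques_LE_plus x 1 1 < cliques_bound x 1 1" if "2 \<le> x"
  proof -
    have D: "D = x * (x - 1) * (x - 2) / (x + 1)" using ND x1 by (simp add: field_simps)
    have "x * (x - 2) - D = 2 * x * (x - 2) / (x + 1)"
      using x1 by (simp add: D field_simps)
    moreover have "0 \<le> 2 * x * (x - 2) / (x + 1)" using that by simp
    ultimately have le1: "D \<le> x * (x - 2)" by linarith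
    have "2 * (x - 1) * (x - 2) - D = (x - 1) * (x - 2) * (x + 2) / (x + 1)"
      using x1 by (simp add: D field_simps)
    moreover have "0 \<le> (x - 1) * (x - 2) * (x + 2) / (x + 1)" using that by simp
    ultimately have le2: "D \<le> 2 * (x - 1) * (x - 2)" by linarith
    have gap: "D - (x - 2)\<^sup>2 = 2 * (x - 2) / (x + 1)"
      using x1 by (simp add: D field_simps power2_eq_square)
    have gap0: "0 \<le> D - (x - 2)\<^sup>2" unfolding gap using that by simp
    have gap2: "D - (x - 2)\<^sup>2 < 2" unfolding gap using that by (simp add: field_simps)
    have D0: "0 \<le> D" unfolding D using that by simp
    have LE: "cliques_LE x 1 1 = 2 * D + (x - 1) * (x * (x - 2) - D)"
      unfolding cliques_LE_def Let_def D_def[symmetric] using D0 le1 by simp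
    have "(x + 1) * (cliques_LE x 1 1 - cliques_bound x 1 1) =
        (3 - x) * ((x + 1) * D) + (x + 1) * ((x - 1) * (x * (x - 2)) - 2 * x * (x - 1))"
      unfolding LE cliques_bound_def by (simp add: algebra_simps)
    also have "\<dots> = 2 * x * (x - 1) * (x - 5)"
      unfolding ND by (simp add: algebra_simps)
    finally have "(x + 1) * (cliques_LE x 1 1 - cliques_bound x 1 1) = 2 * x * (x - 1) * (x - 5)" .
    moreover have "cliques_LE_plus x 1 1 = 2 * (x - 1) * (x - 2) + (x - 1) * (D - (x - 2)\<^sup>2)"
      unfolding cliques_LE_plus_def Let_def D_def[symmetric] using D0 le2 gap0 by simp
    moreover have "(x - 1) * (D - (x - 2)\<^sup>2) < (x - 1) * 2"
      using gap2 that by (intro mult_strict_left_mono) auto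
    moreover have "cliques_bound x 1 1 = 2 * (x - 1) * (x - 2) + (x - 1) * 4"
      by (simp add: cliques_bound_def algebra_simps)
    moreover have "(x - 1) * 2 \<le> (x - 1) * 4" using that by simp
    ultimately show ?thesis by linarith
  qed
  consider "a = 1" | "2 \<le> a" using assms by linarith
  then have "(cliques_LE a 1 1 > cliques_bound a 1 1 \<longleftrightarrow> 6 \<le> a) \<and>
    (cliques_LE a 1 1 = cliques_bound a 1 1 \<longleftrightarrow> a = 1 \<or> a = 5) \<and>
    \<not> cliques_LE_plus a 1 1 > cliques_bound a 1 1 \<and> (cliques_LE_plus a 1 1 = cliques_bound a 1 1 \<longleftrightarrow> a = 1)"
  proof cases
    case 1
    then show ?thesis using a1 by simp
  next
    case 2
    then have x2: "2 \<le> x" by (simp add: x_def)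
    have "0 < x + 1" "0 < 2 * x * (x - 1)" using x2 by auto
    then have "(0 < cliques_LE x 1 1 - cliques_bound x 1 1 \<longleftrightarrow> 0 < x - 5) \<and>
        (cliques_LE x 1 1 - cliques_bound x 1 1 = 0 \<longleftrightarrow> x - 5 = 0)"
      using ge2[OF x2] by (metis mult_eq_0_iff order_less_irrefl zero_less_mult_iff less_asym)
    then show ?thesis using ge2[OF x2] 2 by (auto simp: x_def)
  qed
  then show "cliques_LE a 1 1 > cliques_bound a 1 1 \<longleftrightarrow> 6 \<le> a"
    and "cliques_LE a 1 1 = cliques_bound a 1 1 \<longleftrightarrow> a = 1 \<or> a = 5"
    and "\<not> cliques_LE_plus a 1 1 > cliques_bound a 1 1"
    and "cliques_LE_plus a 1 1 = cliques_bound a 1 1 \<longleftrightarrow> a = 1" by auto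
qed

text \<open>Cliques with at most two vertices have no common neighbours, so it does not matter whether the two remaining
vertices are adjacent. For large \<open>a\<close> the lower bounds suffice, as \<open>3 (a - 1) (a - 2) > (a + 1) (a + 2)\<close> for
\<open>a \<ge> 6\<close> and \<open>2 (a - 1) (a - 2) > (a + 1) (a + 2)\<close> for \<open>a \<ge> 9\<close>; the smaller values are evaluated.\<close>

lemma one_clique_and_two_vertices:
  fixes a :: nat and e b :: real
  assumes a: "1 \<le> a" and eb: "e = 1 \<and> b = 2 \<or> e = 2 \<and> b = 1"
  shows "6 \<le> a \<Longrightarrow> cliques_LE a e b > cliques_bound a e b"
    and "a < 6 \<Longrightarrow> cliques_LE a e b < cliques_bound a e b"
    and "9 \<le> a \<Longrightarrow> cliques_LE_plus a e b > cliques_bound a e b"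
    and "a < 9 \<Longrightarrow> cliques_LE_plus a e b < cliques_bound a e b"
proof -
  define x where "x = real a"
  have b: "1 \<le> b" "0 \<le> e" "1 \<le> x" using a eb by (auto simp: x_def)
  show "cliques_LE a e b > cliques_bound a e b" if "6 \<le> a"
  proof -
    have "6 \<le> x" using that by (simp add: x_def)
    have "(x - 1) * (3 * (x - 2)) - (x + 2) * (x + 1) = 2 * ((x - 6) * x) + 4"
      by (simp add: algebra_simps)
    moreover have "0 \<le> (x - 6) * x" using \<open>6 \<le> x\<close> by simp
    ultimately have "(x + 2) * (x + 1) < (x - 1) * (3 * (x - 2))" by linarith
    then have "x * ((x + 2) * (x + 1)) < x * ((x - 1) * (3 * (x - 2)))"
      using \<open>6 \<le> x\<close> by (intro mult_strict_left_mono) auto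
    then show ?thesis
      unfolding x_def[symmetric] using eb
      by (intro hyper_from_excess(1) b) (auto simp: algebra_simps)
  qed
  show "cliques_LE_plus a e b > cliques_bound a e b" if "9 \<le> a"
  proof -
    have "9 \<le> x" using that by (simp add: x_def)
    have "2 * ((x - 1) * (x - 2)) - (x + 2) * (x + 1) = (x - 9) * x + 2"
      by (simp add: algebra_simps)
    moreover have "0 \<le> (x - 9) * x" using \<open>9 \<le> x\<close> by simp
    ultimately have "(x + 2) * (x + 1) < 2 * ((x - 1) * (x - 2))" by linarith
    then have "x * ((x + 2) * (x + 1)) < x * (2 * ((x - 1) * (x - 2)))"
      using \<open>9 \<le> x\<close> by (intro mult_strict_left_mono) auto
    then show ?thesis
      unfolding x_def[symmetric] using eb
      by (intro hyper_from_excess(2) b) (auto simp: algebra_simps)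
  qed
  show "cliques_LE a e b < cliques_bound a e b" if "a < 6"
  proof -
    have "a \<in> {1, 2, 3, 4, 5}" using a that by auto
    then show ?thesis using eb
      by (auto simp: cliques_LE_def cliques_bound_def cliques_Delta_def)
  qed
  show "cliques_LE_plus a e b < cliques_bound a e b" if "a < 9"
  proof -
    have "a \<in> {1, 2, 3, 4, 5, 6, 7, 8}" using a that by auto
    then show ?thesis using eb
      by (auto simp: cliques_LE_plus_def cliques_bound_def cliques_Delta_def)
  qed
qed

text \<open>The positive cases are those covered by the corners above. Among the others, \<open>r = 1\<close> means equal cliques,
and the rest are single numerical values.\<close>

lemma two_cliques_with_ratio:
  fixes r b :: nat
  assumes r: "1 \<le> r" and b: "2 \<le> b"
  shows "3 \<le> r \<or> r = 2 \<and> 4 \<le> b \<Longrightarrow> cliques_LE (real (r * b)) 1 b > cliques_bound (real (r * b)) 1 b"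
    and "\<not> (3 \<le> r \<or> r = 2 \<and> 4 \<le> b) \<Longrightarrow> cliques_LE (real (r * b)) 1 b < cliques_bound (real (r * b)) 1 b"
    and "\<not> (r = 1 \<or> r = 2 \<and> b \<le> 4 \<or> r \<in> {3, 4} \<and> b = 2) \<Longrightarrow>
      cliques_LE_plus (real (r * b)) 1 b > cliques_bound (real (r * b)) 1 b"
    and "r = 1 \<or> r = 2 \<and> b \<le> 4 \<or> r \<in> {3, 4} \<and> b = 2 \<Longrightarrow>
      cliques_LE_plus (real (r * b)) 1 b < cliques_bound (real (r * b)) 1 b"
proof -
  have "1 * 1 \<le> r * b" using r b by (intro mult_le_mono) auto
  then have pos: "1 \<le> real (r * b)" "1 \<le> real b" "(0::real) \<le> 1" using b by linarith+
  show "cliques_LE (real (r * b)) 1 b > cliques_bound (real (r * b)) 1 b" if "3 \<le> r \<or> r = 2 \<and> 4 \<le> b"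
    using LE_excess_two_cliques[of "real (r * b)" r b] that b
    by (intro hyper_from_excess(1)[OF pos]) auto
  show "cliques_LE_plus (real (r * b)) 1 b > cliques_bound (real (r * b)) 1 b"
    if "\<not> (r = 1 \<or> r = 2 \<and> b \<le> 4 \<or> r \<in> {3, 4} \<and> b = 2)"
  proof -
    have "2 \<le> r \<and> 5 \<le> b \<or> 3 \<le> r \<and> 3 \<le> b \<or> 5 \<le> r \<and> 2 \<le> b" using that r b by auto
    then show ?thesis
      using LE_plus_excess_two_cliques[of "real (r * b)" r b]
      by (intro hyper_from_excess(2)[OF pos]) auto
  qed
  show "cliques_LE (real (r * b)) 1 b < cliques_bound (real (r * b)) 1 b"
    if "\<not> (3 \<le> r \<or> r = 2 \<and> 4 \<le> b)"
  proof -
    have "r = 1 \<or> r = 2 \<and> b = 2 \<or> r = 2 \<and> b = 3" using that r b by auto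
    moreover have ?thesis if "r = 1" using equal_cliques(1)[of b 1] b that by simp
    moreover have ?thesis if "r \<noteq> 1"
      using calculation(1) that by (auto simp: cliques_LE_def cliques_bound_def cliques_Delta_def)
    ultimately show ?thesis by blast
  qed
  show "cliques_LE_plus (real (r * b)) 1 b < cliques_bound (real (r * b)) 1 b"
    if "r = 1 \<or> r = 2 \<and> b \<le> 4 \<or> r \<in> {3, 4} \<and> b = 2"
  proof -
    have "r = 1 \<or> r = 2 \<and> b = 2 \<or> r = 2 \<and> b = 3 \<or> r = 2 \<and> b = 4 \<or> r = 3 \<and> b = 2 \<or> r = 4 \<and> b = 2"
      using that b by auto
    moreover have ?thesis if "r = 1" using equal_cliques(2)[of b 1] b that by simp
    moreover have ?thesis if "r \<noteq> 1"
      using calculation(1) that by (auto simp: cliques_LE_plus_def cliques_bound_def cliques_Delta_def)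
    ultimately show ?thesis by blast
  qed
qed

text \<open>Oddness of the ratio excludes \<open>k = 2\<close> and \<open>k = 4\<close>, so below the corners only the equal cliques and the
sizes \<open>(6, 2, 2)\<close> are left.\<close>

lemma three_cliques_with_ratio:
  fixes k b :: nat
  assumes k: "odd k" and b: "2 \<le> b"
  shows "5 \<le> k \<or> k = 3 \<and> 3 \<le> b \<Longrightarrow> cliques_LE (real (k * b)) 2 b > cliques_bound (real (k * b)) 2 b"
    and "\<not> (5 \<le> k \<or> k = 3 \<and> 3 \<le> b) \<Longrightarrow> cliques_LE (real (k * b)) 2 b < cliques_bound (real (k * b)) 2 b"
    and "5 \<le> k \<or> k = 3 \<and> 3 \<le> b \<Longrightarrow> cliques_LE_plus (real (k * b)) 2 b > cliques_bound (real (k * b)) 2 b"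
    and "\<not> (5 \<le> k \<or> k = 3 \<and> 3 \<le> b) \<Longrightarrow>
      cliques_LE_plus (real (k * b)) 2 b < cliques_bound (real (k * b)) 2 b"
proof -
  have k1: "1 \<le> k" using odd_pos[OF k] by simp
  then have "1 * 1 \<le> k * b" using b by (intro mult_le_mono) auto
  then have pos: "1 \<le> real (k * b)" "1 \<le> real b" "(0::real) \<le> 2" using b by linarith+
  show "cliques_LE (real (k * b)) 2 b > cliques_bound (real (k * b)) 2 b" if "5 \<le> k \<or> k = 3 \<and> 3 \<le> b"
    using LE_excess_three_cliques[of "real (k * b)" k b] that b
    by (intro hyper_from_excess(1)[OF pos]) auto
  show "cliques_LE_plus (real (k * b)) 2 b > cliques_bound (real (k * b)) 2 b" if "5 \<le> k \<or> k = 3 \<and> 3 \<le> b"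
    using LE_plus_excess_three_cliques[of "real (k * b)" k b] that b
    by (intro hyper_from_excess(2)[OF pos]) auto
  have small: "k = 1 \<or> k = 3 \<and> b = 2" if "\<not> (5 \<le> k \<or> k = 3 \<and> 3 \<le> b)"
  proof -
    have "k < 5" using that by simp
    then have "k \<in> {1, 2, 3, 4}" using k1 by auto
    then show ?thesis using k b that by auto
  qed
  show "cliques_LE (real (k * b)) 2 b < cliques_bound (real (k * b)) 2 b"
    if "\<not> (5 \<le> k \<or> k = 3 \<and> 3 \<le> b)"
  proof (cases "k = 1")
    case True
    then show ?thesis using equal_cliques(1)[of b 2] b by simp
  next
    case False
    then show ?thesis
      using small[OF that] by (auto simp: cliques_LE_def cliques_bound_def cliques_Delta_def)
  qed
  show "cliques_LE_plus (real (k * b)) 2 b < cliques_bound (real (k * b)) 2 b"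
    if "\<not> (5 \<le> k \<or> k = 3 \<and> 3 \<le> b)"
  proof (cases "k = 1")
    case True
    then show ?thesis using equal_cliques(2)[of b 2] b by simp
  next
    case False
    then show ?thesis
      using small[OF that] by (auto simp: cliques_LE_plus_def cliques_bound_def cliques_Delta_def)
  qed
qed

section \<open>Presentations and metacyclic groups\<close>

definition word_eval :: "('a, 'b) monoid_scheme \<Rightarrow> ('g \<Rightarrow> 'a) \<Rightarrow> 'g word \<Rightarrow> 'a" where
  "word_eval H \<phi> w = foldr (\<lambda>(g, b) a. (if b then \<phi> g else inv\<^bsub>H\<^esub> \<phi> g) \<otimes>\<^bsub>H\<^esub> a) w \<one>\<^bsub>H\<^esub>"

definition satisfies_relations ::
  "('a, 'b) monoid_scheme \<Rightarrow> ('g \<Rightarrow> 'a) \<Rightarrow> ('g word \<times> 'g word) set \<Rightarrow> bool" where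
  "satisfies_relations H \<phi> R \<longleftrightarrow>
     range \<phi> \<subseteq> carrier H \<and> (\<forall>(u, v)\<in>R. word_eval H \<phi> u = word_eval H \<phi> v)"

context group
begin

lemma word_eval_Nil [simp]: "word_eval G \<phi> [] = \<one>"
  by (simp add: word_eval_def)

lemma word_eval_Cons:
  "word_eval G \<phi> ((g, b) # w) = (if b then \<phi> g else inv \<phi> g) \<otimes> word_eval G \<phi> w"
  by (simp add: word_eval_def)

lemma word_eval_closed:
  assumes "range \<phi> \<subseteq> carrier G"
  shows "word_eval G \<phi> w \<in> carrier G"
proof (induction w)
  case (Cons a w)
  then show ?case using assms by (cases a) (auto simp: word_eval_Cons)
qed simp

lemma word_eval_append:
  assumes "range \<phi> \<subseteq> carrier G"
  shows "word_eval G \<phi> (u @ v) = word_eval G \<phi> u \<otimes> word_eval G \<phi> v"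
proof (induction u)
  case Nil
  then show ?case using word_eval_closed[OF assms] by simp
next
  case (Cons a u)
  obtain g b where a: "a = (g, b)" by force
  have "\<phi> g \<in> carrier G" using assms by auto
  then show ?case
    using Cons.IH word_eval_closed[OF assms] by (auto simp: a word_eval_Cons m_assoc)
qed

lemma word_eval_word_pow:
  assumes "range \<phi> \<subseteq> carrier G"
  shows "word_eval G \<phi> (word_pow w k) = word_eval G \<phi> w [^] k"
proof (induction k)
  case 0
  then show ?case by (simp add: word_pow_def)
next
  case (Suc k)
  have "word_eval G \<phi> (word_pow w (Suc k)) = word_eval G \<phi> w \<otimes> word_eval G \<phi> (word_pow w k)"
    using word_eval_append[OF assms] by (simp add: word_pow_def)
  with Suc.IH show ?case using word_eval_closed[OF assms] nat_pow_Suc2 by metis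
qed

lemma word_eval_word_inv:
  assumes "range \<phi> \<subseteq> carrier G"
  shows "word_eval G \<phi> (word_inv [(g, True)]) = inv \<phi> g"
proof -
  have "\<phi> g \<in> carrier G" using assms by auto
  then show ?thesis by (simp add: word_inv_def word_eval_Cons)
qed

lemma word_eval_letter:
  assumes "range \<phi> \<subseteq> carrier G"
  shows "word_eval G \<phi> [(g, True)] = \<phi> g"
proof -
  have "\<phi> g \<in> carrier G" using assms by auto
  then show ?thesis by (simp add: word_eval_Cons)
qed

lemma pres_eq_word_eval:
  assumes "satisfies_relations G \<phi> R" and "pres_eq R u v"
  shows "word_eval G \<phi> u = word_eval G \<phi> v"
  using assms(2)
proof induction
  case (relation u v)
  then show ?case using assms(1) by (auto simp: satisfies_relations_def)
next
  case (cancel g b)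
  have "\<phi> g \<in> carrier G" using assms(1) by (auto simp: satisfies_relations_def)
  then show ?case by (simp add: word_eval_Cons)
next
  case (append u u' v v')
  then show ?case using assms(1) by (simp add: satisfies_relations_def word_eval_append)
qed auto

text \<open>The universal property of a presentation: an assignment of the generators that respects the relations
extends to a homomorphism.\<close>

lemma presented_group_universal:
  assumes sat: "satisfies_relations G \<phi> R"
  obtains \<Phi> where "\<Phi> \<in> hom (presented_group R) G"
    and "\<And>w. \<Phi> (pres_rel R `` {w}) = word_eval G \<phi> w"
proof -
  define \<Phi> where "\<Phi> = (\<lambda>A. the_elem (word_eval G \<phi> ` A))"
  have \<Phi>: "\<Phi> (pres_rel R `` {w}) = word_eval G \<phi> w" for w
  proof -
    have "word_eval G \<phi> ` (pres_rel R `` {w}) = {word_eval G \<phi> w}"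
      using pres_eq_word_eval[OF sat] pres_eq.refl by (fastforce simp: pres_rel_def image_iff)
    then show ?thesis by (simp add: \<Phi>_def)
  qed
  have rng: "range \<phi> \<subseteq> carrier G" using sat by (simp add: satisfies_relations_def)
  have "\<Phi> \<in> hom (presented_group R) G"
  proof (rule homI)
    fix A assume "A \<in> carrier (presented_group R)"
    then obtain u where A: "A = pres_rel R `` {u}" by (auto simp: presented_group_def elim: quotientE)
    then show "\<Phi> A \<in> carrier G" using \<Phi> word_eval_closed[OF rng] by simp
    fix B assume "B \<in> carrier (presented_group R)"
    then obtain v where B: "B = pres_rel R `` {v}" by (auto simp: presented_group_def elim: quotientE)
    show "\<Phi> (A \<otimes>\<^bsub>presented_group R\<^esub> B) = \<Phi> A \<otimes> \<Phi> B"
      by (simp add: A B presented_group_mult \<Phi> word_eval_append[OF rng])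
  qed
  with \<Phi> show ?thesis using that by blast
qed

end

definition letter_class :: "('g word \<times> 'g word) set \<Rightarrow> 'g \<Rightarrow> 'g word set" where
  "letter_class R g = pres_rel R `` {[(g, True)]}"

lemma letter_class_closed: "range (letter_class R) \<subseteq> carrier (presented_group R)"
  by (auto simp: letter_class_def presented_group_def quotientI)

text \<open>Evaluating a word at the classes of the letters gives the class of the word. So the presented group is
generated by these classes, and a fact about all evaluated words is a fact about all its elements.\<close>

lemma word_eval_letter_class:
  "word_eval (presented_group R) (letter_class R) w = pres_rel R `` {w}"
proof (induction w)
  case Nil
  then show ?case by (simp add: word_eval_def presented_group_def)
next
  case (Cons a w)
  interpret P: group "presented_group R" by (rule group_presented_group)
  obtain g b where a: "a = (g, b)" by force
  have "pres_rel R `` {[(g, False)]} = inv\<^bsub>presented_group R\<^esub> letter_class R g"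
  proof (rule P.inv_equality[symmetric])
    have "pres_eq R [(g, False), (g, True)] []" using pres_eq.cancel[of R g False] by simp
    then have "pres_rel R `` {[(g, False), (g, True)]} = pres_rel R `` {[]}"
      by (intro equiv_class_eq[OF equiv_pres_rel]) (simp add: pres_rel_def)
    then show "pres_rel R `` {[(g, False)]} \<otimes>\<^bsub>presented_group R\<^esub> letter_class R g =
        \<one>\<^bsub>presented_group R\<^esub>"
      by (simp add: letter_class_def presented_group_mult) (simp add: presented_group_def)
  qed (auto simp: letter_class_def presented_group_def quotientI)
  then have "pres_rel R `` {[(g, b)]} =
      (if b then letter_class R g else inv\<^bsub>presented_group R\<^esub> letter_class R g)"
    by (cases b) (simp_all add: letter_class_def)
  then show ?case
    using presented_group_mult[of R "[(g, b)]" w] by (simp add: a P.word_eval_Cons Cons.IH)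
qed

lemma letter_class_satisfies: "satisfies_relations (presented_group R) (letter_class R) R"
proof -
  have "pres_rel R `` {u} = pres_rel R `` {v}" if "(u, v) \<in> R" for u v
    using that pres_eq.relation
    by (intro equiv_class_eq[OF equiv_pres_rel]) (auto simp: pres_rel_def)
  then show ?thesis
    unfolding satisfies_relations_def word_eval_letter_class
    by (intro conjI letter_class_closed) auto
qed

text \<open>The relations satisfied by the two generators: \<open>c\<close> generates a cyclic normal subgroup on which \<open>d\<close> acts by
\<open>c \<mapsto> c\<^sup>s\<close>. The exponents are integers, which makes \<open>s = -1\<close> an ordinary exponent.\<close>

definition metacyclic_pair ::
  "('a, 'b) monoid_scheme \<Rightarrow> int \<Rightarrow> int \<Rightarrow> int \<Rightarrow> int \<Rightarrow> 'a \<Rightarrow> 'a \<Rightarrow> bool" where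
  "metacyclic_pair H N K s t c d \<longleftrightarrow> c \<in> carrier H \<and> d \<in> carrier H \<and>
     c [^]\<^bsub>H\<^esub> N = \<one>\<^bsub>H\<^esub> \<and> d [^]\<^bsub>H\<^esub> K = c [^]\<^bsub>H\<^esub> t \<and> d \<otimes>\<^bsub>H\<^esub> c = c [^]\<^bsub>H\<^esub> s \<otimes>\<^bsub>H\<^esub> d"

text \<open>\<open>t_fixed\<close> is forced by \<open>d\<close> commuting with \<open>d\<^sup>K = c\<^sup>t\<close>. As \<open>s\<^sup>2 \<equiv> 1\<close>, conjugation by \<open>d\<^sup>k\<close> only depends on
the parity of \<open>k\<close>, and as \<open>K\<close> is even, this parity makes sense modulo \<open>K\<close>.\<close>

locale metacyclic =
  fixes N K s t :: int
  assumes N_pos: "1 \<le> N" and K_pos: "1 \<le> K" and even_K: "even K"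
    and s_square: "N dvd s * s - 1" and t_fixed: "N dvd s * t - t"
begin

definition act :: "int \<Rightarrow> int" where "act k = (if even k then 1 else s)"

text \<open>The pair \<open>(i, k)\<close> stands for \<open>c\<^sup>i d\<^sup>k\<close>. A carry in the exponent of \<open>d\<close> turns \<open>d\<^sup>K\<close> into \<open>c\<^sup>t\<close>.\<close>

definition M :: "(int \<times> int) monoid" where
  "M = \<lparr>carrier = {0..<N} \<times> {0..<K},
        mult = (\<lambda>(i, k) (j, l). ((i + act k * j + t * ((k + l) div K)) mod N, (k + l) mod K)),
        one = (0, 0)\<rparr>"

lemma carrier_M: "carrier M = {0..<N} \<times> {0..<K}" by (simp add: M_def)

lemma mult_M: "(i, k) \<otimes>\<^bsub>M\<^esub> (j, l) =
    ((i + act k * j + t * ((k + l) div K)) mod N, (k + l) mod K)"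
  by (simp add: M_def)

lemma one_M: "\<one>\<^bsub>M\<^esub> = (0, 0)" by (simp add: M_def)

lemma act_mod_K: "act (k mod K) = act k"
  using dvd_mod_iff[OF even_K] by (simp add: act_def)

lemma act_add: "N dvd act (k + l) - act k * act l"
  using s_square by (auto simp: act_def dvd_diff_commute)

lemma act_t: "N dvd t - act k * t"
  using t_fixed by (auto simp: act_def dvd_diff_commute)

lemma carry: "(a mod K + b) div K = (a + b) div K - a div K"
proof -
  have "(a + b) div K = ((a mod K + b) + a div K * K) div K" by (simp add: algebra_simps)
  also have "\<dots> = a div K + (a mod K + b) div K" using K_pos by (subst div_mult_self1) auto
  finally show ?thesis by simp
qed

lemma group_M: "group M"
proof (rule groupI)
  fix x y assume "x \<in> carrier M" "y \<in> carrier M"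
  then show "x \<otimes>\<^bsub>M\<^esub> y \<in> carrier M"
    using N_pos K_pos by (cases x, cases y) (simp add: mult_M carrier_M)
next
  show "\<one>\<^bsub>M\<^esub> \<in> carrier M" using N_pos K_pos by (simp add: one_M carrier_M)
next
  fix x y z assume "x \<in> carrier M" "y \<in> carrier M" "z \<in> carrier M"
  obtain i k j l h p where xyz: "x = (i, k)" "y = (j, l)" "z = (h, p)" by (metis surj_pair)
  \<comment> \<open>Both sides carry \<open>(k + l + p) div K\<close> times in total; they differ by multiples of \<open>N\<close> only,
    because \<open>act\<close> is multiplicative and fixes \<open>t\<close> modulo \<open>N\<close>.\<close>
  have carry': "(a + b mod K) div K = (a + b) div K - b div K" for a b
    using carry[of b a] by (simp add: add.commute)
  have "(i + act k * j + t * ((k + l) div K) + act (k + l) * h + t * (((k + l) mod K + p) div K)) -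
      (i + act k * (j + act l * h + t * ((l + p) div K)) + t * ((k + (l + p) mod K) div K)) =
      (act (k + l) - act k * act l) * h + (t - act k * t) * ((l + p) div K)"
    by (simp add: carry carry' algebra_simps)
  also have "N dvd \<dots>" using act_add act_t by (intro dvd_add dvd_mult2)
  finally have "(i + act k * j + t * ((k + l) div K) + act (k + l) * h + t * (((k + l) mod K + p) div K)) mod N =
      (i + act k * (j + act l * h + t * ((l + p) div K)) + t * ((k + (l + p) mod K) div K)) mod N"
    by (simp only: mod_eq_dvd_iff)
  moreover have "(a + m * (b mod N) + b') mod N = (a + m * b + b') mod N" for a m b b'
  proof -
    have "(a + m * (b mod N) + b') - (a + m * b + b') = N * (- m * (b div N))"
      by (simp add: minus_mult_div_eq_mod[symmetric] algebra_simps)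
    then show ?thesis unfolding mod_eq_dvd_iff by simp
  qed
  ultimately show "x \<otimes>\<^bsub>M\<^esub> y \<otimes>\<^bsub>M\<^esub> z = x \<otimes>\<^bsub>M\<^esub> (y \<otimes>\<^bsub>M\<^esub> z)"
    by (simp add: xyz mult_M act_mod_K mod_simps) (simp add: add.assoc mod_simps)
next
  fix x assume x: "x \<in> carrier M"
  obtain i k where ik: "x = (i, k)" by force
  show "\<one>\<^bsub>M\<^esub> \<otimes>\<^bsub>M\<^esub> x = x" using x by (simp add: ik one_M mult_M carrier_M act_def)
  define l where "l = (- k) mod K"
  define j where "j = (- (act l * i + t * ((l + k) div K))) mod N"
  have "(j, l) \<in> carrier M" using N_pos K_pos by (simp add: carrier_M j_def l_def)
  moreover have "(j, l) \<otimes>\<^bsub>M\<^esub> x = \<one>\<^bsub>M\<^esub>"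
  proof -
    have "(j + act l * i + t * ((l + k) div K)) mod N = 0"
      unfolding j_def add.assoc mod_add_left_eq by simp
    moreover have "(l + k) mod K = 0" by (simp add: l_def mod_simps)
    ultimately show ?thesis by (simp add: ik mult_M one_M)
  qed
  ultimately show "\<exists>y\<in>carrier M. y \<otimes>\<^bsub>M\<^esub> x = \<one>\<^bsub>M\<^esub>" by blast
qed

sublocale M: group M by (rule group_M)

text \<open>The reduction modulo \<open>N\<close> matters for \<open>N = 1\<close>, when \<open>c\<close> is trivial.\<close>

abbreviation c_M :: "int \<times> int" where "c_M \<equiv> (1 mod N, 0)"
abbreviation d_M :: "int \<times> int" where "d_M \<equiv> (0, 1)"

lemma K_ge_2: "2 \<le> K"
  using K_pos even_K by (auto elim!: evenE)

lemma gens_M: "c_M \<in> carrier M" "d_M \<in> carrier M"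
  using N_pos K_ge_2 by (auto simp: carrier_M)

lemma c_M_pow: "c_M [^]\<^bsub>M\<^esub> (i :: int) = (i mod N, 0)"
proof -
  have nat: "c_M [^]\<^bsub>M\<^esub> (n :: nat) = (int n mod N, 0)" for n
    by (induction n) (simp_all add: one_M mult_M act_def mod_simps add.commute)
  show ?thesis
  proof (cases i rule: int_cases2)
    case (nonneg n)
    then show ?thesis by (simp add: int_pow_int nat)
  next
    case (nonpos n)
    have "inv\<^bsub>M\<^esub> (int n mod N, 0) = (- int n mod N, 0)"
      using N_pos K_pos
      by (intro M.inv_equality) (simp_all add: mult_M one_M carrier_M act_def mod_simps)
    then show ?thesis using nonpos by (simp add: M.int_pow_neg_int[OF gens_M(1)] nat)
  qed
qed

lemma d_M_pow: "d_M [^]\<^bsub>M\<^esub> (n :: nat) = (t * (int n div K) mod N, int n mod K)"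
proof (induction n)
  case 0
  then show ?case by (simp add: one_M)
next
  case (Suc n)
  have "t * (int n div K) + t * ((int n mod K + 1) div K) = t * (int (Suc n) div K)"
    unfolding carry by (simp add: algebra_simps)
  then show ?case
    by (simp add: Suc.IH mult_M mod_simps) (simp add: add.commute)
qed

lemma metacyclic_pair_M: "metacyclic_pair M N K s t c_M d_M"
proof -
  have "d_M [^]\<^bsub>M\<^esub> K = d_M [^]\<^bsub>M\<^esub> nat K"
    using K_pos int_pow_int[of M d_M "nat K"] by simp
  also have "\<dots> = c_M [^]\<^bsub>M\<^esub> t"
    unfolding d_M_pow c_M_pow using K_pos by simp
  finally have "d_M [^]\<^bsub>M\<^esub> K = c_M [^]\<^bsub>M\<^esub> t" .
  moreover have "c_M [^]\<^bsub>M\<^esub> N = \<one>\<^bsub>M\<^esub>"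
    by (simp add: c_M_pow one_M)
  moreover have "d_M \<otimes>\<^bsub>M\<^esub> c_M = c_M [^]\<^bsub>M\<^esub> s \<otimes>\<^bsub>M\<^esub> d_M"
    using K_ge_2 by (simp add: c_M_pow mult_M act_def mod_simps)
  ultimately show ?thesis using gens_M by (simp add: metacyclic_pair_def)
qed

end

context group
begin

context
  fixes N K s t :: int and c d :: 'a
  assumes pair: "metacyclic_pair G N K s t c d"
    and s_square: "N dvd s * s - 1"
begin

private lemma closed: "c \<in> carrier G" "d \<in> carrier G"
  using pair by (simp_all add: metacyclic_pair_def)

lemma metacyclic_pow_cong:
  assumes "N dvd i - j"
  shows "c [^] i = c [^] j"
proof -
  obtain q where "i = j + N * q" using assms by (metis diff_eq_eq add.commute dvdE)
  then have "c [^] i = c [^] j \<otimes> (c [^] N) [^] q"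
    using closed by (simp add: int_pow_mult int_pow_pow)
  then show ?thesis using pair closed by (simp add: metacyclic_pair_def)
qed

lemma metacyclic_swap: "d \<otimes> c [^] (i :: int) = c [^] (s * i) \<otimes> d"
proof -
  have nat: "d \<otimes> c [^] (int n) = c [^] (s * int n) \<otimes> d" for n
  proof (induction n)
    case 0
    then show ?case using closed by simp
  next
    case (Suc n)
    have "d \<otimes> c [^] (int (Suc n)) = d \<otimes> c [^] (int n) \<otimes> c"
      using closed int_pow_mult[of c "int n" 1] by (simp add: m_assoc add.commute)
    also have "\<dots> = c [^] (s * int n) \<otimes> (d \<otimes> c)"
      unfolding Suc using closed by (simp add: m_assoc)
    also have "d \<otimes> c = c [^] s \<otimes> d" using pair by (simp add: metacyclic_pair_def)
    also have "c [^] (s * int n) \<otimes> (c [^] s \<otimes> d) = c [^] (s * int (Suc n)) \<otimes> d"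
      using closed int_pow_mult[of c "s * int n" s] by (simp add: m_assoc algebra_simps)
    finally show ?case .
  qed
  show ?thesis
  proof (cases i rule: int_cases2)
    case (nonneg n)
    then show ?thesis using nat by simp
  next
    case (nonpos n)
    have "c [^] (s * int n) \<otimes> (d \<otimes> c [^] i) = d \<otimes> c [^] (int n) \<otimes> c [^] i"
      unfolding nat using closed by (simp add: m_assoc)
    also have "\<dots> = d"
      using closed nonpos int_pow_mult[of c "int n" i] by (simp add: m_assoc)
    also have "\<dots> = c [^] (s * int n) \<otimes> (c [^] (s * i) \<otimes> d)"
      using closed nonpos int_pow_mult[of c "s * int n" "s * i"] by (simp add: m_assoc[symmetric])
    finally show ?thesis using closed by simp
  qed
qed

text \<open>Conjugation by \<open>d\<close> is an involution on the powers of \<open>c\<close>, so \<open>d\<close> and its inverse act in the same way.\<close>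

lemma metacyclic_swap_inv: "inv d \<otimes> c [^] (i :: int) = c [^] (s * i) \<otimes> inv d"
proof -
  have "d \<otimes> c [^] (s * i) = c [^] (s * (s * i)) \<otimes> d" by (rule metacyclic_swap)
  also have "c [^] (s * (s * i)) = c [^] i"
  proof (rule metacyclic_pow_cong)
    have "s * (s * i) - i = (s * s - 1) * i" by (simp add: algebra_simps)
    then show "N dvd s * (s * i) - i" using s_square by simp
  qed
  finally have "inv d \<otimes> (d \<otimes> c [^] (s * i)) \<otimes> inv d = inv d \<otimes> (c [^] i \<otimes> d) \<otimes> inv d" by simp
  then show ?thesis using closed by (simp add: m_assoc[symmetric]) (simp add: m_assoc)
qed

lemma metacyclic_word_eval:
  assumes gens: "range \<phi> = {c, d}"
  shows "\<exists>(i :: int) (k :: int). word_eval G \<phi> w = c [^] i \<otimes> d [^] k"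
proof (induction w)
  case Nil
  have "word_eval G \<phi> [] = c [^] (0 :: int) \<otimes> d [^] (0 :: int)" by simp
  then show ?case by blast
next
  case (Cons a w)
  then obtain i k :: int where w: "word_eval G \<phi> w = c [^] i \<otimes> d [^] k" by blast
  obtain g b where a: "a = (g, b)" by force
  have pow: "x [^] (1 + j) = x \<otimes> x [^] j" "x [^] (j - 1) = inv x \<otimes> x [^] j"
    if "x \<in> carrier G" for x and j :: int
    using that int_pow_mult[of x 1 j] int_pow_mult[of x "- 1" j] int_pow_neg[of x 1] by simp_all
  have "\<phi> g = c \<or> \<phi> g = d" using gens by blast
  then consider "\<phi> g = c" b | "\<phi> g = c" "\<not> b" | "\<phi> g = d" b | "\<phi> g = d" "\<not> b" by blast
  then show ?case
  proof cases
    case 1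
    then have "word_eval G \<phi> (a # w) = c [^] (1 + i) \<otimes> d [^] k"
      using closed by (simp add: a w word_eval_Cons pow m_assoc)
    then show ?thesis by blast
  next
    case 2
    then have "word_eval G \<phi> (a # w) = c [^] (i - 1) \<otimes> d [^] k"
      using closed by (simp add: a w word_eval_Cons pow m_assoc)
    then show ?thesis by blast
  next
    case 3
    then have "word_eval G \<phi> (a # w) = (d \<otimes> c [^] i) \<otimes> d [^] k"
      using closed by (simp add: a w word_eval_Cons m_assoc)
    then have "word_eval G \<phi> (a # w) = c [^] (s * i) \<otimes> d [^] (1 + k)"
      using closed by (simp add: metacyclic_swap pow m_assoc)
    then show ?thesis by blast
  next
    case 4
    then have "word_eval G \<phi> (a # w) = (inv d \<otimes> c [^] i) \<otimes> d [^] k"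
      using closed by (simp add: a w word_eval_Cons m_assoc)
    then have "word_eval G \<phi> (a # w) = c [^] (s * i) \<otimes> d [^] (k - 1)"
      using closed by (simp add: metacyclic_swap_inv pow m_assoc)
    then show ?thesis by blast
  qed
qed

lemma metacyclic_normal_form:
  assumes "1 \<le> N" "1 \<le> K" and gens: "range \<phi> = {c, d}"
  obtains i k where "i \<in> {0..<N}" "k \<in> {0..<K}" "word_eval G \<phi> w = c [^] i \<otimes> d [^] k"
proof -
  obtain i k :: int where w: "word_eval G \<phi> w = c [^] i \<otimes> d [^] k"
    using metacyclic_word_eval[OF gens] by blast
  have "d [^] k = (d [^] K) [^] (k div K) \<otimes> d [^] (k mod K)"
    using closed int_pow_mult[of d "K * (k div K)" "k mod K"] by (simp add: int_pow_pow)
  also have "(d [^] K) [^] (k div K) = c [^] (t * (k div K))"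
    using pair closed by (simp add: metacyclic_pair_def int_pow_pow)
  finally have "word_eval G \<phi> w = c [^] (i + t * (k div K)) \<otimes> d [^] (k mod K)"
    using w closed by (simp add: int_pow_mult m_assoc)
  also have "c [^] (i + t * (k div K)) = c [^] ((i + t * (k div K)) mod N)"
    by (rule metacyclic_pow_cong) (simp add: minus_mod_eq_mult_div)
  finally show ?thesis
    using assms(1,2) by (intro that[of "(i + t * (k div K)) mod N" "k mod K"]) auto
qed

end

end

context metacyclic
begin

text \<open>The homomorphism to \<open>M\<close> given by the universal property sends the normal form \<open>c\<^sup>i d\<^sup>k\<close> to \<open>(i, k)\<close>.
As every element of the presented group has a normal form, the homomorphism is a bijection.\<close>

theorem presented_group_iso_M:
  fixes R :: "('g word \<times> 'g word) set" and gc gd :: 'g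
  assumes gens: "UNIV = {gc, gd}" "gc \<noteq> gd"
    and pair: "metacyclic_pair (presented_group R) N K s t (letter_class R gc) (letter_class R gd)"
    and sat: "satisfies_relations M (\<lambda>g. if g = gc then c_M else d_M) R"
  shows "presented_group R \<cong> M"
proof -
  let ?\<phi> = "\<lambda>g. if g = gc then c_M else d_M"
  let ?c = "letter_class R gc" and ?d = "letter_class R gd"
  interpret P: group "presented_group R" by (rule group_presented_group)
  obtain \<Phi> where hom: "\<Phi> \<in> hom (presented_group R) M"
    and \<Phi>: "\<And>w. \<Phi> (pres_rel R `` {w}) = word_eval M ?\<phi> w"
    using M.presented_group_universal[OF sat] by blast
  have rng: "range ?\<phi> \<subseteq> carrier M" using gens_M by auto
  interpret H: group_hom "presented_group R" M \<Phi>
    using hom by unfold_locales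
  have gen_img: "\<Phi> ?c = c_M" "\<Phi> ?d = d_M"
    using gens(2) by (simp_all add: letter_class_def \<Phi> M.word_eval_letter[OF rng])
  have cd: "?c \<in> carrier (presented_group R)" "?d \<in> carrier (presented_group R)"
    using pair by (simp_all add: metacyclic_pair_def)
  have coord: "\<Phi> (?c [^]\<^bsub>presented_group R\<^esub> i \<otimes>\<^bsub>presented_group R\<^esub> ?d [^]\<^bsub>presented_group R\<^esub> k) = (i, k)"
    if "i \<in> {0..<N}" "k \<in> {0..<K}" for i k
  proof -
    have "d_M [^]\<^bsub>M\<^esub> k = d_M [^]\<^bsub>M\<^esub> nat k"
      using that int_pow_int[of M d_M "nat k"] by simp
    then have "d_M [^]\<^bsub>M\<^esub> k = (0, k)" using that by (simp add: d_M_pow)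
    then show ?thesis
      using that cd by (simp add: H.hom_int_pow gen_img c_M_pow mult_M)
  qed
  have normal: "\<exists>i\<in>{0..<N}. \<exists>k\<in>{0..<K}.
      p = ?c [^]\<^bsub>presented_group R\<^esub> i \<otimes>\<^bsub>presented_group R\<^esub> ?d [^]\<^bsub>presented_group R\<^esub> k"
    if "p \<in> carrier (presented_group R)" for p
  proof -
    obtain w where p: "p = pres_rel R `` {w}"
      using \<open>p \<in> _\<close> by (auto simp: presented_group_def elim: quotientE)
    have "range (letter_class R) = {?c, ?d}" using gens(1) by auto
    from P.metacyclic_normal_form[OF pair s_square N_pos K_pos this, of w]
    show ?thesis unfolding p word_eval_letter_class by blast
  qed
  have "inj_on \<Phi> (carrier (presented_group R))"
    using normal coord by (intro inj_onI) (metis prod.inject)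
  moreover have "\<Phi> ` carrier (presented_group R) = carrier M"
  proof
    show "\<Phi> ` carrier (presented_group R) \<subseteq> carrier M" by auto
    show "carrier M \<subseteq> \<Phi> ` carrier (presented_group R)"
    proof
      fix x assume "x \<in> carrier M"
      then obtain i k where "x = (i, k)" "i \<in> {0..<N}" "k \<in> {0..<K}" by (auto simp: carrier_M)
      then show "x \<in> \<Phi> ` carrier (presented_group R)"
        using coord cd by (intro image_eqI[of _ _ "?c [^]\<^bsub>presented_group R\<^esub> i \<otimes>\<^bsub>presented_group R\<^esub> ?d [^]\<^bsub>presented_group R\<^esub> k"]) auto
    qed
  qed
  ultimately show ?thesis
    using hom unfolding is_iso_def iso_def bij_betw_def by blast
qed

end

section \<open>The five families as metacyclic groups\<close>

lemma UNIV_gen: "(UNIV :: gen set) = {Gen_x, Gen_y}"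
  using gen.exhaust by auto

text \<open>Conjugation by \<open>d\<close> inverts \<open>c\<close> exactly if conjugation by the inverse of \<open>d\<close> does. The presentations of
\<open>T\<close> and \<open>U\<close> use the latter form.\<close>

lemma (in group) inverted_by_conjugation_iff:
  assumes c: "c \<in> carrier G" and d: "d \<in> carrier G"
  shows "inv d \<otimes> (c \<otimes> d) = inv c \<longleftrightarrow> d \<otimes> c = inv c \<otimes> d"
proof -
  have cancel: "inv a \<otimes> (a \<otimes> z) = z" "a \<otimes> (inv a \<otimes> z) = z"
    if "a \<in> carrier G" "z \<in> carrier G" for a z
    using that by (simp_all add: m_assoc[symmetric])
  show ?thesis
  proof
    assume "inv d \<otimes> (c \<otimes> d) = inv c"
    then have "d \<otimes> (inv d \<otimes> (c \<otimes> d)) = d \<otimes> inv c" by simp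
    then have "inv c \<otimes> (c \<otimes> d) \<otimes> c = inv c \<otimes> (d \<otimes> inv c) \<otimes> c"
      using c d by (simp add: cancel)
    then show "d \<otimes> c = inv c \<otimes> d" using c d by (simp add: m_assoc cancel)
  next
    assume "d \<otimes> c = inv c \<otimes> d"
    then have "c \<otimes> (d \<otimes> c) \<otimes> inv c = c \<otimes> (inv c \<otimes> d) \<otimes> inv c" by simp
    then have "c \<otimes> d = d \<otimes> inv c" using c d by (simp add: m_assoc cancel)
    then show "inv d \<otimes> (c \<otimes> d) = inv c" using c d by (simp add: cancel)
  qed
qed

text \<open>In the next four lemmas the relations of a family are equivalent to those of a metacyclic pair in every
group. One direction is used in the presented group, to reach normal forms, and the other one in the model,
to obtain the homomorphism from the presented group.\<close>

lemma (in group) dihedral_relations_iff: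
  assumes "range \<phi> \<subseteq> carrier G"
  shows "satisfies_relations G \<phi>
      {(word_pow wx n, []), (word_pow wy 2, []), (wy @ wx @ word_inv wy, word_inv wx)} \<longleftrightarrow>
    metacyclic_pair G (int n) 2 (- 1) 0 (\<phi> Gen_x) (\<phi> Gen_y)"
proof -
  note evals = word_eval_append[OF assms] word_eval_word_pow[OF assms] word_eval_word_inv[OF assms]
    word_eval_letter[OF assms] word_eval_Cons
  define x y where "x = \<phi> Gen_x" and "y = \<phi> Gen_y"
  have xy: "x \<in> carrier G" "y \<in> carrier G" using assms by (auto simp: x_def y_def)
  have "y \<otimes> (x \<otimes> inv y) = inv x \<longleftrightarrow> y \<otimes> x = inv x \<otimes> y"
    using xy inv_solve_right'[of "inv x" "y \<otimes> x" y] by (auto simp: m_assoc)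
  then show ?thesis
    using assms xy int_pow_neg[of x 1] int_pow_int[of G y 2] int_pow_int[of G x n]
    unfolding satisfies_relations_def metacyclic_pair_def
    by (simp add: evals x_def[symmetric] y_def[symmetric])
qed

lemma (in group) dicyclic_relations_iff:
  assumes "range \<phi> \<subseteq> carrier G"
  shows "satisfies_relations G \<phi>
      {(word_pow wx (2 * n), []), (word_pow wx n, word_pow wy 2),
       (word_inv wy @ wx @ wy, word_inv wx)} \<longleftrightarrow>
    metacyclic_pair G (int (2 * n)) 2 (- 1) (int n) (\<phi> Gen_x) (\<phi> Gen_y)"
proof -
  note evals = word_eval_append[OF assms] word_eval_word_pow[OF assms] word_eval_word_inv[OF assms]
    word_eval_letter[OF assms] word_eval_Cons
  define x y where "x = \<phi> Gen_x" and "y = \<phi> Gen_y"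
  have xy: "x \<in> carrier G" "y \<in> carrier G" using assms by (auto simp: x_def y_def)
  show ?thesis
    using assms xy int_pow_neg[of x 1] int_pow_int[of G y 2] int_pow_int[of G x n]
      int_pow_int[of G x "2 * n"] inverted_by_conjugation_iff[OF xy]
    unfolding satisfies_relations_def metacyclic_pair_def
    by (simp add: evals x_def[symmetric] y_def[symmetric] eq_commute[of "x [^] n"])
qed

text \<open>The roles of the two generators are exchanged: \<open>y\<close> generates the normal subgroup.\<close>

lemma (in group) semidirect_relations_iff:
  assumes "range \<phi> \<subseteq> carrier G"
  shows "satisfies_relations G \<phi>
      {(word_pow wx (2 * n), []), (word_pow wy m, []), (word_inv wx @ wy @ wx, word_inv wy)} \<longleftrightarrow>
    metacyclic_pair G (int m) (int (2 * n)) (- 1) 0 (\<phi> Gen_y) (\<phi> Gen_x)"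
proof -
  note evals = word_eval_append[OF assms] word_eval_word_pow[OF assms] word_eval_word_inv[OF assms]
    word_eval_letter[OF assms] word_eval_Cons
  define x y where "x = \<phi> Gen_x" and "y = \<phi> Gen_y"
  have xy: "x \<in> carrier G" "y \<in> carrier G" using assms by (auto simp: x_def y_def)
  show ?thesis
    using assms xy int_pow_neg[of y 1] int_pow_int[of G y m] int_pow_int[of G x "2 * n"]
      inverted_by_conjugation_iff[OF xy(2,1)]
    unfolding satisfies_relations_def metacyclic_pair_def
    by (auto simp: evals x_def[symmetric] y_def[symmetric])
qed

lemma (in group) semidihedral_relations_iff:
  assumes "range \<phi> \<subseteq> carrier G" and n: "1 \<le> n"
  shows "satisfies_relations G \<phi>
      {(word_pow wx (4 * n), []), (word_pow wy 2, []), (wy @ wx @ wy, word_pow wx (2 * n - 1))} \<longleftrightarrow>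
    metacyclic_pair G (int (4 * n)) 2 (int (2 * n - 1)) 0 (\<phi> Gen_x) (\<phi> Gen_y)"
proof -
  note evals = word_eval_append[OF assms(1)] word_eval_word_pow[OF assms(1)]
    word_eval_word_inv[OF assms(1)] word_eval_letter[OF assms(1)] word_eval_Cons
  define x y where "x = \<phi> Gen_x" and "y = \<phi> Gen_y"
  have xy: "x \<in> carrier G" "y \<in> carrier G" using assms by (auto simp: x_def y_def)
  have "y \<otimes> (x \<otimes> y) = x [^] (2 * n - 1) \<longleftrightarrow> y \<otimes> x = x [^] (2 * n - 1) \<otimes> y"
    if "y [^] (2 :: nat) = \<one>"
  proof -
    have "inv y = y" using that xy by (intro inv_equality) (simp_all add: numeral_2_eq_2)
    then show ?thesis
      using xy inv_solve_right'[of "x [^] (2 * n - 1)" "y \<otimes> x" y] by (auto simp: m_assoc)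
  qed
  then show ?thesis
    using assms xy int_pow_int[of G y 2] int_pow_int[of G x "4 * n"] int_pow_int[of G x "2 * n - 1"]
    unfolding satisfies_relations_def metacyclic_pair_def
    by (auto simp: evals x_def[symmetric] y_def[symmetric])
qed

lemma grp_D_iso:
  assumes "1 \<le> n"
  shows "metacyclic (int n) 2 (- 1) 0" "grp_D n \<cong> metacyclic.M (int n) 2 (- 1) 0"
proof -
  show "metacyclic (int n) 2 (- 1) 0" using assms by unfold_locales auto
  then interpret metacyclic "int n" 2 "- 1" 0 .
  let ?\<phi> = "\<lambda>g. if g = Gen_x then c_M else d_M"
  have rng: "range ?\<phi> \<subseteq> carrier M" using gens_M by auto
  show "grp_D n \<cong> M"
    unfolding grp_D_def
    by (rule presented_group_iso_M[OF UNIV_gen gen.distinct(1)],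
        subst group.dihedral_relations_iff[OF group_presented_group letter_class_closed, symmetric],
        rule letter_class_satisfies, subst M.dihedral_relations_iff[OF rng])
      (simp add: metacyclic_pair_M)
qed

lemma grp_T_iso:
  assumes "1 \<le> n"
  shows "metacyclic (int (2 * n)) 2 (- 1) (int n)"
    "grp_T n \<cong> metacyclic.M (int (2 * n)) 2 (- 1) (int n)"
proof -
  show "metacyclic (int (2 * n)) 2 (- 1) (int n)" using assms by unfold_locales auto
  then interpret metacyclic "int (2 * n)" 2 "- 1" "int n" .
  let ?\<phi> = "\<lambda>g. if g = Gen_x then c_M else d_M"
  have rng: "range ?\<phi> \<subseteq> carrier M" using gens_M by auto
  show "grp_T n \<cong> M"
    unfolding grp_T_def
    by (rule presented_group_iso_M[OF UNIV_gen gen.distinct(1)],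
        subst group.dicyclic_relations_iff[OF group_presented_group letter_class_closed, symmetric],
        rule letter_class_satisfies, subst M.dicyclic_relations_iff[OF rng])
      (use metacyclic_pair_M in simp)
qed

lemma grp_U_iso:
  assumes "1 \<le> n" "1 \<le> m"
  shows "metacyclic (int m) (int (2 * n)) (- 1) 0"
    "grp_U n m \<cong> metacyclic.M (int m) (int (2 * n)) (- 1) 0"
proof -
  show "metacyclic (int m) (int (2 * n)) (- 1) 0" using assms by unfold_locales auto
  then interpret metacyclic "int m" "int (2 * n)" "- 1" 0 .
  let ?\<phi> = "\<lambda>g. if g = Gen_y then c_M else d_M"
  have rng: "range ?\<phi> \<subseteq> carrier M" using gens_M by auto
  have UNIV: "(UNIV :: gen set) = {Gen_y, Gen_x}" using UNIV_gen by auto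
  show "grp_U n m \<cong> M"
    unfolding grp_U_def
    by (rule presented_group_iso_M[OF UNIV gen.distinct(2)],
        subst group.semidirect_relations_iff[OF group_presented_group letter_class_closed, symmetric],
        rule letter_class_satisfies, subst M.semidirect_relations_iff[OF rng])
      (use metacyclic_pair_M in simp)
qed

lemma grp_SD_iso:
  assumes "1 \<le> n"
  shows "metacyclic (int (4 * n)) 2 (int (2 * n - 1)) 0"
    "grp_SD n \<cong> metacyclic.M (int (4 * n)) 2 (int (2 * n - 1)) 0"
proof -
  have "int (2 * n - 1) * int (2 * n - 1) - 1 = int (4 * n) * (int n - 1)"
    using assms by (simp add: of_nat_diff algebra_simps)
  then show "metacyclic (int (4 * n)) 2 (int (2 * n - 1)) 0"
    using assms by unfold_locales (auto simp del: of_nat_mult)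
  then interpret metacyclic "int (4 * n)" 2 "int (2 * n - 1)" 0 .
  let ?\<phi> = "\<lambda>g. if g = Gen_x then c_M else d_M"
  have rng: "range ?\<phi> \<subseteq> carrier M" using gens_M by auto
  show "grp_SD n \<cong> M"
    unfolding grp_SD_def
    by (rule presented_group_iso_M[OF UNIV_gen gen.distinct(1)],
        subst group.semidihedral_relations_iff[OF group_presented_group letter_class_closed assms, symmetric],
        rule letter_class_satisfies, subst M.semidihedral_relations_iff[OF rng assms])
      (use metacyclic_pair_M in simp)
qed

section \<open>Conjugacy and commutation in a metacyclic group\<close>

lemma card_residue_class:
  fixes m N a :: int
  assumes "0 < m" "m dvd N" "0 \<le> N"
  shows "card {i \<in> {0..<N}. m dvd i - a} = nat (N div m)"
proof -
  have "bij_betw (\<lambda>j. a mod m + m * j) {0..<N div m} {i \<in> {0..<N}. m dvd i - a}"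
  proof (rule bij_betw_byWitness[where f' = "\<lambda>i. i div m"])
    have a: "0 \<le> a mod m" "a mod m < m" using assms by auto
    show "\<forall>j\<in>{0..<N div m}. (a mod m + m * j) div m = j" using a assms by auto
    show "\<forall>i\<in>{i \<in> {0..<N}. m dvd i - a}. a mod m + m * (i div m) = i"
      by (auto simp: mod_eq_dvd_iff[symmetric]) (metis mod_mult_div_eq)
    show "(\<lambda>j. a mod m + m * j) ` {0..<N div m} \<subseteq> {i \<in> {0..<N}. m dvd i - a}"
    proof (clarify, intro conjI)
      fix j assume j: "j \<in> {0..<N div m}"
      have "m * (j + 1) \<le> m * (N div m)" using j assms by (intro mult_left_mono) auto
      also have "\<dots> = N" using assms by simp
      finally have "a mod m + m * j < N" using a by (simp add: algebra_simps)
      then show "a mod m + m * j \<in> {0..<N}" using j a assms by simp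
      show "m dvd a mod m + m * j - a" by (simp add: mod_eq_dvd_iff[symmetric])
    qed
    show "(\<lambda>i. i div m) ` {i \<in> {0..<N}. m dvd i - a} \<subseteq> {0..<N div m}"
    proof clarify
      fix i assume i: "i \<in> {0..<N}"
      have "m * (i div m) \<le> i" using assms(1) by (simp add: minus_mod_eq_mult_div[symmetric])
      also have "\<dots> < m * (N div m)" using i assms by simp
      finally have "i div m < N div m" using assms(1) by simp
      then show "i div m \<in> {0..<N div m}" using i assms by (simp add: pos_imp_zdiv_nonneg_iff)
    qed
  qed
  then show ?thesis using bij_betw_same_card by fastforce
qed

text \<open>Written without inverses, conjugacy becomes a congruence in the coordinates of the model.\<close>

lemma (in group) conj_class_iff:
  assumes "x \<in> carrier G"
  shows "y \<in> conj_class G x \<longleftrightarrow> y \<in> carrier G \<and> (\<exists>g\<in>carrier G. y \<otimes> g = g \<otimes> x)"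
proof
  assume "y \<in> conj_class G x"
  then obtain g where "g \<in> carrier G" "y = g \<otimes> x \<otimes> inv g" by (auto simp: conj_class_def)
  then show "y \<in> carrier G \<and> (\<exists>g\<in>carrier G. y \<otimes> g = g \<otimes> x)"
    using assms by (intro conjI bexI[of _ g]) (simp_all add: m_assoc)
next
  assume "y \<in> carrier G \<and> (\<exists>g\<in>carrier G. y \<otimes> g = g \<otimes> x)"
  then obtain g where "y \<in> carrier G" "g \<in> carrier G" "y \<otimes> g = g \<otimes> x" by blast
  then have "y = g \<otimes> x \<otimes> inv g" using assms inv_solve_right[of y "g \<otimes> x" g] by simp
  then show "y \<in> conj_class G x" using \<open>g \<in> carrier G\<close> by (auto simp: conj_class_def)
qed

lemma (in group) conj_class_self: "x \<in> carrier G \<Longrightarrow> x \<in> conj_class G x"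
  by (subst conj_class_iff) (auto intro: bexI[of _ \<one>])

lemma (in group) conj_class_eq:
  assumes x: "x \<in> carrier G" and y: "y \<in> conj_class G x"
  shows "conj_class G y = conj_class G x"
proof -
  obtain g where g: "g \<in> carrier G" "y \<otimes> g = g \<otimes> x" and yc: "y \<in> carrier G"
    using y conj_class_iff[OF x] by blast
  have sub: "conj_class G b \<subseteq> conj_class G a"
    if ab: "a \<in> carrier G" "b \<in> carrier G" "g \<in> carrier G" "b \<otimes> g = g \<otimes> a" for a b g
  proof
    fix z assume "z \<in> conj_class G b"
    then obtain h where h: "z \<in> carrier G" "h \<in> carrier G" "z \<otimes> h = h \<otimes> b"
      using conj_class_iff[OF ab(2)] by blast
    have "z \<otimes> (h \<otimes> g) = z \<otimes> h \<otimes> g" using h(1,2) ab(1-3) by (simp add: m_assoc)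
    also have "\<dots> = h \<otimes> (b \<otimes> g)" unfolding h(3) using h(1,2) ab(1-3) by (simp add: m_assoc)
    also have "\<dots> = h \<otimes> g \<otimes> a" unfolding ab(4) using h(1,2) ab(1-3) by (simp add: m_assoc)
    finally show "z \<in> conj_class G a"
      using h ab unfolding conj_class_iff[OF ab(1)] by (intro conjI bexI[of _ "h \<otimes> g"]) auto
  qed
  have "x \<otimes> inv g = inv g \<otimes> y"
  proof -
    have "inv g \<otimes> (y \<otimes> g) \<otimes> inv g = inv g \<otimes> (g \<otimes> x) \<otimes> inv g" by (simp add: g(2))
    then show ?thesis using g(1) x yc by (simp add: m_assoc) (simp add: m_assoc[symmetric])
  qed
  then show ?thesis using sub[OF x yc g] sub[OF yc x inv_closed[OF g(1)]] by blast
qed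

lemma (in group) card_conj_classes:
  assumes fin: "finite S" and S: "S \<subseteq> carrier G"
    and closed: "\<And>x. x \<in> S \<Longrightarrow> conj_class G x \<subseteq> S"
    and card: "\<And>x. x \<in> S \<Longrightarrow> card (conj_class G x) = p"
  shows "p * card (conj_class G ` S) = card S"
proof -
  have "\<Union> (conj_class G ` S) = S" using closed conj_class_self S by blast
  moreover have "p * card (conj_class G ` S) = card (\<Union> (conj_class G ` S))"
  proof (rule card_partition)
    show "finite (\<Union> (conj_class G ` S))" using calculation fin by simp
    fix A B assume "A \<in> conj_class G ` S" "B \<in> conj_class G ` S" "A \<noteq> B"
    then show "A \<inter> B = {}" using conj_class_eq S by blast
  qed (use fin card in auto)
  ultimately show ?thesis by simp
qed

text \<open>One clique, named \<open>-1\<close>, with \<open>a\<close> vertices and \<open>e\<close> cliques, named \<open>0, \<dots>, e - 1\<close>, with \<open>b\<close> vertices each.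
In the graphs below the names are \<open>-1\<close> for the classes of \<open>c\<^sup>i d\<^sup>k\<close> with \<open>k\<close> even and a residue of \<open>i\<close> for
those with \<open>k\<close> odd.\<close>

definition clique_type :: "'v pair_pre_digraph \<Rightarrow> nat \<Rightarrow> nat \<Rightarrow> nat \<Rightarrow> bool" where
  "clique_type \<Gamma> a e b \<longleftrightarrow> (\<exists>f :: 'v \<Rightarrow> int. clique_union \<Gamma> f \<and>
     f ` pverts \<Gamma> = insert (- 1) {0..<int e} \<and> clique_size \<Gamma> f (- 1) = a \<and>
     (\<forall>c\<in>{0..<int e}. clique_size \<Gamma> f c = b))"

locale nonabelian_metacyclic = metacyclic +
  assumes nonabelian: "\<not> N dvd 1 - s"
begin

text \<open>\<open>fix_ord\<close> is the number of elements of \<open>\<langle>c\<rangle>\<close> that commute with \<open>d\<close>, and \<open>move_ord\<close> is the order of the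
commutator subgroup, which is generated by \<open>c\<close> to the power \<open>1 - s\<close>.\<close>

definition fix_ord :: int where "fix_ord = gcd (1 - s) N"
definition move_ord :: int where "move_ord = N div fix_ord"
definition n_odd_cliques :: int where "n_odd_cliques = gcd fix_ord move_ord"

lemma pos: "0 < fix_ord" "0 < move_ord" "0 < n_odd_cliques"
proof -
  show f: "0 < fix_ord" using N_pos by (auto simp: fix_ord_def)
  show "0 < move_ord"
    using N_pos f by (simp add: move_ord_def fix_ord_def pos_imp_zdiv_pos_iff zdvd_imp_le)
  then show "0 < n_odd_cliques" by (simp add: n_odd_cliques_def)
qed

lemma N_eq: "N = fix_ord * move_ord"
  by (simp add: move_ord_def fix_ord_def)

lemma dvds: "fix_ord dvd N" "move_ord dvd N" "n_odd_cliques dvd fix_ord" "n_odd_cliques dvd move_ord"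
    "n_odd_cliques dvd N" "fix_ord dvd 1 - s"
proof -
  show f: "fix_ord dvd N" "fix_ord dvd 1 - s" by (simp_all add: fix_ord_def)
  show "move_ord dvd N" using dvd_triv_right[of move_ord fix_ord] N_eq by argo
  show o: "n_odd_cliques dvd fix_ord" "n_odd_cliques dvd move_ord" by (simp_all add: n_odd_cliques_def)
  show "n_odd_cliques dvd N" using o(1) f(1) by (rule dvd_trans)
qed

lemma moved_iff: "N dvd (1 - s) * z \<longleftrightarrow> move_ord dvd z"
proof
  assume "move_ord dvd z"
  then have "fix_ord * move_ord dvd (1 - s) * z" using dvds(6) by (intro mult_dvd_mono)
  then show "N dvd (1 - s) * z" using N_eq by argo
next
  assume "N dvd (1 - s) * z"
  moreover obtain u v where uv: "u * (1 - s) + v * N = fix_ord"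
    using bezout_int unfolding fix_ord_def by blast
  moreover have "N dvd v * N * z" by simp
  ultimately have "N dvd u * ((1 - s) * z) + v * N * z" by (intro dvd_add dvd_mult[of N "(1 - s) * z"])
  also have "u * ((1 - s) * z) + v * N * z = fix_ord * z" unfolding uv[symmetric] by (simp add: algebra_simps)
  finally have "fix_ord * move_ord dvd fix_ord * z" using N_eq by argo
  then show "move_ord dvd z" using pos by simp
qed

lemma move_ord_gt_1: "1 < move_ord"
  using moved_iff[of 1] nonabelian pos(2) by (cases "move_ord = 1") auto

text \<open>Commutation means \<open>(1 - s\<^sup>l) i \<equiv> (1 - s\<^sup>k) j (mod N)\<close>, the carries being the same on both sides. The
coefficients are \<open>0\<close> for even exponents and \<open>1 - s\<close> for odd ones.\<close>

lemma commute_iff: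
  assumes "(i, k) \<in> carrier M" "(j, l) \<in> carrier M"
  shows "(i, k) \<otimes>\<^bsub>M\<^esub> (j, l) = (j, l) \<otimes>\<^bsub>M\<^esub> (i, k) \<longleftrightarrow>
    (even k \<and> even l) \<or> (even k \<and> odd l \<and> move_ord dvd i) \<or> (odd k \<and> even l \<and> move_ord dvd j) \<or>
    (odd k \<and> odd l \<and> move_ord dvd i - j)"
proof -
  have "(i, k) \<otimes>\<^bsub>M\<^esub> (j, l) = (j, l) \<otimes>\<^bsub>M\<^esub> (i, k) \<longleftrightarrow>
      N dvd (i + act k * j) - (j + act l * i)"
    by (simp add: mult_M add.commute[of l k] mod_eq_dvd_iff)
  also have "(i + act k * j) - (j + act l * i) = (1 - act l) * i - (1 - act k) * j"
    by (simp add: algebra_simps)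
  also have "N dvd \<dots> \<longleftrightarrow> (even k \<and> even l) \<or> (even k \<and> odd l \<and> move_ord dvd i) \<or>
      (odd k \<and> even l \<and> move_ord dvd j) \<or> (odd k \<and> odd l \<and> move_ord dvd i - j)"
    using moved_iff[of i] moved_iff[of j] moved_iff[of "i - j"]
    by (auto simp: act_def right_diff_distrib)
  finally show ?thesis .
qed

lemma center_M: "grp_center M = {(i, k) \<in> carrier M. even k \<and> move_ord dvd i}"
proof -
  have c: "(1, 0) \<in> carrier M" "(0, 1) \<in> carrier M"
    using nonabelian N_pos K_ge_2 by (auto simp: carrier_M intro: le_neq_trans)
  have "(i, k) \<in> grp_center M \<longleftrightarrow> even k \<and> move_ord dvd i" if "(i, k) \<in> carrier M" for i k
  proof
    assume "(i, k) \<in> grp_center M"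
    then have "(i, k) \<otimes>\<^bsub>M\<^esub> (1, 0) = (1, 0) \<otimes>\<^bsub>M\<^esub> (i, k)" "(i, k) \<otimes>\<^bsub>M\<^esub> (0, 1) = (0, 1) \<otimes>\<^bsub>M\<^esub> (i, k)"
      using c by (auto simp: grp_center_def)
    then show "even k \<and> move_ord dvd i"
      using commute_iff[OF that c(1)] commute_iff[OF that c(2)] move_ord_gt_1 by auto
  next
    assume "even k \<and> move_ord dvd i"
    then have "(i, k) \<otimes>\<^bsub>M\<^esub> y = y \<otimes>\<^bsub>M\<^esub> (i, k)" if "y \<in> carrier M" for y
      using commute_iff[OF \<open>(i, k) \<in> carrier M\<close>, of "fst y" "snd y"] that by auto
    then show "(i, k) \<in> grp_center M" using that by (simp add: grp_center_def)
  qed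
  then show ?thesis by (auto simp: grp_center_def)
qed

lemma conj_M_iff:
  assumes x: "(i, k) \<in> carrier M" and y: "(i', k') \<in> carrier M"
  shows "(i', k') \<in> conj_class M (i, k) \<longleftrightarrow>
    k' = k \<and> (\<exists>j l. (j, l) \<in> carrier M \<and> N dvd (i' + act k * j) - (j + act l * i))"
proof -
  have "(i', k') \<otimes>\<^bsub>M\<^esub> (j, l) = (j, l) \<otimes>\<^bsub>M\<^esub> (i, k) \<longleftrightarrow>
      k' = k \<and> N dvd (i' + act k * j) - (j + act l * i)" for j l
  proof -
    have "(k' + l) mod K = (l + k) mod K \<longleftrightarrow> k' = k"
    proof
      assume "(k' + l) mod K = (l + k) mod K"
      then have "K dvd k' - k" by (simp add: mod_eq_dvd_iff)
      then show "k' = k" using x y by (simp add: carrier_M mod_eq_dvd_iff[symmetric])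
    qed (simp add: add.commute)
    then show ?thesis by (auto simp: mult_M add.commute[of l k] mod_eq_dvd_iff)
  qed
  then show ?thesis unfolding M.conj_class_iff[OF x] using y by (auto simp: Bex_def)
qed

lemma conj_class_even:
  assumes x: "(i, k) \<in> carrier M" and "even k"
  shows "conj_class M (i, k) = {(i, k), ((s * i) mod N, k)}"
proof -
  have in_carrier: "((s * i) mod N, k) \<in> carrier M" using x N_pos by (simp add: carrier_M)
  have "(i', k') \<in> conj_class M (i, k) \<longleftrightarrow> k' = k \<and> (i' = i \<or> i' = (s * i) mod N)"
    if y: "(i', k') \<in> carrier M" for i' k'
  proof -
    have div_iff: "N dvd (i' + act k * j) - (j + act l * i) \<longleftrightarrow> (if even l then i' = i else i' = (s * i) mod N)"
      if "(j, l) \<in> carrier M" for j l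
    proof -
      have "N dvd i' - z \<longleftrightarrow> i' = z mod N" for z
        using y by (simp add: carrier_M mod_eq_dvd_iff[symmetric])
      moreover have "i mod N = i" using x by (simp add: carrier_M)
      ultimately show ?thesis using \<open>even k\<close> by (simp add: act_def)
    qed
    have "(0, 0) \<in> carrier M" "(0, 1) \<in> carrier M"
      using N_pos K_ge_2 by (auto simp: carrier_M)
    then have "i' = i \<or> i' = (s * i) mod N \<Longrightarrow>
        \<exists>j l. (j, l) \<in> carrier M \<and> N dvd (i' + act k * j) - (j + act l * i)"
      using div_iff[of 0 0] div_iff[of 0 1] even_zero odd_one by metis
    moreover have "i' = i \<or> i' = (s * i) mod N"
      if "(j, l) \<in> carrier M" "N dvd (i' + act k * j) - (j + act l * i)" for j l
      using div_iff[OF that(1)] that(2) by presburger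
    ultimately show ?thesis unfolding conj_M_iff[OF x y] by blast
  qed
  moreover have "conj_class M (i, k) \<subseteq> carrier M" using M.conj_class_iff[OF x] by blast
  ultimately show ?thesis using x in_carrier by auto
qed

text \<open>For odd \<open>k\<close>, conjugation by \<open>c\<^sup>j\<close> shifts \<open>i\<close> by \<open>(1 - s) j\<close>, and conjugation by \<open>d\<close> replaces \<open>i\<close> by
\<open>s i \<equiv> i (mod 1 - s)\<close>. So the class consists of all exponents congruent to \<open>i\<close> modulo \<open>gcd (1 - s, N)\<close>.\<close>

lemma conj_class_odd:
  assumes x: "(i, k) \<in> carrier M" and "odd k"
  shows "conj_class M (i, k) = {i' \<in> {0..<N}. fix_ord dvd i' - i} \<times> {k}"
proof -
  have "(i', k') \<in> conj_class M (i, k) \<longleftrightarrow> k' = k \<and> fix_ord dvd i' - i"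
    if y: "(i', k') \<in> carrier M" for i' k'
  proof -
    have "\<exists>j l. (j, l) \<in> carrier M \<and> N dvd (i' + act k * j) - (j + act l * i)" if d: "fix_ord dvd i' - i"
    proof -
      obtain u v where uv: "u * (1 - s) + v * N = fix_ord"
        using bezout_int unfolding fix_ord_def by blast
      obtain w where w: "i' - i = fix_ord * w" using d by blast
      define j where "j = (u * w) mod N"
      have "N dvd u * w - j" by (simp add: j_def minus_mod_eq_mult_div)
      then have "N dvd (u * w - j) * (1 - s) + N * (v * w)" by simp
      also have "(u * w - j) * (1 - s) + N * (v * w) = w * (u * (1 - s) + v * N) - (1 - s) * j"
        by (simp add: algebra_simps)
      also have "\<dots> = (i' - i) - (1 - s) * j" unfolding uv w by simp
      also have "\<dots> = (i' + act k * j) - (j + act 0 * i)"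
        using \<open>odd k\<close> by (simp add: act_def algebra_simps)
      finally show ?thesis
        using N_pos K_pos by (intro exI[of _ j] exI[of _ 0]) (auto simp: carrier_M j_def)
    qed
    moreover have "fix_ord dvd i' - i" if "N dvd (i' + act k * j) - (j + act l * i)" for j l
    proof -
      have "fix_ord dvd (i' + act k * j) - (j + act l * i)" using that dvds(1) by (rule dvd_trans[rotated])
      moreover have "fix_ord dvd (1 - s) * j + (act l - 1) * i"
        using dvds(6) by (auto simp: act_def dvd_diff_commute intro!: dvd_add dvd_mult2)
      moreover have "(i' + act k * j) - (j + act l * i) + ((1 - s) * j + (act l - 1) * i) = i' - i"
        using \<open>odd k\<close> by (simp add: act_def algebra_simps)
      ultimately show ?thesis by (metis dvd_add)
    qed
    ultimately show ?thesis unfolding conj_M_iff[OF x y] by blast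
  qed
  moreover have "conj_class M (i, k) \<subseteq> carrier M" using M.conj_class_iff[OF x] by blast
  ultimately show ?thesis using x by (auto simp: carrier_M)
qed

text \<open>The name of the clique that contains the conjugacy class of a non-central element.\<close>

definition kind :: "int \<times> int \<Rightarrow> int" where
  "kind = (\<lambda>(i, k). if even k then - 1 else i mod n_odd_cliques)"

lemma kind_conj_class:
  assumes "x \<in> carrier M"
  shows "kind ` conj_class M x = {kind x}"
proof -
  have "kind y = kind x" if y_conj: "y \<in> conj_class M x" for y
  proof (cases x)
    case (Pair i k)
    show ?thesis
    proof (cases "even k")
      case True
      then show ?thesis using that conj_class_even[of i k] assms by (auto simp: Pair kind_def)
    next
      case False
      then obtain i' where y: "y = (i', k)" "fix_ord dvd i' - i"
        using y_conj conj_class_odd[of i k] assms by (auto simp: Pair)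
      have "n_odd_cliques dvd i' - i" using dvds(3) y(2) by (rule dvd_trans)
      then show ?thesis using False by (simp add: Pair y kind_def mod_eq_dvd_iff)
    qed
  qed
  then show ?thesis using M.conj_class_self[OF assms] by blast
qed

text \<open>For two odd exponents, the elements with \<open>i\<close> and \<open>j\<close> commute if \<open>i \<equiv> j\<close> modulo \<open>move_ord\<close>, and the
classes allow to change \<open>i\<close> and \<open>j\<close> by multiples of \<open>fix_ord\<close>. By Bezout, both together amount to a
congruence modulo the greatest common divisor. An element with an even exponent that commutes with one with
an odd exponent is central.\<close>

lemma commuting_representatives_iff:
  assumes x: "x \<in> carrier M - grp_center M" and y: "y \<in> carrier M - grp_center M"
  shows "(\<exists>x'\<in>conj_class M x. \<exists>y'\<in>conj_class M y. x' \<otimes>\<^bsub>M\<^esub> y' = y' \<otimes>\<^bsub>M\<^esub> x') \<longleftrightarrow> kind x = kind y"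
proof -
  obtain i k j l where xy: "x = (i, k)" "y = (j, l)" by (metis surj_pair)
  have c: "(i, k) \<in> carrier M" "(j, l) \<in> carrier M" using x y by (auto simp: xy)
  have class_carrier: "conj_class M z \<subseteq> carrier M" if "z \<in> carrier M" for z
    using M.conj_class_iff[OF that] by blast
  have nonneg: "0 \<le> z mod n_odd_cliques" for z using pos by simp
  \<comment> \<open>Conjugates of a non-central element with an even exponent are not central.\<close>
  have even_moved: "\<not> move_ord dvd i'" if "(i0, k0) \<in> carrier M - grp_center M" "even k0"
    "(i', k') \<in> conj_class M (i0, k0)" for i0 k0 i' k'
  proof -
    have "\<not> N dvd (1 - s) * i0" using that center_M moved_iff by auto
    moreover have "N dvd (1 - s) * i0" if "N dvd (1 - s) * ((s * i0) mod N)"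
    proof -
      have "N dvd (1 - s) * (s * i0 - (s * i0) mod N)" by (simp add: minus_mod_eq_mult_div)
      from dvd_mult[OF dvd_add[OF that this], of s]
      have "N dvd (s * s) * ((1 - s) * i0)" by (simp add: algebra_simps)
      moreover have "N dvd (s * s - 1) * ((1 - s) * i0)" using s_square by simp
      ultimately have "N dvd (s * s) * ((1 - s) * i0) - (s * s - 1) * ((1 - s) * i0)" by (rule dvd_diff)
      then show ?thesis by (simp add: algebra_simps)
    qed
    ultimately show ?thesis using that conj_class_even[of i0 k0] by (auto simp: moved_iff)
  qed
  consider "even k" "even l" | "even k" "odd l" | "odd k" "even l" | "odd k" "odd l" by blast
  then show ?thesis
  proof cases
    case 1
    then have "x \<otimes>\<^bsub>M\<^esub> y = y \<otimes>\<^bsub>M\<^esub> x" using commute_iff[OF c] by (simp add: xy)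
    then show ?thesis
      using 1 M.conj_class_self[OF c(1)] M.conj_class_self[OF c(2)] by (auto simp: xy kind_def)
  next
    case 2
    have "x' \<otimes>\<^bsub>M\<^esub> y' \<noteq> y' \<otimes>\<^bsub>M\<^esub> x'"
      if conj: "x' \<in> conj_class M x" "y' \<in> conj_class M y" for x' y'
    proof -
      obtain i' j' where xy': "x' = (i', k)" "y' = (j', l)"
        using conj 2 conj_class_even[OF c(1)] conj_class_odd[OF c(2)] by (auto simp: xy)
      then show ?thesis
        using commute_iff[of i' k j' l] conj 2 even_moved[of i k i' k] x class_carrier c by (auto simp: xy)
    qed
    then show ?thesis using 2 nonneg[of j] by (auto simp: xy kind_def)
  next
    case 3
    have "x' \<otimes>\<^bsub>M\<^esub> y' \<noteq> y' \<otimes>\<^bsub>M\<^esub> x'"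
      if conj: "x' \<in> conj_class M x" "y' \<in> conj_class M y" for x' y'
    proof -
      obtain i' j' where xy': "x' = (i', k)" "y' = (j', l)"
        using conj 3 conj_class_even[OF c(2)] conj_class_odd[OF c(1)] by (auto simp: xy)
      then show ?thesis
        using commute_iff[of i' k j' l] conj 3 even_moved[of j l j' l] y class_carrier c by (auto simp: xy)
    qed
    then show ?thesis using 3 nonneg[of i] by (auto simp: xy kind_def)
  next
    case 4
    have "n_odd_cliques dvd i - j"
      if conj: "x' \<in> conj_class M x" "y' \<in> conj_class M y" "x' \<otimes>\<^bsub>M\<^esub> y' = y' \<otimes>\<^bsub>M\<^esub> x'" for x' y'
    proof -
      obtain i' j' where xy': "x' = (i', k)" "fix_ord dvd i' - i" "y' = (j', l)" "fix_ord dvd j' - j"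
        using conj 4 conj_class_odd[OF c(2)] conj_class_odd[OF c(1)] by (auto simp: xy)
      have "move_ord dvd i' - j'"
        using commute_iff[of i' k j' l] conj 4 class_carrier c by (auto simp: xy xy')
      from dvd_add[OF dvd_diff[OF dvd_trans[OF dvds(4) this] dvd_trans[OF dvds(3) xy'(2)]]
          dvd_trans[OF dvds(3) xy'(4)]]
      have "n_odd_cliques dvd (i' - j') - (i' - i) + (j' - j)" .
      then show ?thesis by (simp add: algebra_simps)
    qed
    moreover have "\<exists>x'\<in>conj_class M x. \<exists>y'\<in>conj_class M y. x' \<otimes>\<^bsub>M\<^esub> y' = y' \<otimes>\<^bsub>M\<^esub> x'"
      if ij: "n_odd_cliques dvd i - j"
    proof -
      obtain u v where uv: "u * fix_ord + v * move_ord = n_odd_cliques"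
        using bezout_int unfolding n_odd_cliques_def by blast
      obtain w where w: "i - j = n_odd_cliques * w" using ij by blast
      \<comment> \<open>A conjugate of \<open>x\<close> whose exponent differs from \<open>j\<close> by the multiple \<open>v w\<close> of \<open>move_ord\<close>.\<close>
      define i' where "i' = (i - u * w * fix_ord) mod N"
      have diff: "N dvd i - u * w * fix_ord - i'" by (simp add: i'_def minus_mod_eq_mult_div)
      have "fix_ord dvd (i - u * w * fix_ord - i') + u * w * fix_ord"
        by (rule dvd_add[OF dvd_trans[OF dvds(1) diff] dvd_triv_right])
      then have "fix_ord dvd i' - i" by (simp add: dvd_diff_commute)
      then have "(i', k) \<in> conj_class M x"
        using conj_class_odd[OF c(1)] 4 N_pos by (auto simp: xy i'_def)
      moreover have "(i', k) \<in> carrier M" using c N_pos by (simp add: carrier_M i'_def)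
      moreover have "move_ord dvd i' - j"
      proof -
        have "move_ord dvd v * w * move_ord - (i - u * w * fix_ord - i')"
          by (rule dvd_diff[OF dvd_triv_right dvd_trans[OF dvds(2) diff]])
        also have "v * w * move_ord - (i - u * w * fix_ord - i') =
            (u * fix_ord + v * move_ord) * w - i + i'" by (simp add: algebra_simps)
        also have "\<dots> = i' - j" unfolding uv w[symmetric] by simp
        finally show ?thesis .
      qed
      ultimately show ?thesis
        using commute_iff[of i' k j l] c 4 M.conj_class_self[OF c(2)] by (auto simp: xy)
    qed
    moreover have "kind x = kind y \<longleftrightarrow> n_odd_cliques dvd i - j"
      using 4 by (simp add: xy kind_def mod_eq_dvd_iff)
    ultimately show ?thesis by blast
  qed
qed

end

section \<open>The commuting conjugacy class graph of a metacyclic group\<close>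

lemma pverts_ccc_graph: "pverts (ccc_graph G) = conj_class G ` (carrier G - grp_center G)"
  by (simp add: ccc_graph_def Let_def)

lemma parcs_ccc_graph: "(A, B) \<in> parcs (ccc_graph G) \<longleftrightarrow>
    A \<in> pverts (ccc_graph G) \<and> B \<in> pverts (ccc_graph G) \<and> A \<noteq> B \<and>
    (\<exists>x\<in>A. \<exists>y\<in>B. x \<otimes>\<^bsub>G\<^esub> y = y \<otimes>\<^bsub>G\<^esub> x)"
  by (simp add: ccc_graph_def Let_def)

lemma (in group) noncentral_conj:
  assumes x: "x \<in> carrier G - grp_center G" and y: "y \<in> conj_class G x"
  shows "y \<in> carrier G - grp_center G"
proof -
  have xc: "x \<in> carrier G" using x by simp
  then obtain g where g: "y \<in> carrier G" "g \<in> carrier G" "y \<otimes> g = g \<otimes> x"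
    using y conj_class_iff by blast
  have "y = x" if "y \<in> grp_center G"
  proof -
    have "g \<otimes> y = g \<otimes> x" using that g by (simp add: grp_center_def)
    then show ?thesis using g xc by simp
  qed
  then show ?thesis using x g(1) by blast
qed

context nonabelian_metacyclic
begin

definition class_kind :: "(int \<times> int) set \<Rightarrow> int" where
  "class_kind A = the_elem (kind ` A)"

lemma class_kind: "x \<in> carrier M \<Longrightarrow> class_kind (conj_class M x) = kind x"
  by (simp add: class_kind_def kind_conj_class)

lemma finite_M: "finite (carrier M)"
  by (simp add: carrier_M)

lemma clique_union_M: "clique_union (ccc_graph M) class_kind"
proof -
  let ?S = "carrier M - grp_center M"
  have "(\<exists>x'\<in>A. \<exists>y'\<in>B. x' \<otimes>\<^bsub>M\<^esub> y' = y' \<otimes>\<^bsub>M\<^esub> x') \<longleftrightarrow> class_kind A = class_kind B"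
    if AB: "A \<in> conj_class M ` ?S" "B \<in> conj_class M ` ?S" for A B
  proof -
    obtain x y where "x \<in> ?S" "y \<in> ?S" "A = conj_class M x" "B = conj_class M y" using AB by blast
    then show ?thesis using commuting_representatives_iff[of x y] by (simp add: class_kind)
  qed
  then show ?thesis
    using finite_M unfolding clique_union_def ccc_graph_def Let_def by auto
qed

lemma classes_of_kind:
  "{A \<in> pverts (ccc_graph M). class_kind A = c} =
    conj_class M ` {x \<in> carrier M - grp_center M. kind x = c}"
proof -
  have "class_kind (conj_class M x) = kind x" if "x \<in> carrier M - grp_center M" for x
    using that by (simp add: class_kind)
  then show ?thesis by (auto simp: pverts_ccc_graph)
qed

text \<open>The non-central elements of a given kind are a union of conjugacy classes. If these all have size \<open>p\<close>, then
there are as many of them as the number of elements divided by \<open>p\<close>.\<close>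

lemma card_classes_of_kind:
  assumes "\<And>x. x \<in> carrier M - grp_center M \<Longrightarrow> kind x = c \<Longrightarrow> card (conj_class M x) = p"
  shows "p * clique_size (ccc_graph M) class_kind c = card {x \<in> carrier M - grp_center M. kind x = c}"
  unfolding clique_size_def classes_of_kind
proof (rule M.card_conj_classes)
  fix x assume x: "x \<in> {x \<in> carrier M - grp_center M. kind x = c}"
  show "conj_class M x \<subseteq> {x \<in> carrier M - grp_center M. kind x = c}"
    using M.noncentral_conj[of x] kind_conj_class[of x] x by blast
qed (use assms finite_M in auto)

lemma card_parity: "card {k \<in> {0..<K}. even k} = nat (K div 2)" "card {k \<in> {0..<K}. odd k} = nat (K div 2)"
  using card_residue_class[of 2 K 0] card_residue_class[of 2 K 1] even_K K_pos by simp_all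

text \<open>Non-central elements with an even exponent have classes \<open>{c\<^sup>i d\<^sup>k, c\<^sup>s\<^sup>i d\<^sup>k}\<close> of size \<open>2\<close>.\<close>

lemma clique_size_even:
  "2 * clique_size (ccc_graph M) class_kind (- 1) = nat (N - fix_ord) * nat (K div 2)"
proof -
  have "2 * clique_size (ccc_graph M) class_kind (- 1) =
      card {x \<in> carrier M - grp_center M. kind x = - 1}"
  proof (rule card_classes_of_kind)
    fix x assume x: "x \<in> carrier M - grp_center M" "kind x = - 1"
    obtain i k where ik: "x = (i, k)" by force
    have "even k"
    proof (rule ccontr)
      assume "odd k"
      then have "i mod n_odd_cliques = - 1" using x(2) by (simp add: ik kind_def)
      moreover have "0 \<le> i mod n_odd_cliques" using pos by simp
      ultimately show False by simp
    qed
    moreover have "(s * i) mod N \<noteq> i"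
    proof
      assume "(s * i) mod N = i"
      then have "(s * i) mod N = i mod N" using x by (simp add: ik carrier_M)
      then have "N dvd i - s * i" by (simp add: mod_eq_dvd_iff dvd_diff_commute)
      also have "i - s * i = (1 - s) * i" by (simp add: algebra_simps)
      finally show False using x \<open>even k\<close> by (simp add: moved_iff ik center_M)
    qed
    ultimately show "card (conj_class M x) = 2"
      using x conj_class_even[of i k] by (auto simp: ik)
  qed
  also have "{x \<in> carrier M - grp_center M. kind x = - 1} =
      ({0..<N} - {i \<in> {0..<N}. move_ord dvd i - 0}) \<times> {k \<in> {0..<K}. even k}"
  proof -
    have "i mod n_odd_cliques \<noteq> - 1" for i
      using pos(3) pos_mod_sign[of n_odd_cliques i] by linarith
    then have "kind (i, k) = - 1 \<longleftrightarrow> even k" for i k by (simp add: kind_def)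
    then show ?thesis unfolding center_M by (auto simp: carrier_M)
  qed
  also have "card \<dots> = (nat N - nat (N div move_ord)) * nat (K div 2)"
  proof -
    have "card ({0..<N} - {i \<in> {0..<N}. move_ord dvd i - 0}) =
        card {0..<N} - card {i \<in> {0..<N}. move_ord dvd i - 0}"
      by (rule card_Diff_subset, rule finite_subset[of _ "{0..<N}"]) auto
    also have "\<dots> = nat N - nat (N div move_ord)"
      using card_residue_class[OF pos(2) dvds(2), of 0] N_pos by simp
    finally show ?thesis by (simp only: card_cartesian_product card_parity)
  qed
  also have "N div move_ord = fix_ord"
  proof -
    have "N div move_ord = fix_ord * move_ord div move_ord" using N_eq by argo
    then show ?thesis using pos by simp
  qed
  also have "nat N - nat fix_ord = nat (N - fix_ord)" using pos by (simp add: nat_diff_distrib')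
  finally show ?thesis .
qed

lemma clique_size_odd:
  assumes c: "c \<in> {0..<n_odd_cliques}"
  shows "clique_size (ccc_graph M) class_kind c = nat (fix_ord div n_odd_cliques * (K div 2))"
proof -
  have kind_iff: "kind (i, k) = c \<longleftrightarrow> odd k \<and> n_odd_cliques dvd i - c" for i k
    using c by (auto simp: kind_def mod_eq_dvd_iff[symmetric])
  have "nat (N div fix_ord) * clique_size (ccc_graph M) class_kind c =
      card {x \<in> carrier M - grp_center M. kind x = c}"
  proof (rule card_classes_of_kind)
    fix x assume x: "x \<in> carrier M - grp_center M" "kind x = c"
    obtain i k where ik: "x = (i, k)" by force
    have "odd k" using x(2) kind_iff by (simp add: ik)
    then have "conj_class M x = {i' \<in> {0..<N}. fix_ord dvd i' - i} \<times> {k}"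
      using conj_class_odd[of i k] x by (simp add: ik)
    then show "card (conj_class M x) = nat (N div fix_ord)"
      using card_residue_class[OF pos(1) dvds(1), of i] N_pos by (simp add: card_cartesian_product)
  qed
  also have "{x \<in> carrier M - grp_center M. kind x = c} =
      {i \<in> {0..<N}. n_odd_cliques dvd i - c} \<times> {k \<in> {0..<K}. odd k}"
    (is "?A = ?B")
  proof (rule Set.set_eqI)
    fix x :: "int \<times> int"
    obtain i k where "x = (i, k)" by force
    then show "x \<in> ?A \<longleftrightarrow> x \<in> ?B"
      unfolding center_M by (simp add: carrier_M kind_iff) blast
  qed
  also have "card \<dots> = nat (N div n_odd_cliques) * nat (K div 2)"
    using card_residue_class[OF pos(3) dvds(5), of c] N_pos
    by (simp only: card_cartesian_product card_parity)
  also have "N div n_odd_cliques = move_ord * (fix_ord div n_odd_cliques)"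
  proof -
    have "N div n_odd_cliques = move_ord * fix_ord div n_odd_cliques"
      using N_eq by (metis mult.commute)
    then show ?thesis using dvds(3) by (simp add: div_mult_swap)
  qed
  also have "N div fix_ord = move_ord" by (simp add: move_ord_def)
  finally have "nat move_ord * clique_size (ccc_graph M) class_kind c =
      nat move_ord * nat (fix_ord div n_odd_cliques * (K div 2))"
    using pos K_pos by (simp add: nat_mult_distrib pos_imp_zdiv_nonneg_iff)
  then show ?thesis using pos by simp
qed

lemma class_kind_image: "class_kind ` pverts (ccc_graph M) = insert (- 1) {0..<n_odd_cliques}"
proof -
  let ?S = "carrier M - grp_center M"
  have "class_kind ` pverts (ccc_graph M) = kind ` ?S"
    by (auto simp: pverts_ccc_graph image_image class_kind intro!: image_eqI)
  also have "\<dots> = insert (- 1) {0..<n_odd_cliques}"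
  proof
    show "kind ` ?S \<subseteq> insert (- 1) {0..<n_odd_cliques}"
      using pos(3) by (auto simp: kind_def split: if_splits)
    have "(1, 0) \<in> ?S" using nonabelian N_pos K_pos move_ord_gt_1
      by (auto simp: carrier_M center_M intro: le_neq_trans)
    moreover have "kind (1, 0) = - 1" by (simp add: kind_def)
    moreover have "c \<in> kind ` ?S" if "c \<in> {0..<n_odd_cliques}" for c
    proof -
      have "n_odd_cliques \<le> N" using dvds(5) N_pos by (simp add: zdvd_imp_le)
      then have "(c, 1) \<in> ?S" using that K_ge_2 by (simp add: carrier_M center_M)
      moreover have "kind (c, 1) = c" using that by (simp add: kind_def)
      ultimately show ?thesis by (metis image_eqI)
    qed
    ultimately show "insert (- 1) {0..<n_odd_cliques} \<subseteq> kind ` ?S" by (metis image_eqI insert_subset subsetI)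
  qed
  finally show ?thesis .
qed

theorem clique_type_M:
  assumes "2 * int a = (N - fix_ord) * (K div 2)" and "int e = n_odd_cliques"
    and "int b = fix_ord div n_odd_cliques * (K div 2)"
  shows "clique_type (ccc_graph M) a e b"
proof -
  have "fix_ord \<le> N" using dvds(1) N_pos by (simp add: zdvd_imp_le)
  then have "2 * clique_size (ccc_graph M) class_kind (- 1) = nat ((N - fix_ord) * (K div 2))"
    unfolding clique_size_even using K_pos by (simp add: nat_mult_distrib)
  then have "clique_size (ccc_graph M) class_kind (- 1) = a" unfolding assms(1)[symmetric] by simp
  then show ?thesis
    unfolding clique_type_def assms(2)
    using clique_union_M class_kind_image clique_size_odd assms(3) by (metis nat_int)
qed

end

text \<open>An isomorphism of groups induces an isomorphism of the graphs, along which the names of the cliques are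
pulled back.\<close>

lemma clique_type_iso:
  assumes G: "group G" and H: "group H" and iso: "h \<in> iso G H"
    and type: "clique_type (ccc_graph H) a e b"
  shows "clique_type (ccc_graph G) a e b"
proof -
  interpret G: group G by fact
  interpret H: group H by fact
  have bij: "bij_betw h (carrier G) (carrier H)" and hom: "h \<in> hom G H"
    using iso by (auto simp: iso_def)
  interpret h: group_hom G H h using hom by unfold_locales
  have inj: "h x = h y \<longleftrightarrow> x = y" if "x \<in> carrier G" "y \<in> carrier G" for x y
    using bij that by (auto simp: bij_betw_def inj_on_eq_iff)
  have surj: "h ` carrier G = carrier H" using bij by (simp add: bij_betw_def)
  have comm: "h x \<otimes>\<^bsub>H\<^esub> h y = h y \<otimes>\<^bsub>H\<^esub> h x \<longleftrightarrow> x \<otimes>\<^bsub>G\<^esub> y = y \<otimes>\<^bsub>G\<^esub> x"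
    if "x \<in> carrier G" "y \<in> carrier G" for x y
    using inj[of "x \<otimes>\<^bsub>G\<^esub> y" "y \<otimes>\<^bsub>G\<^esub> x"] that by simp
  have center: "h x \<in> grp_center H \<longleftrightarrow> x \<in> grp_center G" if "x \<in> carrier G" for x
    using that comm surj[symmetric] by (auto simp: grp_center_def)
  have conj: "h ` conj_class G x = conj_class H (h x)" if "x \<in> carrier G" for x
  proof
    show "h ` conj_class G x \<subseteq> conj_class H (h x)"
      using that by (fastforce simp: conj_class_def)
    show "conj_class H (h x) \<subseteq> h ` conj_class G x"
    proof
      fix z assume "z \<in> conj_class H (h x)"
      then obtain g' where g': "g' \<in> carrier H" "z = g' \<otimes>\<^bsub>H\<^esub> h x \<otimes>\<^bsub>H\<^esub> inv\<^bsub>H\<^esub> g'"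
        by (auto simp: conj_class_def)
      then obtain g where "g \<in> carrier G" "g' = h g" using surj by blast
      with g'(2) have "g \<in> carrier G" "z = h g \<otimes>\<^bsub>H\<^esub> h x \<otimes>\<^bsub>H\<^esub> inv\<^bsub>H\<^esub> h g" by simp_all
      then have "z = h (g \<otimes>\<^bsub>G\<^esub> x \<otimes>\<^bsub>G\<^esub> inv\<^bsub>G\<^esub> g)" using that by simp
      then show "z \<in> h ` conj_class G x" using \<open>g \<in> carrier G\<close> by (auto simp: conj_class_def)
    qed
  qed
  have class_sub: "A \<subseteq> carrier G" if "A \<in> pverts (ccc_graph G)" for A
    using that by (auto simp: pverts_ccc_graph conj_class_def)
  have "(`) h ` pverts (ccc_graph G) = pverts (ccc_graph H)"
  proof -
    have "(`) h ` pverts (ccc_graph G) = (\<lambda>x. conj_class H (h x)) ` (carrier G - grp_center G)"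
      by (auto simp: pverts_ccc_graph image_image conj intro!: image_eqI)
    also have "\<dots> = conj_class H ` h ` (carrier G - grp_center G)" by (simp add: image_image)
    also have "h ` (carrier G - grp_center G) = carrier H - grp_center H"
      unfolding surj[symmetric] using center by auto
    finally show ?thesis by (simp add: pverts_ccc_graph)
  qed
  moreover have "inj_on ((`) h) (pverts (ccc_graph G))"
    using inj_on_image_Pow[of h "carrier G"] bij class_sub
    by (auto simp: bij_betw_def intro: inj_on_subset)
  ultimately have F: "bij_betw ((`) h) (pverts (ccc_graph G)) (pverts (ccc_graph H))"
    by (simp add: bij_betw_def)
  have arcs: "(h ` A, h ` B) \<in> parcs (ccc_graph H) \<longleftrightarrow> (A, B) \<in> parcs (ccc_graph G)"
    if AB: "A \<in> pverts (ccc_graph G)" "B \<in> pverts (ccc_graph G)" for A B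
  proof -
    have "h ` A \<in> pverts (ccc_graph H)" "h ` B \<in> pverts (ccc_graph H)"
      using AB F by (auto simp: bij_betw_def)
    moreover have "h ` A = h ` B \<longleftrightarrow> A = B" using AB F by (auto simp: bij_betw_def inj_on_eq_iff)
    moreover have "(\<exists>x\<in>h ` A. \<exists>y\<in>h ` B. x \<otimes>\<^bsub>H\<^esub> y = y \<otimes>\<^bsub>H\<^esub> x) \<longleftrightarrow>
        (\<exists>x\<in>A. \<exists>y\<in>B. x \<otimes>\<^bsub>G\<^esub> y = y \<otimes>\<^bsub>G\<^esub> x)"
      using comm class_sub[OF AB(1)] class_sub[OF AB(2)] by blast
    ultimately show ?thesis using AB by (simp add: parcs_ccc_graph)
  qed
  obtain f :: "_ \<Rightarrow> int" where f: "clique_union (ccc_graph H) f"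
    "f ` pverts (ccc_graph H) = insert (- 1) {0..<int e}" "clique_size (ccc_graph H) f (- 1) = a"
    "\<forall>c\<in>{0..<int e}. clique_size (ccc_graph H) f c = b"
    using type unfolding clique_type_def by blast
  define f' where "f' = (\<lambda>A. f (h ` A))"
  have size: "clique_size (ccc_graph G) f' c = clique_size (ccc_graph H) f c" for c
  proof -
    have "bij_betw ((`) h) {A \<in> pverts (ccc_graph G). f' A = c} {A \<in> pverts (ccc_graph H). f A = c}"
    proof (rule bij_betw_subset[OF F])
      show "(`) h ` {A \<in> pverts (ccc_graph G). f' A = c} = {A \<in> pverts (ccc_graph H). f A = c}"
        unfolding bij_betw_imp_surj_on[OF F, symmetric] f'_def by blast
    qed auto
    then show ?thesis unfolding clique_size_def by (rule bij_betw_same_card)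
  qed
  have "clique_union (ccc_graph G) f'"
  proof -
    have fin: "finite (pverts (ccc_graph G))"
      using f(1) bij_betw_finite[OF F] by (simp add: clique_union_def)
    have "(A, B) \<in> parcs (ccc_graph G) \<longleftrightarrow>
        A \<in> pverts (ccc_graph G) \<and> B \<in> pverts (ccc_graph G) \<and> A \<noteq> B \<and> f' A = f' B" for A B
    proof (cases "A \<in> pverts (ccc_graph G) \<and> B \<in> pverts (ccc_graph G)")
      case True
      then have verts: "h ` A \<in> pverts (ccc_graph H)" "h ` B \<in> pverts (ccc_graph H)"
        and neq: "h ` A \<noteq> h ` B \<longleftrightarrow> A \<noteq> B"
        using F by (auto simp: bij_betw_def inj_on_eq_iff)
      have "(A, B) \<in> parcs (ccc_graph G) \<longleftrightarrow> (h ` A, h ` B) \<in> parcs (ccc_graph H)"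
        using True arcs by blast
      also have "\<dots> \<longleftrightarrow> h ` A \<noteq> h ` B \<and> f' A = f' B"
        using f(1) verts by (simp add: clique_union_def f'_def)
      also have "\<dots> \<longleftrightarrow> A \<noteq> B \<and> f' A = f' B" by (simp only: neq)
      finally show ?thesis using True by simp
    next
      case False
      then show ?thesis by (auto simp: parcs_ccc_graph)
    qed
    with fin show ?thesis unfolding clique_union_def by auto
  qed
  moreover have "f' ` pverts (ccc_graph G) = insert (- 1) {0..<int e}"
    using F f(2) unfolding f'_def bij_betw_def by (metis image_image)
  ultimately show ?thesis using size f(3,4) unfolding clique_type_def by auto
qed

lemma clique_type_energies:
  assumes type: "clique_type \<Gamma> a e b"
  shows "LE_CN \<Gamma> = cliques_LE a e b" "LE_CN_plus \<Gamma> = cliques_LE_plus a e b" "energy_bound \<Gamma> = cliques_bound a e b"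
proof -
  obtain f :: "'a \<Rightarrow> int" where f: "clique_union \<Gamma> f"
    "f ` pverts \<Gamma> = insert (- 1) {0..<int e}" "clique_size \<Gamma> f (- 1) = a"
    "\<forall>c\<in>{0..<int e}. clique_size \<Gamma> f c = b"
    using type unfolding clique_type_def by blast
  have sum: "(\<Sum>c\<in>f ` pverts \<Gamma>. F (clique_size \<Gamma> f c)) = F a + real e * F b" for F :: "nat \<Rightarrow> real"
    unfolding f(2) using f(3,4) by (simp add: sum.insert)
  have "finite (pverts \<Gamma>)" using f(1) by (simp add: clique_union_def)
  then have "real (graph_order \<Gamma>) = (\<Sum>c\<in>f ` pverts \<Gamma>. real (clique_size \<Gamma> f c))"
    using sum.image_gen[of "pverts \<Gamma>" "\<lambda>_. 1 :: real" f]
    by (simp add: graph_order_def clique_size_def)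
  then have N: "real (graph_order \<Gamma>) = real a + real e * real b" by (simp only: sum)
  have D: "CN_Delta \<Gamma> = cliques_Delta a e b"
    unfolding clique_union_CN_Delta[OF f(1)] cliques_Delta_def N
    by (simp only: sum[of "\<lambda>k. real k * (real k - 1) * (real k - 2)"])
  show "LE_CN \<Gamma> = cliques_LE a e b"
    unfolding clique_union_LE_CN[OF f(1)] cliques_LE_def D Let_def
    by (simp only: sum[of "\<lambda>k. \<bar>cliques_Delta a e b\<bar> + (real k - 1) * \<bar>real k * (real k - 2) - cliques_Delta a e b\<bar>"])
  show "LE_CN_plus \<Gamma> = cliques_LE_plus a e b"
    unfolding clique_union_LE_CN_plus[OF f(1)] cliques_LE_plus_def D Let_def
    by (simp only: sum[of "\<lambda>k. \<bar>2 * (real k - 1) * (real k - 2) - cliques_Delta a e b\<bar> +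
        (real k - 1) * \<bar>(real k - 2)\<^sup>2 - cliques_Delta a e b\<bar>"])
  show "energy_bound \<Gamma> = cliques_bound a e b"
    unfolding energy_bound_def cliques_bound_def N by simp
qed

section \<open>The families one by one\<close>

lemma (in metacyclic) comm_group_M:
  assumes "N dvd 1 - s"
  shows "comm_group M"
proof (rule M.group_comm_groupI)
  fix x y :: "int \<times> int"
  obtain i k j l where xy: "x = (i, k)" "y = (j, l)" by (metis surj_pair)
  have act: "N dvd 1 - act l" for l using assms by (simp add: act_def)
  have "(i + act k * j) - (j + act l * i) = (1 - act l) * i - (1 - act k) * j"
    by (simp add: algebra_simps)
  also have "N dvd \<dots>" by (rule dvd_diff[OF dvd_mult2[OF act] dvd_mult2[OF act]])
  finally show "x \<otimes>\<^bsub>M\<^esub> y = y \<otimes>\<^bsub>M\<^esub> x"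
    by (simp add: xy mult_M add.commute[of l k] mod_eq_dvd_iff)
qed

text \<open>For \<open>s = -1\<close> the element \<open>d\<close> inverts \<open>c\<close>. If \<open>N\<close> is odd, only the identity of \<open>\<langle>c\<rangle>\<close> is fixed.\<close>

lemma inverting_clique_type_odd:
  fixes r h :: nat and t :: int
  assumes met: "metacyclic (int (2 * r + 1)) (int (2 * h)) (- 1) t" and r: "1 \<le> r"
  shows "clique_type (ccc_graph (metacyclic.M (int (2 * r + 1)) (int (2 * h)) (- 1) t)) (r * h) 1 h"
proof -
  interpret metacyclic "int (2 * r + 1)" "int (2 * h)" "- 1" t by fact
  interpret nonabelian_metacyclic "int (2 * r + 1)" "int (2 * h)" "- 1" t
    by unfold_locales (use r in \<open>auto dest: zdvd_imp_le\<close>)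
  have "coprime 2 (int (2 * r + 1))" unfolding coprime_left_2_iff_odd by simp
  then have fix1: "fix_ord = 1" unfolding fix_ord_def by (simp add: coprime_iff_gcd_eq_1)
  have odd1: "n_odd_cliques = 1" unfolding n_odd_cliques_def fix1 by simp
  show ?thesis
    by (rule clique_type_M, unfold fix1 odd1) simp_all
qed

text \<open>If \<open>N = 2 p\<close>, the elements \<open>1\<close> and \<open>c\<^sup>p\<close> of \<open>\<langle>c\<rangle>\<close> are fixed, and the parity of \<open>p\<close> decides
between one and two cliques of odd type.\<close>

lemma inverting_clique_type_even:
  fixes p h :: nat and t :: int
  assumes met: "metacyclic (int (2 * p)) (int (2 * h)) (- 1) t" and p: "2 \<le> p"
  shows "odd p \<Longrightarrow>
      clique_type (ccc_graph (metacyclic.M (int (2 * p)) (int (2 * h)) (- 1) t)) ((p - 1) * h) 1 (2 * h)"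
    and "even p \<Longrightarrow>
      clique_type (ccc_graph (metacyclic.M (int (2 * p)) (int (2 * h)) (- 1) t)) ((p - 1) * h) 2 h"
proof -
  interpret metacyclic "int (2 * p)" "int (2 * h)" "- 1" t by fact
  interpret nonabelian_metacyclic "int (2 * p)" "int (2 * h)" "- 1" t
    by unfold_locales (use p in \<open>auto dest: zdvd_imp_le\<close>)
  have fix2: "fix_ord = 2" unfolding fix_ord_def by (simp add: gcd_proj1_iff)
  have move: "move_ord = int p" unfolding move_ord_def fix2 by simp
  have a: "2 * int ((p - 1) * h) = (int (2 * p) - fix_ord) * (int (2 * h) div 2)"
    unfolding fix2 using p by (simp add: of_nat_diff algebra_simps)
  {
    assume "odd p"
    then have odd1: "n_odd_cliques = 1"
      unfolding n_odd_cliques_def fix2 move by (simp add: coprime_iff_gcd_eq_1[symmetric])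
    then show "clique_type (ccc_graph M) ((p - 1) * h) 1 (2 * h)"
      by (intro clique_type_M a, unfold fix2 odd1) simp_all
  }
  {
    assume "even p"
    then have odd2: "n_odd_cliques = 2"
      unfolding n_odd_cliques_def fix2 move by (simp add: gcd_proj1_iff)
    then show "clique_type (ccc_graph M) ((p - 1) * h) 2 h"
      by (intro clique_type_M a, unfold fix2 odd2) simp_all
  }
qed

text \<open>For \<open>SD\<close> the fixed elements are counted by \<open>gcd (2 - 2 n, 4 n)\<close>. This is \<open>2\<close> for even \<open>n\<close> and \<open>4\<close> for odd \<open>n\<close>,
which accounts for the two shapes of the graph.\<close>

lemma semidihedral_clique_type_even:
  fixes p :: nat
  assumes met: "metacyclic (int (4 * (2 * p))) 2 (int (2 * (2 * p) - 1)) 0" and p: "1 \<le> p"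
  shows "clique_type (ccc_graph (metacyclic.M (int (4 * (2 * p))) 2 (int (2 * (2 * p) - 1)) 0)) (4 * p - 1) 2 1"
proof -
  interpret metacyclic "int (4 * (2 * p))" 2 "int (2 * (2 * p) - 1)" 0 by fact
  have s: "1 - int (2 * (2 * p) - 1) = 2 * (1 - 2 * int p)" using p by (simp add: of_nat_diff)
  have cop: "coprime (1 - 2 * int p) (4 * int p)"
  proof (rule coprimeI)
    fix c assume c: "c dvd 1 - 2 * int p" "c dvd 4 * int p"
    \<comment> \<open>This combination is \<open>1\<close>.\<close>
    have "c dvd (1 + 2 * int p) * (1 - 2 * int p) + int p * (4 * int p)"
      using c by (intro dvd_add dvd_mult[of c "1 - 2 * int p"] dvd_mult[of c "4 * int p"])
    then show "is_unit c" by (simp add: algebra_simps)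
  qed
  have "gcd (1 - int (2 * (2 * p) - 1)) (int (4 * (2 * p))) = gcd (2 * (1 - 2 * int p)) (2 * (4 * int p))"
    unfolding s by simp
  also have "\<dots> = 2" unfolding gcd_mult_left using cop by simp
  finally have g: "gcd (1 - int (2 * (2 * p) - 1)) (int (4 * (2 * p))) = 2" .
  interpret nonabelian_metacyclic "int (4 * (2 * p))" 2 "int (2 * (2 * p) - 1)" 0
  proof unfold_locales
    show "\<not> int (4 * (2 * p)) dvd 1 - int (2 * (2 * p) - 1)"
    proof
      assume "int (4 * (2 * p)) dvd 1 - int (2 * (2 * p) - 1)"
      then have "gcd (1 - int (2 * (2 * p) - 1)) (int (4 * (2 * p))) = int (4 * (2 * p))"
        by (simp add: gcd_proj2_iff)
      then show False using p unfolding g by simp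
    qed
  qed
  have fix2: "fix_ord = 2" unfolding fix_ord_def by (rule g)
  have odd2: "n_odd_cliques = 2"
    unfolding n_odd_cliques_def move_ord_def fix2 by (simp add: gcd_proj1_iff)
  show ?thesis
    by (rule clique_type_M, unfold fix2 odd2) (use p in \<open>simp_all add: of_nat_diff\<close>)
qed

lemma semidihedral_clique_type_odd:
  fixes p :: nat
  assumes met: "metacyclic (int (4 * (2 * p + 1))) 2 (int (2 * (2 * p + 1) - 1)) 0" and p: "1 \<le> p"
  shows "clique_type (ccc_graph (metacyclic.M (int (4 * (2 * p + 1))) 2 (int (2 * (2 * p + 1) - 1)) 0)) (p * 4) 1 4"
proof -
  interpret metacyclic "int (4 * (2 * p + 1))" 2 "int (2 * (2 * p + 1) - 1)" 0 by fact
  have s: "1 - int (2 * (2 * p + 1) - 1) = 4 * (- int p)" by simp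
  have cop: "coprime (- int p) (2 * int p + 1)"
  proof (rule coprimeI)
    fix c assume c: "c dvd - int p" "c dvd 2 * int p + 1"
    \<comment> \<open>This combination is \<open>1\<close>.\<close>
    have "c dvd 2 * (- int p) + (2 * int p + 1)" by (rule dvd_add[OF dvd_mult[OF c(1)] c(2)])
    then show "is_unit c" by simp
  qed
  have "gcd (1 - int (2 * (2 * p + 1) - 1)) (int (4 * (2 * p + 1))) = gcd (4 * (- int p)) (4 * (2 * int p + 1))"
    unfolding s by (simp add: algebra_simps)
  also have "\<dots> = 4" unfolding gcd_mult_left using cop by simp
  finally have g: "gcd (1 - int (2 * (2 * p + 1) - 1)) (int (4 * (2 * p + 1))) = 4" .
  interpret nonabelian_metacyclic "int (4 * (2 * p + 1))" 2 "int (2 * (2 * p + 1) - 1)" 0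
  proof unfold_locales
    show "\<not> int (4 * (2 * p + 1)) dvd 1 - int (2 * (2 * p + 1) - 1)"
    proof
      assume "int (4 * (2 * p + 1)) dvd 1 - int (2 * (2 * p + 1) - 1)"
      then have "gcd (1 - int (2 * (2 * p + 1) - 1)) (int (4 * (2 * p + 1))) = int (4 * (2 * p + 1))"
        by (simp add: gcd_proj2_iff)
      then show False using p unfolding g by simp
    qed
  qed
  have fix4: "fix_ord = 4" unfolding fix_ord_def by (rule g)
  have "move_ord = 2 * int p + 1" unfolding move_ord_def fix4 by simp
  moreover have "coprime 4 (2 * int p + 1)"
    using coprime_power_left_iff[of 2 2 "2 * int p + 1"] by simp
  ultimately have odd1: "n_odd_cliques = 1" unfolding n_odd_cliques_def fix4 by simp
  show ?thesis
    by (rule clique_type_M, unfold fix4 odd1) simp_all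
qed

lemma clique_type_of_presentation:
  assumes "group G" "G \<cong> P" "P \<cong> metacyclic.M N K s t" "metacyclic N K s t"
    and "clique_type (ccc_graph (metacyclic.M N K s t)) a e b"
  shows "clique_type (ccc_graph G) a e b"
proof -
  obtain h where "h \<in> iso G (metacyclic.M N K s t)"
    using iso_trans[OF assms(2,3)] unfolding is_iso_def by blast
  then show ?thesis
    using clique_type_iso[OF assms(1) metacyclic.group_M[OF assms(4)]] assms(5) by blast
qed

lemma clique_type_verdicts:
  assumes "clique_type \<Gamma> a e b"
  shows "CNL_hyperenergetic \<Gamma> \<longleftrightarrow> cliques_LE a e b > cliques_bound a e b"
    "CNL_borderenergetic \<Gamma> \<longleftrightarrow> cliques_LE a e b = cliques_bound a e b"
    "CNSL_hyperenergetic \<Gamma> \<longleftrightarrow> cliques_LE_plus a e b > cliques_bound a e b"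
    "CNSL_borderenergetic \<Gamma> \<longleftrightarrow> cliques_LE_plus a e b = cliques_bound a e b"
  by (simp_all add: CNL_hyperenergetic_def CNL_borderenergetic_def CNSL_hyperenergetic_def
      CNSL_borderenergetic_def clique_type_energies[OF assms])

text \<open>This covers \<open>D\<^sub>2\<^sub>n\<close> and \<open>SD\<^sub>8\<^sub>n\<close> with \<open>n\<close> even, and \<open>T\<^sub>4\<^sub>n\<close>.\<close>

lemma one_clique_and_two_vertices_verdicts:
  assumes "clique_type \<Gamma> a e b" "1 \<le> a" "e = 1 \<and> b = 2 \<or> e = 2 \<and> b = 1"
  shows "CNL_hyperenergetic \<Gamma> \<longleftrightarrow> 6 \<le> a" "\<not> CNL_borderenergetic \<Gamma>"
    "CNSL_hyperenergetic \<Gamma> \<longleftrightarrow> 9 \<le> a" "\<not> CNSL_borderenergetic \<Gamma>"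
proof -
  have eb: "real e = 1 \<and> real b = 2 \<or> real e = 2 \<and> real b = 1" using assms(3) by auto
  note E = one_clique_and_two_vertices[OF assms(2) eb]
  have "6 \<le> a \<or> a < 6" "9 \<le> a \<or> a < 9" by auto
  then show "CNL_hyperenergetic \<Gamma> \<longleftrightarrow> 6 \<le> a" "\<not> CNL_borderenergetic \<Gamma>"
    "CNSL_hyperenergetic \<Gamma> \<longleftrightarrow> 9 \<le> a" "\<not> CNSL_borderenergetic \<Gamma>"
    unfolding clique_type_verdicts[OF assms(1)] using E by force+
qed

lemma dihedral_verdicts:
  assumes G: "group G" "G \<cong> grp_D n" and n: "3 \<le> n"
  shows "CNL_hyperenergetic (ccc_graph G) \<longleftrightarrow> 13 \<le> n"
    "CNL_borderenergetic (ccc_graph G) \<longleftrightarrow> n = 3 \<or> n = 11"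
    "CNSL_hyperenergetic (ccc_graph G) \<longleftrightarrow> even n \<and> 20 \<le> n"
    "CNSL_borderenergetic (ccc_graph G) \<longleftrightarrow> n = 3"
proof -
  have "1 \<le> n" using n by simp
  note type = clique_type_of_presentation[OF G grp_D_iso(2,1)[OF this]]
  have "(CNL_hyperenergetic (ccc_graph G) \<longleftrightarrow> 13 \<le> n) \<and>
    (CNL_borderenergetic (ccc_graph G) \<longleftrightarrow> n = 3 \<or> n = 11) \<and>
    (CNSL_hyperenergetic (ccc_graph G) \<longleftrightarrow> even n \<and> 20 \<le> n) \<and>
    (CNSL_borderenergetic (ccc_graph G) \<longleftrightarrow> n = 3)"
  proof (cases "even n")
    case True
    then obtain p where p: "n = 2 * p" "2 \<le> p" using n by (auto elim!: evenE)
    have met: "metacyclic (int (2 * p)) (int (2 * 1)) (- 1) 0"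
      using grp_D_iso(1)[OF \<open>1 \<le> n\<close>] p by simp
    have "\<exists>e b. clique_type (ccc_graph G) (p - 1) e b \<and> (e = 1 \<and> b = 2 \<or> e = 2 \<and> b = 1)"
      using type inverting_clique_type_even[OF met p(2)] p(1) by (cases "even p") force+
    then obtain e b where "clique_type (ccc_graph G) (p - 1) e b" "e = 1 \<and> b = 2 \<or> e = 2 \<and> b = 1"
      by blast
    note V = one_clique_and_two_vertices_verdicts[OF this(1) _ this(2)]
    have "1 \<le> p - 1" "6 \<le> p - 1 \<longleftrightarrow> 13 \<le> n" "9 \<le> p - 1 \<longleftrightarrow> 20 \<le> n" "n \<noteq> 3" "n \<noteq> 11"
      using p by presburger+
    with V True show ?thesis by simp
  next
    case False
    then obtain r where r: "n = 2 * r + 1" "1 \<le> r" using n by (auto elim!: oddE)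
    have met: "metacyclic (int (2 * r + 1)) (int (2 * 1)) (- 1) 0"
      using grp_D_iso(1)[OF \<open>1 \<le> n\<close>] r by simp
    have "clique_type (ccc_graph G) r 1 1"
      using type inverting_clique_type_odd[OF met r(2)] r(1) by force
    from clique_type_verdicts[OF this] one_clique_and_point[OF r(2)] r show ?thesis by auto
  qed
  then show "CNL_hyperenergetic (ccc_graph G) \<longleftrightarrow> 13 \<le> n"
    "CNL_borderenergetic (ccc_graph G) \<longleftrightarrow> n = 3 \<or> n = 11"
    "CNSL_hyperenergetic (ccc_graph G) \<longleftrightarrow> even n \<and> 20 \<le> n"
    "CNSL_borderenergetic (ccc_graph G) \<longleftrightarrow> n = 3" by blast+
qed

lemma dicyclic_verdicts:
  assumes G: "group G" "G \<cong> grp_T n" and n: "2 \<le> n"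
  shows "CNL_hyperenergetic (ccc_graph G) \<longleftrightarrow> 7 \<le> n" "\<not> CNL_borderenergetic (ccc_graph G)"
    "CNSL_hyperenergetic (ccc_graph G) \<longleftrightarrow> 10 \<le> n" "\<not> CNSL_borderenergetic (ccc_graph G)"
proof -
  have "1 \<le> n" using n by simp
  note type = clique_type_of_presentation[OF G grp_T_iso(2,1)[OF this]]
  have met: "metacyclic (int (2 * n)) (int (2 * 1)) (- 1) (int n)"
    using grp_T_iso(1)[OF \<open>1 \<le> n\<close>] by simp
  have "\<exists>e b. clique_type (ccc_graph G) (n - 1) e b \<and> (e = 1 \<and> b = 2 \<or> e = 2 \<and> b = 1)"
    using type inverting_clique_type_even[OF met n] by (cases "even n") force+
  then obtain e b where "clique_type (ccc_graph G) (n - 1) e b" "e = 1 \<and> b = 2 \<or> e = 2 \<and> b = 1"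
    by blast
  from one_clique_and_two_vertices_verdicts[OF this(1) _ this(2)] n
  show "CNL_hyperenergetic (ccc_graph G) \<longleftrightarrow> 7 \<le> n" "\<not> CNL_borderenergetic (ccc_graph G)"
    "CNSL_hyperenergetic (ccc_graph G) \<longleftrightarrow> 10 \<le> n" "\<not> CNSL_borderenergetic (ccc_graph G)"
    by auto
qed

text \<open>This covers \<open>U\<close> with index \<open>(n, m)\<close> unless \<open>4\<close> divides \<open>m\<close>, as well as \<open>SD\<^sub>8\<^sub>n\<close> with \<open>n\<close> odd.\<close>

lemma two_cliques_with_ratio_verdicts:
  assumes "clique_type \<Gamma> (r * b) 1 b" "1 \<le> r" "2 \<le> b"
  shows "CNL_hyperenergetic \<Gamma> \<longleftrightarrow> 3 \<le> r \<or> r = 2 \<and> 4 \<le> b" "\<not> CNL_borderenergetic \<Gamma>"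
    "CNSL_hyperenergetic \<Gamma> \<longleftrightarrow> \<not> (r = 1 \<or> r = 2 \<and> b \<le> 4 \<or> r \<in> {3, 4} \<and> b = 2)"
    "\<not> CNSL_borderenergetic \<Gamma>"
  unfolding clique_type_verdicts[OF assms(1)] of_nat_1
  using two_cliques_with_ratio[OF assms(2,3)] by (metis less_irrefl less_asym)+

text \<open>This covers \<open>U\<close> with index \<open>(n, m)\<close> if \<open>4\<close> divides \<open>m\<close>; then \<open>k = m / 2 - 1\<close> is odd.\<close>

lemma three_cliques_with_ratio_verdicts:
  assumes "clique_type \<Gamma> (k * b) 2 b" "odd k" "2 \<le> b"
  shows "CNL_hyperenergetic \<Gamma> \<longleftrightarrow> 5 \<le> k \<or> k = 3 \<and> 3 \<le> b" "\<not> CNL_borderenergetic \<Gamma>"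
    "CNSL_hyperenergetic \<Gamma> \<longleftrightarrow> 5 \<le> k \<or> k = 3 \<and> 3 \<le> b" "\<not> CNSL_borderenergetic \<Gamma>"
  unfolding clique_type_verdicts[OF assms(1)] of_nat_numeral
  using three_cliques_with_ratio[OF assms(2,3)] by (metis less_irrefl less_asym)+

lemma semidihedral_verdicts:
  assumes G: "group G" "G \<cong> grp_SD n" and n: "2 \<le> n"
  shows "CNL_hyperenergetic (ccc_graph G) \<longleftrightarrow> 4 \<le> n" "\<not> CNL_borderenergetic (ccc_graph G)"
    "CNSL_hyperenergetic (ccc_graph G) \<longleftrightarrow> 6 \<le> n" "\<not> CNSL_borderenergetic (ccc_graph G)"
proof -
  have "1 \<le> n" using n by simp
  note met = grp_SD_iso(1)[OF this] and type = clique_type_of_presentation[OF G grp_SD_iso(2,1)[OF this]]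
  have "(CNL_hyperenergetic (ccc_graph G) \<longleftrightarrow> 4 \<le> n) \<and> \<not> CNL_borderenergetic (ccc_graph G) \<and>
    (CNSL_hyperenergetic (ccc_graph G) \<longleftrightarrow> 6 \<le> n) \<and> \<not> CNSL_borderenergetic (ccc_graph G)"
  proof (cases "even n")
    case True
    then obtain p where p: "n = 2 * p" "1 \<le> p" using n by (auto elim!: evenE)
    have "clique_type (ccc_graph G) (4 * p - 1) 2 1"
      using type semidihedral_clique_type_even[OF met[unfolded p(1)] p(2)] unfolding p(1) by blast
    from one_clique_and_two_vertices_verdicts[OF this] p show ?thesis by auto
  next
    case False
    then obtain p where p: "n = 2 * p + 1" "1 \<le> p" using n by (auto elim!: oddE)
    have "clique_type (ccc_graph G) (p * 4) 1 4"
      using type semidihedral_clique_type_odd[OF met[unfolded p(1)] p(2)] unfolding p(1) by blast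
    from two_cliques_with_ratio_verdicts[OF this p(2)] p show ?thesis by auto
  qed
  then show "CNL_hyperenergetic (ccc_graph G) \<longleftrightarrow> 4 \<le> n" "\<not> CNL_borderenergetic (ccc_graph G)"
    "CNSL_hyperenergetic (ccc_graph G) \<longleftrightarrow> 6 \<le> n" "\<not> CNSL_borderenergetic (ccc_graph G)" by blast+
qed

lemma semidirect_verdicts:
  assumes G: "group G" "G \<cong> grp_U n m" and n: "2 \<le> n" and m: "3 \<le> m"
  shows "CNL_hyperenergetic (ccc_graph G) \<longleftrightarrow>
      \<not> (m = 3 \<or> (m = 5 \<and> n \<in> {2, 3}) \<or> m = 4 \<or> (m = 8 \<and> n = 2) \<or> m = 6)"
    "\<not> CNL_borderenergetic (ccc_graph G)"
    "CNSL_hyperenergetic (ccc_graph G) \<longleftrightarrow>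
      \<not> (m = 3 \<or> (m \<in> {5, 7, 9} \<and> n = 2) \<or> (m = 5 \<and> n \<in> {3, 4}) \<or> m = 4 \<or>
         (m = 8 \<and> n = 2) \<or> m = 6 \<or> (m = 10 \<and> n = 2))"
    "\<not> CNSL_borderenergetic (ccc_graph G)"
proof -
  have nm: "1 \<le> n" "1 \<le> m" using n m by auto
  note met = grp_U_iso(1)[OF nm] and type = clique_type_of_presentation[OF G grp_U_iso(2,1)[OF nm]]
  have "(CNL_hyperenergetic (ccc_graph G) \<longleftrightarrow>
      \<not> (m = 3 \<or> (m = 5 \<and> n \<in> {2, 3}) \<or> m = 4 \<or> (m = 8 \<and> n = 2) \<or> m = 6)) \<and>
    \<not> CNL_borderenergetic (ccc_graph G) \<and>
    (CNSL_hyperenergetic (ccc_graph G) \<longleftrightarrow>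
      \<not> (m = 3 \<or> (m \<in> {5, 7, 9} \<and> n = 2) \<or> (m = 5 \<and> n \<in> {3, 4}) \<or> m = 4 \<or>
         (m = 8 \<and> n = 2) \<or> m = 6 \<or> (m = 10 \<and> n = 2))) \<and>
    \<not> CNSL_borderenergetic (ccc_graph G)" (is ?verdict)
  proof (cases "even m")
    case False
    then obtain r where r: "m = 2 * r + 1" "1 \<le> r" using m by (auto elim!: oddE)
    have "clique_type (ccc_graph G) (r * n) 1 n"
      using type inverting_clique_type_odd[OF met[unfolded r(1)] r(2)] unfolding r(1) by blast
    note V = two_cliques_with_ratio_verdicts[OF this r(2) n]
    have arith: "(3 \<le> r \<or> r = 2 \<and> 4 \<le> n) \<longleftrightarrow>
        \<not> (m = 3 \<or> (m = 5 \<and> n \<in> {2, 3}) \<or> m = 4 \<or> (m = 8 \<and> n = 2) \<or> m = 6)"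
      "\<not> (r = 1 \<or> r = 2 \<and> n \<le> 4 \<or> r \<in> {3, 4} \<and> n = 2) \<longleftrightarrow>
        \<not> (m = 3 \<or> (m \<in> {5, 7, 9} \<and> n = 2) \<or> (m = 5 \<and> n \<in> {3, 4}) \<or> m = 4 \<or>
          (m = 8 \<and> n = 2) \<or> m = 6 \<or> (m = 10 \<and> n = 2))"
      using n r unfolding insert_iff empty_iff by presburger+
    show ?thesis unfolding V(1,3) by (intro conjI arith V(2,4))
  next
    case True
    then obtain p where p: "m = 2 * p" "2 \<le> p" using m by (auto elim!: evenE)
    show ?thesis
    proof (cases "even p")
      case False
      then obtain r where r: "p = 2 * r + 1" "1 \<le> r" using p by (auto elim!: oddE)
      have "clique_type (ccc_graph G) ((p - 1) * n) 1 (2 * n)"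
        using type inverting_clique_type_even(1)[OF met[unfolded p(1)] p(2) False] unfolding p(1) by blast
      \<comment> \<open>The other clique has \<open>2 n\<close> vertices, so the ratio is \<open>r\<close>, as for \<open>m = 2 r + 1\<close>.\<close>
      also have "(p - 1) * n = r * (2 * n)" using r by simp
      finally have type_r: "clique_type (ccc_graph G) (r * (2 * n)) 1 (2 * n)" .
      have "2 \<le> 2 * n" using n by simp
      note V = two_cliques_with_ratio_verdicts[OF type_r r(2) this]
      have arith: "(3 \<le> r \<or> r = 2 \<and> 4 \<le> 2 * n) \<longleftrightarrow>
          \<not> (m = 3 \<or> (m = 5 \<and> n \<in> {2, 3}) \<or> m = 4 \<or> (m = 8 \<and> n = 2) \<or> m = 6)"
        "\<not> (r = 1 \<or> r = 2 \<and> 2 * n \<le> 4 \<or> r \<in> {3, 4} \<and> 2 * n = 2) \<longleftrightarrow>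
          \<not> (m = 3 \<or> (m \<in> {5, 7, 9} \<and> n = 2) \<or> (m = 5 \<and> n \<in> {3, 4}) \<or> m = 4 \<or>
            (m = 8 \<and> n = 2) \<or> m = 6 \<or> (m = 10 \<and> n = 2))"
        using n r p unfolding insert_iff empty_iff by presburger+
      show ?thesis unfolding V(1,3) by (intro conjI arith V(2,4))
    next
      case True
      have type_p: "clique_type (ccc_graph G) ((p - 1) * n) 2 n"
        using type inverting_clique_type_even(2)[OF met[unfolded p(1)] p(2) True] unfolding p(1) by blast
      have "odd (p - 1)" using True p by simp
      note V = three_cliques_with_ratio_verdicts[OF type_p this n]
      obtain q where q: "p = 2 * q" "1 \<le> q" using True p by (auto elim!: evenE)
      have arith: "(5 \<le> p - 1 \<or> p - 1 = 3 \<and> 3 \<le> n) \<longleftrightarrow>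
          \<not> (m = 3 \<or> (m = 5 \<and> n \<in> {2, 3}) \<or> m = 4 \<or> (m = 8 \<and> n = 2) \<or> m = 6)"
        "(5 \<le> p - 1 \<or> p - 1 = 3 \<and> 3 \<le> n) \<longleftrightarrow>
          \<not> (m = 3 \<or> (m \<in> {5, 7, 9} \<and> n = 2) \<or> (m = 5 \<and> n \<in> {3, 4}) \<or> m = 4 \<or>
            (m = 8 \<and> n = 2) \<or> m = 6 \<or> (m = 10 \<and> n = 2))"
        using n q p unfolding insert_iff empty_iff by presburger+
      show ?thesis unfolding V(1,3) by (intro conjI arith V(2,4))
    qed
  qed
  then show "CNL_hyperenergetic (ccc_graph G) \<longleftrightarrow>
      \<not> (m = 3 \<or> (m = 5 \<and> n \<in> {2, 3}) \<or> m = 4 \<or> (m = 8 \<and> n = 2) \<or> m = 6)"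
    "\<not> CNL_borderenergetic (ccc_graph G)"
    "CNSL_hyperenergetic (ccc_graph G) \<longleftrightarrow>
      \<not> (m = 3 \<or> (m \<in> {5, 7, 9} \<and> n = 2) \<or> (m = 5 \<and> n \<in> {3, 4}) \<or> m = 4 \<or>
         (m = 8 \<and> n = 2) \<or> m = 6 \<or> (m = 10 \<and> n = 2))"
    "\<not> CNSL_borderenergetic (ccc_graph G)" by blast+
qed

text \<open>For \<open>m = 2\<close> inverting \<open>y\<close> does nothing, and the group is abelian.\<close>

lemma nonabelian_semidirect:
  assumes "group G" "\<not> comm_group G" "G \<cong> grp_U n m" "2 \<le> n" "2 \<le> m"
  shows "3 \<le> m"
proof (rule ccontr)
  assume "\<not> 3 \<le> m"
  then have m: "m = 2" using assms(5) by simp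
  interpret G: group G by fact
  have n: "1 \<le> n" "1 \<le> (2 :: nat)" using assms(4) by auto
  interpret metacyclic "int 2" "int (2 * n)" "- 1" 0 by (rule grp_U_iso(1)[OF n])
  have "comm_group M" by (rule comm_group_M) simp
  moreover have "M \<cong> G"
    using iso_trans[OF assms(3)[unfolded m] grp_U_iso(2)[OF n]] G.iso_sym by blast
  ultimately show False using comm_group.iso_imp_comm_group[OF _ _ G.monoid_axioms] assms(2) by blast
qed

text \<open>The cases of the list and the verdicts match family by family. The group \<open>U\<^sub>6\<^sub>n\<close> is \<open>U\<close> with index
\<open>(n, 3)\<close>, and no group \<open>U\<close> with index \<open>(n, 2)\<close> can occur because it would be abelian.\<close>

theorem corollary3p6:
  fixes G :: "('a, 'b) monoid_scheme"
  assumes "group G"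
    and "\<not> comm_group G"
    and "(\<exists>n\<ge>3. G \<cong> grp_D n) \<or> (\<exists>n\<ge>2. G \<cong> grp_T n) \<or> (\<exists>n\<ge>2. G \<cong> grp_U6 n) \<or>
         (\<exists>n\<ge>2. G \<cong> grp_SD n) \<or> (\<exists>n\<ge>2. \<exists>m\<ge>2. G \<cong> grp_U n m)"
  shows "(CNL_borderenergetic (ccc_graph G) \<longleftrightarrow>
           G \<cong> grp_D 3 \<or> G \<cong> grp_D 11 \<or> (\<exists>n\<ge>2. G \<cong> grp_U n 2)) \<and>
         (CNL_hyperenergetic (ccc_graph G) \<longleftrightarrow>
           (\<exists>n\<ge>13. G \<cong> grp_D n) \<or> (\<exists>n\<ge>7. G \<cong> grp_T n) \<or> (\<exists>n\<ge>4. G \<cong> grp_SD n) \<or>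
           (\<exists>n\<ge>2. \<exists>m\<ge>2. G \<cong> grp_U n m \<and>
              \<not> (m = 3 \<or> (m = 5 \<and> n \<in> {2, 3}) \<or> m = 4 \<or> (m = 8 \<and> n = 2) \<or> m = 6))) \<and>
         (CNSL_borderenergetic (ccc_graph G) \<longleftrightarrow>
           G \<cong> grp_D 3 \<or> (\<exists>n\<ge>2. G \<cong> grp_U n 2)) \<and>
         (CNSL_hyperenergetic (ccc_graph G) \<longleftrightarrow>
           (\<exists>n\<ge>20. even n \<and> G \<cong> grp_D n) \<or> (\<exists>n\<ge>10. G \<cong> grp_T n) \<or> (\<exists>n\<ge>6. G \<cong> grp_SD n) \<or>
           (\<exists>n\<ge>2. \<exists>m\<ge>2. G \<cong> grp_U n m \<and>
              \<not> (m = 3 \<or> (m \<in> {5, 7, 9} \<and> n = 2) \<or> (m = 5 \<and> n \<in> {3, 4}) \<or> m = 4 \<or>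
                 (m = 8 \<and> n = 2) \<or> m = 6 \<or> (m = 10 \<and> n = 2))))"
proof -
  note D = dihedral_verdicts[OF assms(1)] and T = dicyclic_verdicts[OF assms(1)]
    and SD = semidihedral_verdicts[OF assms(1)]
  have U3: "3 \<le> m" if "G \<cong> grp_U n m" "2 \<le> n" "2 \<le> m" for n m
    by (rule nonabelian_semidirect[OF assms(1,2) that])
  note U = semidirect_verdicts[OF assms(1) _ _ U3]
  have no_U2: "\<not> (\<exists>n\<ge>2. G \<cong> grp_U n 2)" using U3 by fastforce
  have "\<exists>n\<ge>2. \<exists>m\<ge>2. G \<cong> grp_U n m" if U6: "\<exists>n\<ge>2. G \<cong> grp_U6 n"
  proof -
    obtain n where "2 \<le> n" "G \<cong> grp_U6 n" using U6 by blast
    moreover have "grp_U6 n = grp_U n 3" by (simp add: grp_U6_def grp_U_def)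
    moreover have "2 \<le> (3 :: nat)" by simp
    ultimately show ?thesis by metis
  qed
  with assms(3) have "(\<exists>n\<ge>3. G \<cong> grp_D n) \<or> (\<exists>n\<ge>2. G \<cong> grp_T n) \<or>
      (\<exists>n\<ge>2. G \<cong> grp_SD n) \<or> (\<exists>n\<ge>2. \<exists>m\<ge>2. G \<cong> grp_U n m)" by argo
  then consider (D) n where "3 \<le> n" "G \<cong> grp_D n" | (T) n where "2 \<le> n" "G \<cong> grp_T n"
    | (SD) n where "2 \<le> n" "G \<cong> grp_SD n" | (U) n m where "2 \<le> n" "2 \<le> m" "G \<cong> grp_U n m"
    by blast
  note family = this
  show ?thesis
  proof (intro conjI)
    show "CNL_borderenergetic (ccc_graph G) \<longleftrightarrow>
        G \<cong> grp_D 3 \<or> G \<cong> grp_D 11 \<or> (\<exists>n\<ge>2. G \<cong> grp_U n 2)"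
    proof
      assume border: "CNL_borderenergetic (ccc_graph G)"
      from family show "G \<cong> grp_D 3 \<or> G \<cong> grp_D 11 \<or> (\<exists>n\<ge>2. G \<cong> grp_U n 2)"
        by cases (use border D(2) T(2) SD(2) U(2) in blast)+
    next
      assume "G \<cong> grp_D 3 \<or> G \<cong> grp_D 11 \<or> (\<exists>n\<ge>2. G \<cong> grp_U n 2)"
      then show "CNL_borderenergetic (ccc_graph G)" using D(2)[of 3] D(2)[of 11] no_U2 by auto
    qed
    show "CNSL_borderenergetic (ccc_graph G) \<longleftrightarrow> G \<cong> grp_D 3 \<or> (\<exists>n\<ge>2. G \<cong> grp_U n 2)"
    proof
      assume border: "CNSL_borderenergetic (ccc_graph G)"
      from family show "G \<cong> grp_D 3 \<or> (\<exists>n\<ge>2. G \<cong> grp_U n 2)"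
        by cases (use border D(4) T(4) SD(4) U(4) in blast)+
    next
      assume "G \<cong> grp_D 3 \<or> (\<exists>n\<ge>2. G \<cong> grp_U n 2)"
      then show "CNSL_borderenergetic (ccc_graph G)" using D(4)[of 3] no_U2 by auto
    qed
    show "CNL_hyperenergetic (ccc_graph G) \<longleftrightarrow>
        (\<exists>n\<ge>13. G \<cong> grp_D n) \<or> (\<exists>n\<ge>7. G \<cong> grp_T n) \<or> (\<exists>n\<ge>4. G \<cong> grp_SD n) \<or>
        (\<exists>n\<ge>2. \<exists>m\<ge>2. G \<cong> grp_U n m \<and>
          \<not> (m = 3 \<or> (m = 5 \<and> n \<in> {2, 3}) \<or> m = 4 \<or> (m = 8 \<and> n = 2) \<or> m = 6))"
      (is "?hyper \<longleftrightarrow> ?list")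
    proof
      assume hyper: ?hyper
      from family show ?list
      proof cases
        case (D n) then show ?thesis using hyper dihedral_verdicts(1)[OF assms(1)] by blast
      next
        case (T n) then show ?thesis using hyper dicyclic_verdicts(1)[OF assms(1)] by blast
      next
        case (SD n) then show ?thesis using hyper semidihedral_verdicts(1)[OF assms(1)] by blast
      next
        case (U n m)
        with hyper semidirect_verdicts(1)[OF assms(1) U(3,1) U3[OF U(3,1,2)]] show ?thesis by blast
      qed
    next
      assume ?list
      then consider (D) n where "13 \<le> n" "G \<cong> grp_D n" | (T) n where "7 \<le> n" "G \<cong> grp_T n"
        | (SD) n where "4 \<le> n" "G \<cong> grp_SD n"
        | (U) n m where "2 \<le> n" "2 \<le> m" "G \<cong> grp_U n m"
          "\<not> (m = 3 \<or> (m = 5 \<and> n \<in> {2, 3}) \<or> m = 4 \<or> (m = 8 \<and> n = 2) \<or> m = 6)"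
        by blast
      then show ?hyper
      proof cases
        case (D n) then show ?thesis using dihedral_verdicts(1)[OF assms(1), of n] by simp
      next
        case (T n) then show ?thesis using dicyclic_verdicts(1)[OF assms(1), of n] by simp
      next
        case (SD n) then show ?thesis using semidihedral_verdicts(1)[OF assms(1), of n] by simp
      next
        case (U n m)
        with semidirect_verdicts(1)[OF assms(1) U(3,1) U3[OF U(3,1,2)]] show ?thesis by blast
      qed
    qed
    show "CNSL_hyperenergetic (ccc_graph G) \<longleftrightarrow>
        (\<exists>n\<ge>20. even n \<and> G \<cong> grp_D n) \<or> (\<exists>n\<ge>10. G \<cong> grp_T n) \<or> (\<exists>n\<ge>6. G \<cong> grp_SD n) \<or>
        (\<exists>n\<ge>2. \<exists>m\<ge>2. G \<cong> grp_U n m \<and>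
          \<not> (m = 3 \<or> (m \<in> {5, 7, 9} \<and> n = 2) \<or> (m = 5 \<and> n \<in> {3, 4}) \<or> m = 4 \<or>
             (m = 8 \<and> n = 2) \<or> m = 6 \<or> (m = 10 \<and> n = 2)))"
      (is "?hyper \<longleftrightarrow> ?list")
    proof
      assume hyper: ?hyper
      from family show ?list
      proof cases
        case (D n) then show ?thesis using hyper dihedral_verdicts(3)[OF assms(1)] by blast
      next
        case (T n) then show ?thesis using hyper dicyclic_verdicts(3)[OF assms(1)] by blast
      next
        case (SD n) then show ?thesis using hyper semidihedral_verdicts(3)[OF assms(1)] by blast
      next
        case (U n m)
        with hyper semidirect_verdicts(3)[OF assms(1) U(3,1) U3[OF U(3,1,2)]] show ?thesis by blast
      qed
    next
      assume ?list
      then consider (D) n where "20 \<le> n" "even n" "G \<cong> grp_D n" | (T) n where "10 \<le> n" "G \<cong> grp_T n"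
        | (SD) n where "6 \<le> n" "G \<cong> grp_SD n"
        | (U) n m where "2 \<le> n" "2 \<le> m" "G \<cong> grp_U n m"
          "\<not> (m = 3 \<or> (m \<in> {5, 7, 9} \<and> n = 2) \<or> (m = 5 \<and> n \<in> {3, 4}) \<or> m = 4 \<or>
             (m = 8 \<and> n = 2) \<or> m = 6 \<or> (m = 10 \<and> n = 2))"
        by blast
      then show ?hyper
      proof cases
        case (D n) then show ?thesis using dihedral_verdicts(3)[OF assms(1), of n] by simp
      next
        case (T n) then show ?thesis using dicyclic_verdicts(3)[OF assms(1), of n] by simp
      next
        case (SD n) then show ?thesis using semidihedral_verdicts(3)[OF assms(1), of n] by simp
      next
        case (U n m)
        with semidirect_verdicts(3)[OF assms(1) U(3,1) U3[OF U(3,1,2)]] show ?thesis by blast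
      qed
    qed
  qed
qed

end
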